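(* Consider the cascade dynamics $$\dot r(t)=-(L(\mathcal{G})\otimes I_d)\,r(t),$$ $$\begin{bmatrix}\dot p_0(t)\\ \dot p_f(t)\end{bmatrix}=\begin{bmatrix}-\mathcal{O}(\mathcal{G}_0,c_0(t))^T\big(\mathcal{O}(\mathcal{G}_0,c_0(t))c_0(t)-\mathbf{d}_0^2\big)\\ 0\end{bmatrix}-PQP^T\begin{bmatrix}c_0(t)\\ c_f(t)\end{bmatrix},\qquad \begin{bmatrix}c_0(t)\\ c_f(t)\end{bmatrix}=P(p(t)-r(t)),$$ and let $\mathbf{r}^\star=\mathbf{1}_{|\mathcal{V}|}\otimes\big(\tfrac{1}{|\mathcal{V}|}(\mathbf{1}^T\otimes I_d)r(0)\big)$. Assume that $\mathcal{G}$ is connected and that $(\mathcal{G},p^\star-\mathbf{r}^\star)$ is a $\tau(\Gamma)$-symmetric isostatic framework whose symmetry is free, with desired distances those of this framework. Assume also that the subgraph $\mathcal{G}(\Gamma_i)$ induced by each vertex orbit $\Gamma_i$ is connected and that the matrices $E(\Gamma_i)$ are constructed using only the edges of a spanning tree of $\mathcal{G}(\Gamma_i)$. Then for all initial conditions $(p(0),r(0))$ sufficiently close to $(p^\star,\mathbf{r}^\star)$, $p(t)$ converges exponentially to $p^\star$.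
   Context: Graph and symmetry. $\mathcal{G}=(\mathcal{V},\mathcal{E})$ is a finite simple graph and $\Gamma$ is a subgroup of $\mathrm{Aut}(\mathcal{G})$. The symmetry is free: $\gamma(i)\neq i$ for all $i\in\mathcal{V}$ and all non-identity $\gamma\in\Gamma$. $\tau:\Gamma\to O(\mathbb{R}^d)$ is a homomorphism into the orthogonal group. A framework $(\mathcal{G},p)$, $p:\mathcal{V}\to\mathbb{R}^d$ (also viewed as a point of $\mathbb{R}^{d|\mathcal{V}|}$), is $\tau(\Gamma)$-symmetric if $\tau(\gamma)p_i=p_{\gamma(i)}$ for all $\gamma\in\Gamma$, $i\in\mathcal{V}$. $L(\mathcal{G})$ is the combinatorial graph Laplacian of $\mathcal{G}$, and $r(t)=(r_i(t))_{i\in\mathcal{V}}$, $r_i(t)\in\mathbb{R}^d$, is a virtual state (centroid estimates). Symmetric isostaticity. An infinitesimal motion of $(\mathcal{G},p)$ is $u:\mathcal{V}\to\mathbb{R}^d$ with $\langle p_i-p_j,u_i-u_j\rangle=0$ for all $ij\in\mathcal{E}$; it is trivial if there are a skew-symmetric matrix $S$ and a vector $c$ with $u_i=Sp_i+c$ for all $i$; it is $\tau(\Gamma)$-symmetric if $\tau(\gamma)u_i=u_{\gamma(i)}$ for all $\gamma,i$. A self-stress is $\omega:\mathcal{E}\to\mathbb{R}$ with $\sum_{j:ij\in\mathcal{E}}\omega_{ij}(p_i-p_j)=0$ for every $i$; it is $\tau(\Gamma)$-symmetric if $\omega_{\gamma(e)}=\omega_e$ for all $\gamma\in\Gamma$,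 $e\in\mathcal{E}$. A $\tau(\Gamma)$-symmetric framework is $\tau(\Gamma)$-symmetric isostatic if every $\tau(\Gamma)$-symmetric infinitesimal motion is trivial and it has no non-zero $\tau(\Gamma)$-symmetric self-stress. Orbits. The vertex orbit of $i$ is $\Gamma_i=\{\gamma(i):\gamma\in\Gamma\}$; the edge orbit of $ij$ is $\{\gamma(i)\gamma(j):\gamma\in\Gamma\}$. $\mathcal{V}_0$ is a set of representatives, one for each vertex orbit. $\mathcal{E}_0$ is a set of representatives, one for each edge orbit, each of the form $i\gamma(j)$ with $i,j\in\mathcal{V}_0$, $\gamma\in\Gamma$. For $u,v$ in the same vertex orbit, $\gamma_{uv}$ is the (unique) element of $\Gamma$ with $\gamma_{uv}(u)=v$. The quotient $\Gamma$-gain graph $\mathcal{G}_0=(\mathcal{V}_0,\mathcal{E}_0)$ has a directed edge $((i,j);\gamma)$ for each edge orbit representative $i\gamma(j)$. Orbit rigidity matrix. $\mathcal{O}(\mathcal{G}_0,\bar p)$ is the $|\mathcal{E}_0|\times d|\mathcal{V}_0|$ matrix whose row for $((i,j);\gamma)$ with $i\neq j$ has $(\bar p_i-\tau(\gamma)\bar p_j)^T$ in the columns of $i$, $(\bar p_j-\tau(\gamma)^{-1}\bar p_i)^T$ in the columns of $j$, zeros elsewhere; the row for a loop $((i,i);\gamma)$ has $(2\bar p_i-\tau(\gamma)\bar p_i-\tau(\gamma)^{-1}\bar p_i)^T$ in the columns of $i$, zeros elsewhere. Dynamics. Vertices of the same orbit are consecutive in $p$. $P$ is the permutation matrix with $Pp=(p_0^T,p_f^T)^T$,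 where $p_0$ is the restriction of $p$ to $\mathcal{V}_0$ and $p_f$ the remaining agents. $\mathbf{d}_0^2$ is the vector with entry $\|q_i-q_{\gamma(j)}\|^2$, $q=p^\star-\mathbf{r}^\star$, for each edge $i\gamma(j)\in\mathcal{E}_0$. $E(\Gamma_i)$ has $d\times d$ blocks, block rows indexed by $\Gamma_i$ and block columns by the (arbitrarily oriented) edges of the chosen spanning tree of $\mathcal{G}(\Gamma_i)$: for an edge $k$ from $u$ to $v$, $[E(\Gamma_i)]_{uk}=I$, $[E(\Gamma_i)]_{vk}=-\tau(\gamma_{uv})$, other blocks $0$. $\bar E(\Gamma)$ is block-diagonal with blocks $E(\Gamma_i)$, $i\in\mathcal{V}_0$, and $Q=\bar E(\Gamma)\bar E(\Gamma)^T$.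
   Formalization: Rigidly moved copies of p* that respect the symmetry are equilibria near p*, so p(t) is shown to converge exponentially to a nearby symmetric rigid image of p*; the limit is p* itself when p*−r* has no non-zero symmetric trivial infinitesimal motion. *)

theory Defs
  imports "HOL-Analysis.Analysis" "HOL-Algebra.Group"
begin

text \<open>
  Conventions. The vertex set is the finite type \<open>'v\<close>; an edge is a two-element set \<open>{i, j}\<close> of
  vertices. Ambient space is \<open>real ^ 'd\<close>, and configurations, velocities and virtual states are
  elements of \<open>real ^ 'd ^ 'v\<close>, with the Euclidean norm of the stacked vector. Since block vectors
  are indexed by vertices instead of positions, the permutation matrix \<open>P\<close>, which only moves the
  blocks of the orbit representatives to the front, is the identity map in this representation.
\<close>

type_synonym ('d, 'v) config = "((real, 'd) vec, 'v) vec"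


subsection \<open>Graphs\<close>

definition simple_graph :: "'v set set \<Rightarrow> bool" where
  "simple_graph E \<longleftrightarrow> (\<forall>e\<in>E. card e = 2)"

definition adj_rel :: "'v set set \<Rightarrow> ('v \<times> 'v) set" where
  "adj_rel F = {(u, v). {u, v} \<in> F}"

definition connected_graph :: "'v set \<Rightarrow> 'v set set \<Rightarrow> bool" where
  "connected_graph S F \<longleftrightarrow> S \<noteq> {} \<and> (\<forall>u\<in>S. \<forall>v\<in>S. (u, v) \<in> (adj_rel F)\<^sup>*)"

definition induced_edges :: "'v set set \<Rightarrow> 'v set \<Rightarrow> 'v set set" where
  "induced_edges E S = {e \<in> E. e \<subseteq> S}"

definition is_cycle :: "'v set set \<Rightarrow> 'v list \<Rightarrow> bool" where
  "is_cycle F xs \<longleftrightarrow> 3 \<le> length xs \<and> distinct xs \<and>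
     (\<forall>k<length xs. {xs ! k, xs ! (Suc k mod length xs)} \<in> F)"

definition is_spanning_tree :: "'v set \<Rightarrow> 'v set set \<Rightarrow> 'v set set \<Rightarrow> bool" where
  "is_spanning_tree S F F' \<longleftrightarrow> F' \<subseteq> F \<and> connected_graph S F' \<and> (\<nexists>xs. is_cycle F' xs)"

text \<open>A set of ordered pairs consisting of one orientation of each edge of a spanning tree.\<close>

definition oriented_spanning_tree :: "'v set \<Rightarrow> 'v set set \<Rightarrow> ('v \<times> 'v) set \<Rightarrow> bool" where
  "oriented_spanning_tree S F T \<longleftrightarrow>
     inj_on (\<lambda>(u, v). {u, v}) T \<and> is_spanning_tree S F ((\<lambda>(u, v). {u, v}) ` T)"

definition laplacian :: "('v::finite) set set \<Rightarrow> real ^ 'v ^ 'v" where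
  "laplacian E = (\<chi> i j. if i = j then real (card {k. {i, k} \<in> E})
                         else if {i, j} \<in> E then - 1 else 0)"

text \<open>The product \<open>(M \<otimes> I\<^sub>d) x\<close>.\<close>

definition kron_id_mult ::
    "real ^ 'v ^ 'v \<Rightarrow> ('d::finite, 'v::finite) config \<Rightarrow> ('d, 'v) config" where
  "kron_id_mult M x = (\<chi> i. \<Sum>j\<in>UNIV. M $ i $ j *\<^sub>R x $ j)"

text \<open>The vector \<open>1 \<otimes> ((1/|V|) (1\<^sup>T \<otimes> I\<^sub>d) x)\<close>.\<close>

definition consensus :: "('d::finite, 'v::finite) config \<Rightarrow> ('d, 'v) config" where
  "consensus x = (\<chi> i. (1 / real CARD('v)) *\<^sub>R (\<Sum>j\<in>UNIV. x $ j))"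


subsection \<open>Symmetry\<close>

definition aut_group :: "'v set set \<Rightarrow> ('v \<Rightarrow> 'v) monoid" where
  "aut_group E = \<lparr>carrier = {f. bij f \<and> (\<forall>u v. {f u, f v} \<in> E \<longleftrightarrow> {u, v} \<in> E)},
                  mult = (\<circ>), one = id\<rparr>"

definition orthogonal_group :: "(real ^ 'd ^ 'd::finite) monoid" where
  "orthogonal_group = \<lparr>carrier = {A. orthogonal_matrix A}, mult = (**), one = mat 1\<rparr>"

definition free_action :: "('v \<Rightarrow> 'v) set \<Rightarrow> bool" where
  "free_action \<Gamma> \<longleftrightarrow> (\<forall>\<gamma>\<in>\<Gamma>. \<gamma> \<noteq> id \<longrightarrow> (\<forall>i. \<gamma> i \<noteq> i))"

definition vertex_orbit :: "('v \<Rightarrow> 'v) set \<Rightarrow> 'v \<Rightarrow> 'v set" where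
  "vertex_orbit \<Gamma> i = {\<gamma> i | \<gamma>. \<gamma> \<in> \<Gamma>}"

definition edge_orbit :: "('v \<Rightarrow> 'v) set \<Rightarrow> 'v set \<Rightarrow> 'v set set" where
  "edge_orbit \<Gamma> e = {\<gamma> ` e | \<gamma>. \<gamma> \<in> \<Gamma>}"

definition connecting_sym :: "('v \<Rightarrow> 'v) set \<Rightarrow> 'v \<Rightarrow> 'v \<Rightarrow> ('v \<Rightarrow> 'v)" where
  "connecting_sym \<Gamma> u v = (THE \<gamma>. \<gamma> \<in> \<Gamma> \<and> \<gamma> u = v)"

text \<open>Used both for symmetric frameworks and for symmetric infinitesimal motions.\<close>

definition sym_config ::
    "('v \<Rightarrow> 'v) set \<Rightarrow> (('v \<Rightarrow> 'v) \<Rightarrow> real ^ 'd ^ 'd) \<Rightarrow> ('d::finite, 'v::finite) config \<Rightarrow> bool" where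
  "sym_config \<Gamma> \<tau> x \<longleftrightarrow> (\<forall>\<gamma>\<in>\<Gamma>. \<forall>i. \<tau> \<gamma> *v (x $ i) = x $ (\<gamma> i))"


subsection \<open>Symmetric isostaticity\<close>

definition inf_motion ::
    "'v set set \<Rightarrow> ('d::finite, 'v::finite) config \<Rightarrow> ('d, 'v) config \<Rightarrow> bool" where
  "inf_motion E p u \<longleftrightarrow> (\<forall>i j. {i, j} \<in> E \<longrightarrow> (p $ i - p $ j) \<bullet> (u $ i - u $ j) = 0)"

definition trivial_motion ::
    "('d::finite, 'v::finite) config \<Rightarrow> ('d, 'v) config \<Rightarrow> bool" where
  "trivial_motion p u \<longleftrightarrow> (\<exists>(S :: real ^ 'd ^ 'd) c. transpose S = - S \<and> (\<forall>i. u $ i = S *v (p $ i) + c))"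

definition self_stress ::
    "'v set set \<Rightarrow> ('d::finite, 'v::finite) config \<Rightarrow> ('v set \<Rightarrow> real) \<Rightarrow> bool" where
  "self_stress E p \<omega> \<longleftrightarrow> (\<forall>i. (\<Sum>j | {i, j} \<in> E. \<omega> {i, j} *\<^sub>R (p $ i - p $ j)) = 0)"

definition sym_stress :: "('v \<Rightarrow> 'v) set \<Rightarrow> 'v set set \<Rightarrow> ('v set \<Rightarrow> real) \<Rightarrow> bool" where
  "sym_stress \<Gamma> E \<omega> \<longleftrightarrow> (\<forall>\<gamma>\<in>\<Gamma>. \<forall>e\<in>E. \<omega> (\<gamma> ` e) = \<omega> e)"

definition sym_isostatic ::
    "'v set set \<Rightarrow> ('v \<Rightarrow> 'v) set \<Rightarrow> (('v \<Rightarrow> 'v) \<Rightarrow> real ^ 'd ^ 'd) \<Rightarrow>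
     ('d::finite, 'v::finite) config \<Rightarrow> bool" where
  "sym_isostatic E \<Gamma> \<tau> p \<longleftrightarrow>
     sym_config \<Gamma> \<tau> p \<and>
     (\<forall>u. inf_motion E p u \<and> sym_config \<Gamma> \<tau> u \<longrightarrow> trivial_motion p u) \<and>
     (\<forall>\<omega>. self_stress E p \<omega> \<and> sym_stress \<Gamma> E \<omega> \<longrightarrow> (\<forall>e\<in>E. \<omega> e = 0))"


subsection \<open>Quotient gain graph and orbit rigidity matrix\<close>

definition vertex_reps :: "('v \<Rightarrow> 'v) set \<Rightarrow> 'v set \<Rightarrow> bool" where
  "vertex_reps \<Gamma> V0 \<longleftrightarrow> (\<forall>i. \<exists>!v. v \<in> V0 \<and> v \<in> vertex_orbit \<Gamma> i)"

text \<open>A triple \<open>(i, j, \<gamma>)\<close> is the directed edge \<open>((i, j); \<gamma>)\<close> of the gain graph.\<close>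

type_synonym 'v gain_edge = "'v \<times> 'v \<times> ('v \<Rightarrow> 'v)"

definition lift_edge :: "'v gain_edge \<Rightarrow> 'v set" where
  "lift_edge = (\<lambda>(i, j, \<gamma>). {i, \<gamma> j})"

definition edge_reps ::
    "'v set set \<Rightarrow> ('v \<Rightarrow> 'v) set \<Rightarrow> 'v set \<Rightarrow> 'v gain_edge set \<Rightarrow> bool" where
  "edge_reps E \<Gamma> V0 E0 \<longleftrightarrow>
     E0 \<subseteq> V0 \<times> V0 \<times> \<Gamma> \<and> (\<forall>x\<in>E0. lift_edge x \<in> E) \<and>
     (\<forall>e\<in>E. \<exists>!x. x \<in> E0 \<and> lift_edge x \<in> edge_orbit \<Gamma> e)"

text \<open>The \<open>1 \<times> d\<close> block of the orbit rigidity matrix in row \<open>((i, j); \<gamma>)\<close> and the columns of \<open>k\<close>.\<close>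

definition orbit_block ::
    "(('v \<Rightarrow> 'v) \<Rightarrow> real ^ 'd ^ 'd) \<Rightarrow> ('d::finite, 'v::finite) config \<Rightarrow> 'v gain_edge \<Rightarrow> 'v \<Rightarrow> real ^ 'd" where
  "orbit_block \<tau> p = (\<lambda>(i, j, \<gamma>) k.
     if i = j then
       (if k = i then 2 *\<^sub>R p $ i - \<tau> \<gamma> *v (p $ i) - matrix_inv (\<tau> \<gamma>) *v (p $ i) else 0)
     else
       (if k = i then p $ i - \<tau> \<gamma> *v (p $ j)
        else if k = j then p $ j - matrix_inv (\<tau> \<gamma>) *v (p $ i)
        else 0))"

text \<open>Products with the orbit rigidity matrix and with its transpose. Only the components of
  configurations at the vertices in \<open>V0\<close> enter.\<close>

definition orbit_mult ::
    "'v set \<Rightarrow> (('v \<Rightarrow> 'v) \<Rightarrow> real ^ 'd ^ 'd) \<Rightarrow> ('d::finite, 'v::finite) config \<Rightarrow>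
     ('d, 'v) config \<Rightarrow> 'v gain_edge \<Rightarrow> real" where
  "orbit_mult V0 \<tau> p x e = (\<Sum>k\<in>V0. orbit_block \<tau> p e k \<bullet> x $ k)"

definition orbit_transpose_mult ::
    "'v gain_edge set \<Rightarrow> (('v \<Rightarrow> 'v) \<Rightarrow> real ^ 'd ^ 'd) \<Rightarrow> ('d::finite, 'v::finite) config \<Rightarrow>
     ('v gain_edge \<Rightarrow> real) \<Rightarrow> 'v \<Rightarrow> real ^ 'd" where
  "orbit_transpose_mult E0 \<tau> p y k = (\<Sum>e\<in>E0. y e *\<^sub>R orbit_block \<tau> p e k)"

definition orbit_dist_sq :: "('d::finite, 'v::finite) config \<Rightarrow> 'v gain_edge \<Rightarrow> real" where
  "orbit_dist_sq q = (\<lambda>(i, j, \<gamma>). (norm (q $ i - q $ \<gamma> j))\<^sup>2)"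


subsection \<open>The symmetry-forcing matrix Q\<close>

text \<open>\<open>tree_block \<Gamma> \<tau> w k\<close> is the block of \<open>E(\<Gamma>\<^sub>i)\<close> in block row \<open>w\<close> and block column
  \<open>k = (u, v)\<close>.\<close>

definition tree_block ::
    "('v \<Rightarrow> 'v) set \<Rightarrow> (('v \<Rightarrow> 'v) \<Rightarrow> real ^ 'd ^ 'd) \<Rightarrow> 'v \<Rightarrow> 'v \<times> 'v \<Rightarrow> real ^ 'd ^ 'd::finite" where
  "tree_block \<Gamma> \<tau> w = (\<lambda>(u, v). if w = u then mat 1
                              else if w = v then - \<tau> (connecting_sym \<Gamma> u v) else 0)"

text \<open>The block-diagonal matrix with blocks \<open>E(\<Gamma>\<^sub>i)\<close>, \<open>i \<in> V0\<close>; a block column is a pair \<open>(i, k)\<close>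
  with \<open>k\<close> in the tree \<open>T i\<close> chosen for the orbit of \<open>i\<close>.\<close>

definition Ebar ::
    "('v \<Rightarrow> 'v) set \<Rightarrow> (('v \<Rightarrow> 'v) \<Rightarrow> real ^ 'd ^ 'd) \<Rightarrow> 'v \<Rightarrow> 'v \<times> ('v \<times> 'v) \<Rightarrow> real ^ 'd ^ 'd::finite" where
  "Ebar \<Gamma> \<tau> w = (\<lambda>(i, k). if w \<in> vertex_orbit \<Gamma> i then tree_block \<Gamma> \<tau> w k else 0)"

definition Q_block ::
    "('v \<Rightarrow> 'v) set \<Rightarrow> (('v \<Rightarrow> 'v) \<Rightarrow> real ^ 'd ^ 'd) \<Rightarrow> 'v set \<Rightarrow> ('v \<Rightarrow> ('v \<times> 'v) set) \<Rightarrow>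
     'v \<Rightarrow> 'v \<Rightarrow> real ^ 'd ^ 'd::finite" where
  "Q_block \<Gamma> \<tau> V0 T w z =
     (\<Sum>x\<in>Sigma V0 T. Ebar \<Gamma> \<tau> w x ** transpose (Ebar \<Gamma> \<tau> z x))"

definition Q_mult ::
    "('v \<Rightarrow> 'v) set \<Rightarrow> (('v \<Rightarrow> 'v) \<Rightarrow> real ^ 'd ^ 'd) \<Rightarrow> 'v set \<Rightarrow> ('v \<Rightarrow> ('v \<times> 'v) set) \<Rightarrow>
     ('d::finite, 'v::finite) config \<Rightarrow> ('d, 'v) config" where
  "Q_mult \<Gamma> \<tau> V0 T c = (\<chi> w. \<Sum>z\<in>UNIV. Q_block \<Gamma> \<tau> V0 T w z *v (c $ z))"


subsection \<open>Cascade dynamics\<close>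

definition formation_field ::
    "('v \<Rightarrow> 'v) set \<Rightarrow> (('v \<Rightarrow> 'v) \<Rightarrow> real ^ 'd ^ 'd) \<Rightarrow> 'v set \<Rightarrow> 'v gain_edge set \<Rightarrow>
     ('v \<Rightarrow> ('v \<times> 'v) set) \<Rightarrow> ('v gain_edge \<Rightarrow> real) \<Rightarrow>
     ('d::finite, 'v::finite) config \<Rightarrow> ('d, 'v) config" where
  "formation_field \<Gamma> \<tau> V0 E0 T dsq c =
     (\<chi> i. if i \<in> V0
           then - orbit_transpose_mult E0 \<tau> c (\<lambda>e. orbit_mult V0 \<tau> c c e - dsq e) i
           else 0)
     - Q_mult \<Gamma> \<tau> V0 T c"

definition cascade_solution ::
    "'v set set \<Rightarrow> ('v \<Rightarrow> 'v) set \<Rightarrow> (('v \<Rightarrow> 'v) \<Rightarrow> real ^ 'd ^ 'd) \<Rightarrow> 'v set \<Rightarrow> 'v gain_edge set \<Rightarrow>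
     ('v \<Rightarrow> ('v \<times> 'v) set) \<Rightarrow> ('v gain_edge \<Rightarrow> real) \<Rightarrow>
     (real \<Rightarrow> ('d::finite, 'v::finite) config) \<Rightarrow> (real \<Rightarrow> ('d, 'v) config) \<Rightarrow> bool" where
  "cascade_solution E \<Gamma> \<tau> V0 E0 T dsq p r \<longleftrightarrow>
     (\<forall>t\<ge>0.
        (r has_vector_derivative - kron_id_mult (laplacian E) (r t)) (at t within {0..}) \<and>
        (p has_vector_derivative formation_field \<Gamma> \<tau> V0 E0 T dsq (p t - r t)) (at t within {0..}))"


subsection \<open>The target formation\<close>

text \<open>
  The vector field depends on \<open>q\<close> only through the lengths of the edges, so every image of \<open>q\<close> under
  a rigid motion \<open>x \<mapsto> A x + b\<close> that commutes with all \<open>\<tau> \<gamma>\<close> is an equilibrium as well. As in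
  distance-based formation control in general, convergence to the target is therefore convergence
  up to these motions; the limit is the given target itself when \<open>sym_pinned\<close> holds.
\<close>

definition sym_rigid_image ::
    "('v \<Rightarrow> 'v) set \<Rightarrow> (('v \<Rightarrow> 'v) \<Rightarrow> real ^ 'd ^ 'd) \<Rightarrow>
     ('d::finite, 'v::finite) config \<Rightarrow> ('d, 'v) config \<Rightarrow> bool" where
  "sym_rigid_image \<Gamma> \<tau> q q' \<longleftrightarrow>
     (\<exists>(A :: real ^ 'd ^ 'd) b. rotation_matrix A \<and>
        (\<forall>\<gamma>\<in>\<Gamma>. A ** \<tau> \<gamma> = \<tau> \<gamma> ** A \<and> \<tau> \<gamma> *v b = b) \<and>
        (\<forall>i. q' $ i = A *v (q $ i) + b))"

definition sym_pinned ::
    "('v \<Rightarrow> 'v) set \<Rightarrow> (('v \<Rightarrow> 'v) \<Rightarrow> real ^ 'd ^ 'd) \<Rightarrow> ('d::finite, 'v::finite) config \<Rightarrow> bool" where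
  "sym_pinned \<Gamma> \<tau> q \<longleftrightarrow> (\<forall>u. trivial_motion q u \<and> sym_config \<Gamma> \<tau> u \<longrightarrow> u = 0)"

end

theory Submission
  imports Defs "HOL-Real_Asymp.Real_Asymp"
begin

text \<open>
  Write \<open>q = pstar - rstar\<close>, \<open>c = p - r\<close> and \<open>s = r - rstar\<close>. For an edge representative
  \<open>e = (i, j, \<gamma>)\<close> both kinds of rows of the orbit rigidity matrix express one symmetric bilinear form
  \<open>B\<close>, with \<open>B c x $ e = (c $ i - \<tau> \<gamma> *v c $ j) \<bullet> (x $ i - \<tau> \<gamma> *v x $ j)\<close>, and \<open>Q\<close> is
  \<open>adjoint D \<circ> D\<close> for the linear map \<open>D\<close> that measures, along the tree edges, how far a configuration
  is from being symmetric. The vector field is therefore \<open>- grad V\<close> for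
  \<open>V c = |D c|\<^sup>2 / 2 + |B c c - B q q|\<^sup>2 / 4\<close>, and \<open>c\<close> follows this gradient flow with the input
  \<open>L s\<close>, where \<open>s\<close> obeys the consensus flow and decays exponentially because the graph is connected.

  The kernel of \<open>D\<close> consists of the symmetric configurations: every orbit carries a connected tree, and
  freeness makes the group element between two vertices unique. If there is no symmetric self-stress,
  the constraints \<open>D c = 0\<close>, \<open>B c c = B q q\<close> are regular at \<open>q\<close>
  (\<open>edge_form_nondegenerate\<close>), so \<open>|grad V|\<^sup>2 \<ge> k V\<close> near \<open>q\<close> (\<open>polyak_lojasiewicz\<close>). This
  inequality needs no isolated minimum. Along the flow \<open>V (c t) + m |s t|\<^sup>2\<close> then decays
  exponentially as long as \<open>c\<close> remains near \<open>q\<close>; so does the speed of \<open>c\<close>, whose path is short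
  enough to remain there forever and to converge to some \<open>l\<close> with \<open>V l = 0\<close>
  (\<open>perturbed_gradient_flow_converges\<close>). The same a priori bound turns solutions of a globally
  Lipschitz truncation of the system into solutions of the system itself, which gives existence.

  Symmetric infinitesimal rigidity enters only to identify \<open>l\<close> as a rigid image of \<open>q\<close>
  (\<open>symmetric_local_rigidity\<close>). Averaging over the group shows that a symmetric trivial motion is
  generated by a skew matrix commuting with the symmetry and a fixed vector. Moving \<open>l\<close> back by the
  commuting rigid motion under which \<open>q\<close> is nearest to \<open>l\<close> makes the difference to \<open>q\<close> orthogonal to
  all these motions, and transversally to them the constraint equations have \<open>q\<close> as their only solution
  near \<open>q\<close>. When the target is pinned there are no such motions and the argument applies to \<open>l\<close>
  directly.
\<close>

section \<open>Global solutions and exponential decay\<close>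

lemma integral_has_vector_derivative_atLeast:
  fixes g :: "real \<Rightarrow> 'a::banach"
  assumes "continuous_on UNIV g" "0 \<le> t"
  shows "((\<lambda>u. integral {0..u} g) has_vector_derivative g t) (at t within {0..})"
proof -
  have "((\<lambda>u. integral {0..u} g) has_vector_derivative g t) (at t within {0..t+1})"
    using assms by (intro integral_has_vector_derivative) (auto intro: continuous_on_subset)
  moreover have "at t within {0..t+1} = at t within {0..}"
    by (rule at_within_nhd[of _ "{..<t+1}"]) (use assms in auto)
  ultimately show ?thesis by simp
qed

text \<open>
  This is what makes the Picard operator a contraction: in the norm weighted by \<open>exp (- a t)\<close>
  integration costs only a factor \<open>1 / a\<close>, uniformly in the length of the time interval.
\<close>

lemma weighted_integral_bound:
  fixes g :: "real \<Rightarrow> 'a::banach"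
  assumes g: "continuous_on UNIV g" and a: "a > 0" and t: "0 \<le> t"
    and bound: "\<And>s. 0 \<le> s \<Longrightarrow> norm (g s) \<le> c * exp (a * s)"
  shows "norm (exp (- (a * t)) *\<^sub>R integral {0..t} g) \<le> c / a"
proof -
  have c: "c \<ge> 0" using order_trans[OF norm_ge_zero bound[of 0]] by simp
  have int: "((\<lambda>s. c * exp (a * s)) has_integral (c / a * exp (a * t) - c / a * exp (a * 0))) {0..t}"
    using a t by (intro fundamental_theorem_of_calculus)
      (auto intro!: derivative_eq_intros simp flip: has_real_derivative_iff_has_vector_derivative)
  have "norm (integral {0..t} g) \<le> integral {0..t} (\<lambda>s. c * exp (a * s))"
    using g int bound by (intro integral_norm_bound_integral)
      (auto intro!: integrable_continuous_real continuous_intros intro: continuous_on_subset)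
  also have "\<dots> \<le> c / a * exp (a * t)"
    unfolding integral_unique[OF int] using a c by simp
  finally have "exp (- (a * t)) * norm (integral {0..t} g) \<le> exp (- (a * t)) * (c / a * exp (a * t))"
    by (intro mult_left_mono) auto
  also have "\<dots> = c / a" by (simp add: exp_minus)
  finally show ?thesis by simp
qed

text \<open>
  With the weight \<open>exp (- 2 k t)\<close> the Picard operator has contraction factor \<open>1/2\<close> on the bounded
  continuous functions on the whole half-line, so a single fixed point gives a solution for all times and
  no local solutions have to be glued. The unknown \<open>u\<close> of the fixed-point problem is the rescaled
  increment \<open>exp (- 2 k t) (z t - z0)\<close>.
\<close>

theorem lipschitz_ode_global_solution:
  fixes f :: "'a::banach \<Rightarrow> 'a"
  assumes lip: "\<And>x y. norm (f x - f y) \<le> K * norm (x - y)"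
  shows "\<exists>z. z 0 = z0 \<and> (\<forall>t\<ge>0. (z has_vector_derivative f (z t)) (at t within {0..}))"
proof -
  define k where "k = max K 1"
  have k: "k > 0" and lipk: "norm (f x - f y) \<le> k * norm (x - y)" for x y
    using lip[of x y] mult_right_mono[of K k "norm (x - y)"] by (auto simp: k_def)
  define a where "a = 2 * k"
  have a: "a > 0" using k by (simp add: a_def)
  have "k-lipschitz_on UNIV f"
    using k lipk by (intro lipschitz_onI) (auto simp: dist_norm)
  then have contf: "continuous_on UNIV f"
    by (rule lipschitz_on_continuous_on)
  define g where "g u s = f (z0 + exp (a * s) *\<^sub>R apply_bcontfun u s)" for u s
  have contg: "continuous_on UNIV (g u)" for u
    unfolding g_def by (intro continuous_on_compose2[OF contf] continuous_intros) auto
  define \<Phi> where "\<Phi> u t = exp (- (a * max t 0)) *\<^sub>R integral {0..max t 0} (g u)" for u t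
  have \<Phi>_bcontfun: "\<Phi> u \<in> bcontfun" for u
  proof (rule bcontfun_normI)
    have "continuous_on {0..} (\<lambda>t. integral {0..t} (g u))"
      using integral_has_vector_derivative_atLeast[OF contg]
      by (auto simp: continuous_on_eq_continuous_within intro: has_vector_derivative_continuous)
    then show "continuous_on UNIV (\<Phi> u)"
      unfolding \<Phi>_def
      by (intro continuous_intros continuous_on_compose2[where f = "\<lambda>t. max t 0"]) auto
    fix t
    have "norm (g u s) \<le> (norm (f z0) + k * norm u) * exp (a * s)" if "0 \<le> s" for s
    proof -
      have "norm (g u s) \<le> norm (f z0) + norm (g u s - f z0)"
        by (rule norm_triangle_sub)
      also have "norm (g u s - f z0) \<le> k * (exp (a * s) * norm (apply_bcontfun u s))"
        unfolding g_def using lipk[of "z0 + exp (a * s) *\<^sub>R apply_bcontfun u s" z0] by simp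
      also have "\<dots> \<le> k * (exp (a * s) * norm u)"
        using k by (intro mult_left_mono norm_bounded) auto
      also have "norm (f z0) \<le> norm (f z0) * exp (a * s)"
        using a that by (simp add: mult_le_cancel_left1)
      finally show ?thesis by (simp add: algebra_simps)
    qed
    then show "norm (\<Phi> u t) \<le> (norm (f z0) + k * norm u) / a"
      unfolding \<Phi>_def by (intro weighted_integral_bound contg a) auto
  qed
  have "\<exists>!u. Bcontfun (\<Phi> u) = u"
  proof (rule banach_fix_type[where c = "1/2"])
    show "\<forall>u v. dist (Bcontfun (\<Phi> u)) (Bcontfun (\<Phi> v)) \<le> 1 / 2 * dist u v"
    proof (intro allI dist_bound)
      fix u v t
      have "norm (g u s - g v s) \<le> (k * dist u v) * exp (a * s)" for s
      proof -
        have "norm (g u s - g v s) \<le> k * (exp (a * s) * dist (apply_bcontfun u s) (apply_bcontfun v s))"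
          unfolding g_def
          using lipk[of "z0 + exp (a * s) *\<^sub>R apply_bcontfun u s" "z0 + exp (a * s) *\<^sub>R apply_bcontfun v s"]
          by (simp add: dist_norm flip: scaleR_diff_right)
        also have "\<dots> \<le> k * (exp (a * s) * dist u v)"
          using k by (intro mult_left_mono dist_bounded) auto
        finally show ?thesis by (simp add: mult_ac)
      qed
      then have "norm (exp (- (a * max t 0)) *\<^sub>R integral {0..max t 0} (\<lambda>s. g u s - g v s)) \<le> k * dist u v / a"
        by (intro weighted_integral_bound a continuous_on_diff contg) auto
      also have "integral {0..max t 0} (\<lambda>s. g u s - g v s) = integral {0..max t 0} (g u) - integral {0..max t 0} (g v)"
        by (intro Henstock_Kurzweil_Integration.integral_diff integrable_continuous_real
              continuous_on_subset[OF contg]) auto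
      finally have "dist (\<Phi> u t) (\<Phi> v t) \<le> k * dist u v / a"
        by (simp add: \<Phi>_def dist_norm scaleR_diff_right)
      also have "\<dots> = 1 / 2 * dist u v"
        using k by (simp add: a_def)
      finally show "dist (apply_bcontfun (Bcontfun (\<Phi> u)) t) (apply_bcontfun (Bcontfun (\<Phi> v)) t) \<le> 1 / 2 * dist u v"
        by (simp add: Bcontfun_inverse[OF \<Phi>_bcontfun])
    qed
  qed auto
  then obtain u where "Bcontfun (\<Phi> u) = u" by auto
  then have u: "apply_bcontfun u = \<Phi> u"
    using Bcontfun_inverse[OF \<Phi>_bcontfun[of u]] by simp
  define z where "z t = z0 + integral {0..t} (g u)" for t
  have z: "f (z t) = g u t" if "0 \<le> t" for t
  proof -
    have "exp (a * t) *\<^sub>R \<Phi> u t = integral {0..t} (g u)"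
      using that by (simp add: \<Phi>_def exp_minus)
    then show ?thesis unfolding z_def g_def[of u t] u by simp
  qed
  show ?thesis
  proof (intro exI[of _ z] conjI allI impI)
    show "z 0 = z0" by (simp add: z_def)
    fix t :: real assume t: "0 \<le> t"
    then show "(z has_vector_derivative f (z t)) (at t within {0..})"
      unfolding z[OF t] unfolding z_def
      by (auto intro!: derivative_eq_intros integral_has_vector_derivative_atLeast contg)
  qed
qed

text \<open>
  The differential inequality says that \<open>exp (a t) y t\<close> has nonpositive derivative. It is demanded only
  up to time \<open>T\<close>, because it will be known only while a trajectory stays in a ball.
\<close>

lemma gronwall_decay:
  fixes y y' :: "real \<Rightarrow> real"
  assumes "0 \<le> T"
    and der: "\<And>t. 0 \<le> t \<Longrightarrow> (y has_vector_derivative y' t) (at t within {0..})"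
    and le: "\<And>t. 0 \<le> t \<Longrightarrow> t \<le> T \<Longrightarrow> y' t \<le> - a * y t"
  shows "y T \<le> y 0 * exp (- a * T)"
proof -
  have "exp (a * T) * y T \<le> exp (a * 0) * y 0"
  proof (rule DERIV_nonpos_imp_decreasing_open[OF \<open>0 \<le> T\<close>])
    show "continuous_on {0..T} (\<lambda>t. exp (a * t) * y t)"
    proof (intro continuous_intros)
      have "continuous_on {0..} y"
        using der by (auto simp: continuous_on_eq_continuous_within intro: has_vector_derivative_continuous)
      then show "continuous_on {0..T} y" by (rule continuous_on_subset) auto
    qed
    fix t assume t: "0 < t" "t < T"
    then have "at t within {0..} = at t" by (intro at_within_interior) auto
    with der[of t] t have "DERIV y t :> y' t"
      by (simp add: has_real_derivative_iff_has_vector_derivative)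
    then have "DERIV (\<lambda>t. exp (a * t) * y t) t :> exp (a * t) * (a * y t + y' t)"
      by (auto intro!: derivative_eq_intros simp: algebra_simps)
    moreover have "exp (a * t) * (a * y t + y' t) \<le> 0"
      using le[of t] t by (simp add: mult_le_0_iff)
    ultimately show "\<exists>d. DERIV (\<lambda>t. exp (a * t) * y t) t :> d \<and> d \<le> 0" by blast
  qed
  then have "exp (- a * T) * (exp (a * T) * y T) \<le> exp (- a * T) * y 0"
    by (intro mult_left_mono) auto
  then show ?thesis by (simp add: exp_minus field_simps)
qed

text \<open>
  At the first time at which the bound fails, the bound would have held at all earlier times.
\<close>

lemma stays_below_of_no_first_exit:
  fixes \<phi> :: "real \<Rightarrow> real"
  assumes cont: "continuous_on {0..} \<phi>"
    and step: "\<And>T. 0 \<le> T \<Longrightarrow> (\<And>t. 0 \<le> t \<Longrightarrow> t < T \<Longrightarrow> \<phi> t < b) \<Longrightarrow> \<phi> T < b"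
    and "0 \<le> t"
  shows "\<phi> t < b"
proof (rule ccontr)
  assume "\<not> \<phi> t < b"
  define S where "S = {0..} \<inter> \<phi> -` {b..}"
  have "closed S" unfolding S_def
    using cont by (intro continuous_closed_preimage) auto
  have "t \<in> S" using \<open>0 \<le> t\<close> \<open>\<not> \<phi> t < b\<close> by (simp add: S_def)
  have "bdd_below S" by (intro bdd_belowI[of _ 0]) (simp add: S_def)
  then have "Inf S \<in> S" using \<open>closed S\<close> \<open>t \<in> S\<close> by (intro closed_contains_Inf) auto
  moreover have "\<phi> s < b" if "0 \<le> s" "s < Inf S" for s
    using cInf_lower[OF _ \<open>bdd_below S\<close>, of s] that by (force simp: S_def)
  ultimately show False using step[of "Inf S"] by (auto simp: S_def)
qed

lemma exponential_speed_bound: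
  fixes c :: "real \<Rightarrow> 'a::real_normed_vector"
  assumes "k > 0" "0 \<le> a" "a \<le> b"
    and der: "\<And>t. 0 \<le> t \<Longrightarrow> (c has_vector_derivative v t) (at t within {0..})"
    and speed: "\<And>t. a < t \<Longrightarrow> t < b \<Longrightarrow> norm (v t) \<le> M * exp (- k * t)"
    and "0 \<le> M"
  shows "norm (c b - c a) \<le> M / k * exp (- k * a)"
proof (cases "a < b")
  case True
  have "norm (c b - c a) \<le> - (M / k) * exp (- k * b) - (- (M / k) * exp (- k * a))"
  proof (rule differentiable_bound_general[OF True])
    have "continuous_on {0..} c"
      using der by (auto simp: continuous_on_eq_continuous_within intro: has_vector_derivative_continuous)
    then show "continuous_on {a..b} c" by (rule continuous_on_subset) (use \<open>0 \<le> a\<close> in auto)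
    fix t assume t: "a < t" "t < b"
    then have "at t within {0..} = at t" using \<open>0 \<le> a\<close> by (intro at_within_interior) auto
    with der[of t] t \<open>0 \<le> a\<close> show "(c has_vector_derivative v t) (at t)" by simp
    show "norm (v t) \<le> M * exp (- k * t)" by (rule speed[OF t])
    show "((\<lambda>t. - (M / k) * exp (- k * t)) has_vector_derivative M * exp (- k * t)) (at t)"
      using \<open>k > 0\<close> by (auto intro!: derivative_eq_intros simp flip: has_real_derivative_iff_has_vector_derivative)
  qed (use \<open>k > 0\<close> in \<open>auto intro!: continuous_intros\<close>)
  also have "\<dots> \<le> M / k * exp (- k * a)" using \<open>0 \<le> M\<close> \<open>k > 0\<close> by simp
  finally show ?thesis .
qed (use assms in simp)

lemma exponential_speed_imp_limit:
  fixes c :: "real \<Rightarrow> 'a::banach"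
  assumes "k > 0" "0 \<le> M"
    and der: "\<And>t. 0 \<le> t \<Longrightarrow> (c has_vector_derivative v t) (at t within {0..})"
    and speed: "\<And>t. 0 \<le> t \<Longrightarrow> norm (v t) \<le> M * exp (- k * t)"
  obtains l where "\<And>t. 0 \<le> t \<Longrightarrow> norm (c t - l) \<le> M / k * exp (- k * t)" "(c \<longlongrightarrow> l) at_top"
proof -
  have dist: "norm (c b - c a) \<le> M / k * exp (- k * a)" if "0 \<le> a" "a \<le> b" for a b
    using that by (intro exponential_speed_bound[OF _ _ _ der speed]) (use assms in auto)
  have lim0: "((\<lambda>a. M / k * exp (- k * a)) \<longlongrightarrow> 0) at_top"
    using \<open>k > 0\<close> by real_asymp
  have "Cauchy (\<lambda>n. c (real n))"
  proof (rule metric_CauchyI)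
    fix e :: real assume "e > 0"
    then have "eventually (\<lambda>a. M / k * exp (- k * a) < e) at_top"
      using order_tendstoD(2)[OF lim0] by blast
    then obtain a where a: "\<And>x. a \<le> x \<Longrightarrow> M / k * exp (- k * x) < e"
      by (auto simp: eventually_at_top_linorder)
    obtain N where N: "a \<le> real N" using real_arch_simple by blast
    have "dist (c (real m)) (c (real n)) < e" if "N \<le> m" "m \<le> n" for m n
      using dist[of "real m" "real n"] a[of "real m"] N that by (simp add: dist_norm norm_minus_commute)
    then show "\<exists>N. \<forall>m\<ge>N. \<forall>n\<ge>N. dist (c (real m)) (c (real n)) < e"
      by (metis dist_commute nle_le)
  qed
  then obtain l where l: "(\<lambda>n. c (real n)) \<longlonglongrightarrow> l"
    using Cauchy_convergent convergent_def by blast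
  have bound: "norm (c t - l) \<le> M / k * exp (- k * t)" if "0 \<le> t" for t
  proof (rule tendsto_upperbound)
    show "(\<lambda>n. norm (c t - c (real n))) \<longlonglongrightarrow> norm (c t - l)"
      by (intro tendsto_intros l)
    obtain N where "t \<le> real N" using real_arch_simple by blast
    then have "norm (c t - c (real n)) \<le> M / k * exp (- k * t)" if "N \<le> n" for n
      using dist[of t "real n"] that \<open>0 \<le> t\<close> by (simp add: norm_minus_commute)
    then show "eventually (\<lambda>n. norm (c t - c (real n)) \<le> M / k * exp (- k * t)) sequentially"
      by (rule eventually_sequentiallyI)
  qed simp
  have "((\<lambda>t. c t - l) \<longlongrightarrow> 0) at_top"
    by (rule Lim_null_comparison[OF _ lim0])
      (use bound in \<open>auto simp: eventually_at_top_linorder\<close>)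
  then have "(c \<longlongrightarrow> l) at_top" by (simp add: LIM_zero_iff)
  with bound show ?thesis by (rule that)
qed

lemma exponential_decay_of_coercive:
  fixes s :: "real \<Rightarrow> 'a::real_inner"
  assumes der: "\<And>t. 0 \<le> t \<Longrightarrow> (s has_vector_derivative - \<Lambda> (s t)) (at t within {0..})"
    and coercive: "\<And>t. 0 \<le> t \<Longrightarrow> lam * (norm (s t))\<^sup>2 \<le> s t \<bullet> \<Lambda> (s t)"
    and t: "0 \<le> t"
  shows "norm (s t) \<le> norm (s 0) * exp (- lam * t)"
proof -
  have "s t \<bullet> s t \<le> (s 0 \<bullet> s 0) * exp (- (2 * lam) * t)"
  proof (rule gronwall_decay[OF t])
    show "((\<lambda>t. s t \<bullet> s t) has_vector_derivative s t \<bullet> (- \<Lambda> (s t)) + (- \<Lambda> (s t)) \<bullet> s t) (at t within {0..})"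
      if "0 \<le> t" for t
      by (rule bounded_bilinear.has_vector_derivative[OF bounded_bilinear_inner der[OF that] der[OF that]])
    show "s t \<bullet> (- \<Lambda> (s t)) + (- \<Lambda> (s t)) \<bullet> s t \<le> - (2 * lam) * (s t \<bullet> s t)" if "0 \<le> t" for t
      using coercive[OF that] by (simp add: power2_norm_eq_inner inner_commute)
  qed
  also have "\<dots> = (norm (s 0) * exp (- lam * t))\<^sup>2"
    by (simp add: power_mult_distrib power2_norm_eq_inner flip: exp_double)
  finally show ?thesis
    by (intro power2_le_imp_le[of "norm (s t)"]) (simp_all add: power2_norm_eq_inner)
qed

section \<open>Gradient flow of a regular system of linear and quadratic constraints\<close>

text \<open>
  The equations \<open>D c = 0\<close> and \<open>B c c = B q q\<close> near their solution \<open>q\<close>. The last assumption is the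
  regularity of the system at \<open>q\<close>: on the kernel of \<open>D\<close> the derivative \<open>B q\<close> of the quadratic part
  reaches all of \<open>Z\<close>. The subspace \<open>Z\<close> holds the values of \<open>B\<close>; it allows the target space to have
  coordinates without a constraint.
\<close>

locale quadratic_constraints =
  fixes D :: "'a::euclidean_space \<Rightarrow> 'b::euclidean_space"
    and B :: "'a \<Rightarrow> 'a \<Rightarrow> 'c::euclidean_space"
    and Z :: "'c set"
    and q :: 'a
  assumes linear_D: "linear D"
    and bilinear_B: "bounded_bilinear B"
    and B_commute: "B x y = B y x"
    and D_target: "D q = 0"
    and subspace_Z: "subspace Z"
    and B_in_Z: "B x y \<in> Z"
    and nondegenerate: "\<And>z. z \<in> Z \<Longrightarrow> (\<And>u. D u = 0 \<Longrightarrow> z \<bullet> B q u = 0) \<Longrightarrow> z = 0"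
begin

sublocale D: bounded_linear D using linear_D by (simp add: linear_conv_bounded_linear)
sublocale B: bounded_bilinear B by (rule bilinear_B)

definition resid :: "'a \<Rightarrow> 'c" where "resid c = B c c - B q q"

text \<open>
  The weights are those for which \<open>adjoint D (D c) + adjoint (B c) (B c c - B q q)\<close> is the gradient
  without numerical factors; the derivative of \<open>B c c\<close> is \<open>2 B c\<close>.
\<close>

definition energy :: "'a \<Rightarrow> real" where
  "energy c = (norm (D c))\<^sup>2 / 2 + (norm (resid c))\<^sup>2 / 4"

definition grad :: "'a \<Rightarrow> 'a" where
  "grad c = adjoint D (D c) + adjoint (B c) (resid c)"

lemma linear_B: "linear (B c)"
  using B.bounded_linear_right by (rule bounded_linear.linear)

lemma resid_in_Z: "resid c \<in> Z"
  unfolding resid_def by (intro subspace_diff subspace_Z B_in_Z)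

lemma inner_grad: "x \<bullet> grad c = D x \<bullet> D c + B c x \<bullet> resid c"
  by (simp add: grad_def inner_add_right adjoint_works linear_D linear_B)

lemma energy_nonneg: "0 \<le> energy c"
  by (simp add: energy_def)

lemma energy_eq_0_iff: "energy c = 0 \<longleftrightarrow> D c = 0 \<and> B c c = B q q"
  by (auto simp: energy_def resid_def add_nonneg_eq_0_iff)

lemma continuous_energy: "continuous_on S energy"
  unfolding energy_def[abs_def] resid_def
  by (intro continuous_intros D.continuous_on B.continuous_on) auto

lemma energy_has_vector_derivative:
  assumes "(c has_vector_derivative v) (at t within S)"
  shows "((\<lambda>t. energy (c t)) has_vector_derivative v \<bullet> grad (c t)) (at t within S)"
proof -
  have D': "((\<lambda>t. D (c t)) has_vector_derivative D v) (at t within S)"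
    using assms by (rule D.has_vector_derivative)
  have B': "((\<lambda>t. resid (c t)) has_vector_derivative 2 *\<^sub>R B (c t) v) (at t within S)"
    unfolding resid_def using B.has_vector_derivative[OF assms assms]
    by (auto intro!: derivative_eq_intros simp: B_commute[of v] scaleR_2)
  have "((\<lambda>t. (D (c t) \<bullet> D (c t)) / 2 + (resid (c t) \<bullet> resid (c t)) / 4) has_vector_derivative
      (D (c t) \<bullet> D v + D v \<bullet> D (c t)) / 2 +
      (resid (c t) \<bullet> (2 *\<^sub>R B (c t) v) + (2 *\<^sub>R B (c t) v) \<bullet> resid (c t)) / 4) (at t within S)"
    by (intro has_vector_derivative_add has_vector_derivative_divide
        bounded_bilinear.has_vector_derivative[OF bounded_bilinear_inner D' D']
        bounded_bilinear.has_vector_derivative[OF bounded_bilinear_inner B' B'])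
  then show ?thesis
    by (simp add: energy_def inner_grad power2_norm_eq_inner inner_commute)
qed

lemma norm_adjoint_B_diff:
  assumes "\<And>x y. norm (B x y) \<le> K * norm x * norm y"
  shows "norm (adjoint (B c) z - adjoint (B c') z) \<le> K * norm (c - c') * norm z"
proof -
  define w where "w = adjoint (B c) z - adjoint (B c') z"
  have "norm w * norm w = w \<bullet> w" by (simp add: power2_norm_eq_inner flip: power2_eq_square)
  also have "\<dots> = B (c - c') w \<bullet> z"
    by (subst (2) w_def) (simp add: inner_diff_right adjoint_works linear_B B.diff_left inner_diff_left)
  also have "\<dots> \<le> norm (B (c - c') w) * norm z" by (rule norm_cauchy_schwarz)
  also have "\<dots> \<le> (K * norm (c - c') * norm w) * norm z"
    by (intro mult_right_mono assms) auto
  finally have "norm w * norm w \<le> norm w * (K * norm (c - c') * norm z)" by (simp add: mult_ac)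
  moreover have "0 \<le> K * norm (c - c') * norm z" if "w = 0"
  proof (cases "c = c'")
    case False
    have "0 \<le> norm (B (c - c') (c - c'))" by simp
    also have "\<dots> \<le> K * norm (c - c') * norm (c - c')" by (rule assms)
    finally have "0 \<le> K" using False by (simp add: zero_le_mult_iff)
    then show ?thesis by simp
  qed simp
  ultimately show ?thesis unfolding w_def[symmetric]
    by (cases "w = 0") (auto simp: mult_le_cancel_left)
qed

text \<open>
  Regularity makes \<open>(y, z) \<mapsto> adjoint D y + adjoint (B q) z\<close> injective on \<open>range D \<times> Z\<close>: testing
  against the kernel of \<open>D\<close> gives \<open>z = 0\<close>, and then \<open>adjoint D (D a) = 0\<close> forces \<open>D a = 0\<close>. In
  finite dimension an injective linear map is bounded below.
\<close>

lemma constraint_adjoint_bounded_below: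
  obtains e where "e > 0"
    "\<And>c z. z \<in> Z \<Longrightarrow> e * norm (D c, z) \<le> norm (adjoint D (D c) + adjoint (B q) z)"
proof -
  define J where "J = (\<lambda>(y, z). adjoint D y + adjoint (B q) z)"
  have "linear J"
    unfolding J_def case_prod_beta
    by (intro linear_compose_add
        linear_compose[unfolded o_def, OF _ adjoint_linear[OF linear_D]]
        linear_compose[unfolded o_def, OF _ adjoint_linear[OF linear_B]] linear_fst linear_snd)
  moreover have sub: "subspace (range D \<times> Z)"
    by (intro subspace_Times subspace_Z linear_subspace_image linear_D subspace_UNIV)
  moreover have "w = 0" if w: "w \<in> range D \<times> Z" and J0: "J w = 0" for w
  proof -
    obtain a z where w_eq: "w = (D a, z)" and z: "z \<in> Z" using w by auto
    have 0: "D u \<bullet> D a + z \<bullet> B q u = 0" for u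
    proof -
      have "u \<bullet> J w = 0" using J0 by simp
      then show ?thesis
        by (simp add: J_def w_eq inner_add_right adjoint_works linear_D linear_B inner_commute)
    qed
    have "z = 0"
    proof (rule nondegenerate[OF z])
      show "z \<bullet> B q u = 0" if "D u = 0" for u using 0[of u] that by simp
    qed
    with 0[of a] show ?thesis by (simp add: w_eq zero_prod_def)
  qed
  ultimately obtain e where "e > 0" "\<forall>w\<in>range D \<times> Z. e * norm w \<le> norm (J w)"
    using injective_imp_isometric[of "range D \<times> Z" J] closed_subspace[OF sub]
    by (auto simp: linear_conv_bounded_linear)
  then show ?thesis by (intro that[of e]) (auto simp: J_def split_beta)
qed

text \<open>
  The gradient at \<open>c\<close> is the map of \<open>constraint_adjoint_bounded_below\<close> applied to the two residuals, up
  to the change from \<open>B q\<close> to \<open>B c\<close>, which is small near \<open>q\<close>. The inequality holds although the zeros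
  of the energy need not be isolated, and it replaces any analysis of the shape of the zero set.
\<close>

lemma polyak_lojasiewicz:
  obtains k \<rho> where "k > 0" "\<rho> > 0"
    "\<And>c. c \<in> cball q \<rho> \<Longrightarrow> k * energy c \<le> (norm (grad c))\<^sup>2"
proof -
  obtain e where e: "e > 0"
    "\<And>c z. z \<in> Z \<Longrightarrow> e * norm (D c, z) \<le> norm (adjoint D (D c) + adjoint (B q) z)"
    using constraint_adjoint_bounded_below by blast
  obtain K where K: "K > 0" "\<And>x y. norm (B x y) \<le> norm x * norm y * K"
    using B.pos_bounded by blast
  have K': "norm (B x y) \<le> K * norm x * norm y" for x y using K(2)[of x y] by (simp add: mult_ac)
  show ?thesis
    \<comment> \<open>within \<open>e / (2 * K)\<close> of \<open>q\<close>, replacing \<open>B q\<close> by \<open>B c\<close> loses at most half of the lower bound\<close>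
  proof (rule that[of "e\<^sup>2 / 4" "e / (2 * K)"])
    show "e\<^sup>2 / 4 > 0" "e / (2 * K) > 0" using e K by simp_all
    fix c assume c: "c \<in> cball q (e / (2 * K))"
    let ?p = "(D c, resid c)"
    have "e * norm ?p \<le> norm (adjoint D (D c) + adjoint (B q) (resid c))"
      by (rule e(2)[OF resid_in_Z])
    also have "adjoint D (D c) + adjoint (B q) (resid c) =
        grad c - (adjoint (B c) (resid c) - adjoint (B q) (resid c))"
      by (simp add: grad_def)
    also have "norm \<dots> \<le> norm (grad c) + norm (adjoint (B c) (resid c) - adjoint (B q) (resid c))"
      by (rule norm_triangle_ineq4)
    also have "norm (adjoint (B c) (resid c) - adjoint (B q) (resid c)) \<le> K * norm (c - q) * norm (resid c)"
      by (rule norm_adjoint_B_diff[OF K'])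
    also have "\<dots> \<le> e / 2 * norm ?p"
    proof (intro mult_mono)
      show "K * norm (c - q) \<le> e / 2"
        using c K(1) by (simp add: dist_norm norm_minus_commute field_simps)
      show "norm (resid c) \<le> norm ?p" by (simp add: norm_Pair real_le_rsqrt)
    qed (use e in auto)
    finally have "e / 2 * norm ?p \<le> norm (grad c)" by simp
    then have le: "(e / 2 * norm ?p)\<^sup>2 \<le> (norm (grad c))\<^sup>2"
      using e by (intro power_mono) auto
    have "(norm ?p)\<^sup>2 = (norm (D c))\<^sup>2 + (norm (resid c))\<^sup>2"
      by (simp add: norm_Pair)
    moreover have "energy c \<le> (norm (D c))\<^sup>2 + (norm (resid c))\<^sup>2"
      unfolding energy_def by (intro add_mono) auto
    ultimately have "energy c \<le> (norm ?p)\<^sup>2" by simp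
    then have "e\<^sup>2 / 4 * energy c \<le> e\<^sup>2 / 4 * (norm ?p)\<^sup>2" by (intro mult_left_mono) auto
    with le show "e\<^sup>2 / 4 * energy c \<le> (norm (grad c))\<^sup>2"
      by (simp add: power_mult_distrib power_divide)
  qed
qed

lemma energy_upper_bound:
  obtains N where "N > 0" "\<And>c. c \<in> cball q \<rho> \<Longrightarrow> energy c \<le> N * (norm (c - q))\<^sup>2"
proof -
  obtain K where K: "K > 0" "\<And>x y. norm (B x y) \<le> norm x * norm y * K"
    using B.pos_bounded by blast
  obtain L where L: "L > 0" "\<And>x. norm (D x) \<le> norm x * L"
    using D.pos_bounded by blast
  define R where "R = \<bar>\<rho>\<bar> + 2 * norm q"
  show ?thesis
  proof (rule that[of "L\<^sup>2 + (R * K)\<^sup>2"])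
    show "L\<^sup>2 + (R * K)\<^sup>2 > 0" using L by (simp add: add_pos_nonneg)
    fix c assume c: "c \<in> cball q \<rho>"
    have "norm c \<le> norm (c - q) + norm q" using norm_triangle_sub[of c q] by simp
    then have R: "norm c + norm q \<le> R"
      using c by (simp add: R_def dist_norm norm_minus_commute)
    have "norm (D c) \<le> norm (c - q) * L" using L(2)[of "c - q"] by (simp add: D.diff D_target)
    then have "(norm (D c))\<^sup>2 \<le> (norm (c - q) * L)\<^sup>2" by (intro power_mono) auto
    moreover have "norm (resid c) \<le> norm (c - q) * (R * K)"
    proof -
      have "resid c = B (c - q) (c + q)"
        by (simp add: resid_def B.diff_left B.add_right B_commute[of q c])
      also have "norm \<dots> \<le> norm (c - q) * norm (c + q) * K" by (rule K(2))
      also have "\<dots> \<le> norm (c - q) * R * K"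
        using R norm_triangle_ineq[of c q] K(1) by (intro mult_right_mono mult_left_mono) auto
      finally show ?thesis by (simp add: mult_ac)
    qed
    then have "(norm (resid c))\<^sup>2 \<le> (norm (c - q) * (R * K))\<^sup>2" by (intro power_mono) auto
    moreover have "energy c \<le> (norm (D c))\<^sup>2 + (norm (resid c))\<^sup>2"
      unfolding energy_def by (intro add_mono) auto
    ultimately show "energy c \<le> (L\<^sup>2 + (R * K)\<^sup>2) * (norm (c - q))\<^sup>2"
      by (simp add: power_mult_distrib algebra_simps)
  qed
qed

text \<open>
  Near \<open>q\<close> the gradient is controlled by the two residuals, so decay of the energy is decay of the
  speed of the flow.
\<close>

lemma grad_upper_bound:
  obtains M where "M > 0" "\<And>c. c \<in> cball q \<rho> \<Longrightarrow> (norm (grad c))\<^sup>2 \<le> M * energy c"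
proof -
  obtain K where K: "K > 0" "\<And>x y. norm (B x y) \<le> norm x * norm y * K"
    using B.pos_bounded by blast
  obtain L where L: "L > 0" "\<And>x. norm (D x) \<le> norm x * L"
    using D.pos_bounded by blast
  define R where "R = \<bar>\<rho>\<bar> + norm q"
  show ?thesis
  proof (rule that[of "4 * L\<^sup>2 + 8 * (R * K)\<^sup>2"])
    show "4 * L\<^sup>2 + 8 * (R * K)\<^sup>2 > 0" using L by (simp add: add_pos_nonneg)
    fix c assume c: "c \<in> cball q \<rho>"
    have "norm c \<le> norm (c - q) + norm q" using norm_triangle_sub[of c q] by simp
    then have R: "norm c \<le> R"
      using c by (simp add: R_def dist_norm norm_minus_commute)
    let ?g = "grad c"
    have "norm ?g * norm ?g = ?g \<bullet> ?g" by (simp add: power2_norm_eq_inner flip: power2_eq_square)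
    also have "\<dots> = D ?g \<bullet> D c + B c ?g \<bullet> resid c" by (rule inner_grad)
    also have "\<dots> \<le> norm (D ?g) * norm (D c) + norm (B c ?g) * norm (resid c)"
      by (intro add_mono norm_cauchy_schwarz)
    also have "\<dots> \<le> (norm ?g * L) * norm (D c) + (R * norm ?g * K) * norm (resid c)"
    proof (intro add_mono mult_right_mono L(2))
      have "norm (B c ?g) \<le> norm c * norm ?g * K" by (rule K(2))
      also have "\<dots> \<le> R * norm ?g * K" using R K(1) by (intro mult_right_mono) auto
      finally show "norm (B c ?g) \<le> R * norm ?g * K" .
    qed auto
    finally have "norm ?g * norm ?g \<le> norm ?g * (L * norm (D c) + R * K * norm (resid c))"
      by (simp add: algebra_simps)
    moreover have nn: "0 \<le> L * norm (D c) + R * K * norm (resid c)"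
      using L K order_trans[OF norm_ge_zero R] by simp
    ultimately have "norm ?g \<le> L * norm (D c) + R * K * norm (resid c)"
      by (cases "?g = 0") (auto simp: mult_le_cancel_left)
    then have "(norm ?g)\<^sup>2 \<le> (L * norm (D c) + R * K * norm (resid c))\<^sup>2"
      by (intro power_mono) auto
    also have "\<dots> \<le> 2 * (L * norm (D c))\<^sup>2 + 2 * (R * K * norm (resid c))\<^sup>2"
      using zero_le_power2[of "L * norm (D c) - R * K * norm (resid c)"]
      by (simp add: power2_sum power2_diff)
    also have "\<dots> = 4 * L\<^sup>2 * ((norm (D c))\<^sup>2 / 2) + 8 * (R * K)\<^sup>2 * ((norm (resid c))\<^sup>2 / 4)"
      by (simp add: power_mult_distrib)
    also have "\<dots> \<le> (4 * L\<^sup>2 + 8 * (R * K)\<^sup>2) * energy c"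
      by (simp add: energy_def algebra_simps)
    finally show "(norm ?g)\<^sup>2 \<le> (4 * L\<^sup>2 + 8 * (R * K)\<^sup>2) * energy c" .
  qed
qed

lemma grad_lipschitz_on_cball:
  obtains M where "M > 0"
    "\<And>a b. a \<in> cball q \<rho> \<Longrightarrow> b \<in> cball q \<rho> \<Longrightarrow> norm (grad a - grad b) \<le> M * norm (a - b)"
proof -
  obtain K where K: "K > 0" "\<And>x y. norm (B x y) \<le> norm x * norm y * K"
    using B.pos_bounded by blast
  obtain L where L: "L > 0" "\<And>x. norm (D x) \<le> norm x * L"
    using D.pos_bounded by blast
  define R where "R = \<bar>\<rho>\<bar> + norm q"
  have R0: "0 \<le> R" by (simp add: R_def)
  define M where "M = L * L + R * K * (2 * R * K) + K * (2 * R * R * K)"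
  show ?thesis
  proof (rule that[of M])
    show "M > 0" using L R0 K unfolding M_def by (intro add_pos_nonneg) auto
    fix a b assume ab: "a \<in> cball q \<rho>" "b \<in> cball q \<rho>"
    have R: "norm c \<le> R" if "c \<in> cball q \<rho>" for c
      using that norm_triangle_sub[of c q] by (simp add: R_def dist_norm norm_minus_commute)
    let ?x = "grad a - grad b" and ?d = "a - b"
    have Bq: "norm (B q q) \<le> R * R * K"
    proof -
      have "norm (B q q) \<le> norm q * norm q * K" by (rule K(2))
      also have "\<dots> \<le> R * R * K" using K(1) by (intro mult_mono) (auto simp: R_def)
      finally show ?thesis .
    qed
    have res: "norm (resid b) \<le> 2 * R * R * K"
    proof -
      have "norm (B b b) \<le> norm b * norm b * K" by (rule K(2))
      also have "\<dots> \<le> R * R * K" using K(1) R[OF ab(2)] R0 by (intro mult_mono) auto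
      finally show ?thesis
        using Bq norm_triangle_ineq4[of "B b b" "B q q"] by (simp add: resid_def)
    qed
    have dres: "norm (resid a - resid b) \<le> norm ?d * (2 * R * K)"
    proof -
      have "resid a - resid b = B (a - b) (a + b)"
        by (simp add: resid_def B.diff_left B.add_right B_commute[of b a])
      also have "norm \<dots> \<le> norm ?d * norm (a + b) * K" by (rule K(2))
      also have "\<dots> \<le> norm ?d * (2 * R) * K"
        using R[OF ab(1)] R[OF ab(2)] norm_triangle_ineq[of a b] K(1)
        by (intro mult_right_mono mult_left_mono) auto
      finally show ?thesis by (simp add: mult_ac)
    qed
    have "norm ?x * norm ?x = ?x \<bullet> ?x" by (simp add: power2_norm_eq_inner flip: power2_eq_square)
    also have "\<dots> = ?x \<bullet> grad a - ?x \<bullet> grad b" by (rule inner_diff_right)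
    also have "\<dots> = D ?x \<bullet> D ?d + B a ?x \<bullet> (resid a - resid b) + B ?d ?x \<bullet> resid b"
      unfolding inner_grad
      by (simp add: B.diff_left D.diff algebra_simps)
    also have "\<dots> \<le> norm (D ?x) * norm (D ?d) + norm (B a ?x) * norm (resid a - resid b)
        + norm (B ?d ?x) * norm (resid b)"
      by (intro add_mono norm_cauchy_schwarz)
    also have "\<dots> \<le> (norm ?x * L) * (norm ?d * L) + (R * norm ?x * K) * (norm ?d * (2 * R * K))
        + (norm ?d * norm ?x * K) * (2 * R * R * K)"
    proof (intro add_mono mult_mono L(2) K(2) dres res)
      have "norm (B a ?x) \<le> norm a * norm ?x * K" by (rule K(2))
      also have "\<dots> \<le> R * norm ?x * K" using R[OF ab(1)] K(1) by (intro mult_right_mono) auto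
      finally show "norm (B a ?x) \<le> R * norm ?x * K" .
    qed (use L K R0 in auto)
    also have "\<dots> = norm ?x * (M * norm ?d)" by (simp add: M_def algebra_simps)
    finally show "norm ?x \<le> M * norm ?d"
      using \<open>M > 0\<close> by (cases "?x = 0") (auto simp: mult_le_cancel_left)
  qed
qed

text \<open>
  The conclusion speaks of every curve that follows the perturbed gradient flow while it is inside
  \<open>cball q \<rho>\<close>. In this form it covers the solutions of the system and also those of a system that is
  modified outside the ball.

  The Lyapunov function is \<open>energy (c t) + m |s t|\<^sup>2\<close>: half of the dissipation \<open>|grad|\<^sup>2\<close> absorbs
  the input \<open>\<Lambda> s\<close> at the cost of \<open>|\<Lambda> s|\<^sup>2 / 2\<close>, which a large \<open>m\<close> lets the dissipation of \<open>s\<close>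
  pay. Its square root bounds the speed of \<open>c\<close>, hence the length of the path.
\<close>

lemma perturbed_gradient_flow_converges:
  assumes \<Lambda>: "bounded_linear \<Lambda>" and lam: "lam > 0"
  obtains \<rho> \<delta> C \<kappa> where "\<rho> > 0" "\<delta> > 0" "C > 0" "\<kappa> > 0"
    "\<And>c s v. \<lbrakk>\<And>t. 0 \<le> t \<Longrightarrow> (c has_vector_derivative v t) (at t within {0..});
        \<And>t. 0 \<le> t \<Longrightarrow> c t \<in> cball q \<rho> \<Longrightarrow> v t = - grad (c t) + \<Lambda> (s t);
        \<And>t. 0 \<le> t \<Longrightarrow> (s has_vector_derivative - \<Lambda> (s t)) (at t within {0..});
        \<And>t. 0 \<le> t \<Longrightarrow> lam * (norm (s t))\<^sup>2 \<le> s t \<bullet> \<Lambda> (s t);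
        norm (c 0 - q) + norm (s 0) < \<delta>\<rbrakk> \<Longrightarrow>
      (\<forall>t\<ge>0. c t \<in> cball q \<rho>) \<and>
      (\<exists>l. D l = 0 \<and> B l l = B q q \<and>
         norm (l - q) \<le> C * (norm (c 0 - q) + norm (s 0)) \<and>
         (\<forall>t\<ge>0. norm (c t - l) \<le> C * (norm (c 0 - q) + norm (s 0)) * exp (- \<kappa> * t)))"
proof -
  obtain k \<rho> where k: "k > 0" and \<rho>: "\<rho> > 0"
    and PL: "\<And>c. c \<in> cball q \<rho> \<Longrightarrow> k * energy c \<le> (norm (grad c))\<^sup>2"
    using polyak_lojasiewicz by blast
  obtain N where N: "N > 0" "\<And>c. c \<in> cball q \<rho> \<Longrightarrow> energy c \<le> N * (norm (c - q))\<^sup>2"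
    using energy_upper_bound[of \<rho>] by blast
  obtain M where M: "M > 0" "\<And>c. c \<in> cball q \<rho> \<Longrightarrow> (norm (grad c))\<^sup>2 \<le> M * energy c"
    using grad_upper_bound[of \<rho>] by blast
  obtain K where K: "K > 0" "\<And>x. norm (\<Lambda> x) \<le> norm x * K"
    using bounded_linear.pos_bounded[OF \<Lambda>] by blast
  \<comment> \<open>large enough for the dissipation of \<open>s\<close> to pay for the input; the summand \<open>1\<close> lets the
    Lyapunov function bound \<open>|s|\<^sup>2\<close> itself\<close>
  define m where "m = K\<^sup>2 / (2 * lam) + 1"
  have m: "m \<ge> 1" "K\<^sup>2 / 2 \<le> m * lam" using lam by (auto simp: m_def field_simps)
  define a where "a = min (k / 2) lam"
  have a: "a > 0" "a \<le> k / 2" "a \<le> lam" using k lam by (auto simp: a_def)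
  \<comment> \<open>the speed is of the order of the square root of the Lyapunov function, so it decays at half the rate\<close>
  define \<kappa> where "\<kappa> = a / 2"
  have \<kappa>: "\<kappa> > 0" "a = 2 * \<kappa>" using a by (auto simp: \<kappa>_def)
  define C\<^sub>1 where "C\<^sub>1 = (sqrt M + K) * sqrt (N + m)"
  have C\<^sub>1: "C\<^sub>1 \<ge> 0" using M K N m by (simp add: C\<^sub>1_def)
  define C where "C = 1 + C\<^sub>1 / \<kappa>"
  have C: "C \<ge> 1" using C\<^sub>1 \<kappa> by (simp add: C_def)
  show ?thesis
  proof (rule that[of \<rho> "\<rho> / C" C \<kappa>])
    show "\<rho> > 0" "\<rho> / C > 0" "C > 0" "\<kappa> > 0" using \<rho> C \<kappa> by auto
    fix c s v
    assume c': "\<And>t. 0 \<le> t \<Longrightarrow> (c has_vector_derivative v t) (at t within {0..})"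
      and v: "\<And>t. 0 \<le> t \<Longrightarrow> c t \<in> cball q \<rho> \<Longrightarrow> v t = - grad (c t) + \<Lambda> (s t)"
      and s': "\<And>t. 0 \<le> t \<Longrightarrow> (s has_vector_derivative - \<Lambda> (s t)) (at t within {0..})"
      and coercive: "\<And>t. 0 \<le> t \<Longrightarrow> lam * (norm (s t))\<^sup>2 \<le> s t \<bullet> \<Lambda> (s t)"
      and init: "norm (c 0 - q) + norm (s 0) < \<rho> / C"
    define \<epsilon> where "\<epsilon> = norm (c 0 - q) + norm (s 0)"
    have \<epsilon>: "0 \<le> \<epsilon>" "C * \<epsilon> < \<rho>" using init C by (auto simp: \<epsilon>_def field_simps)
    have c0: "c 0 \<in> cball q \<rho>"
    proof -
      have "norm (c 0 - q) \<le> \<epsilon>" by (simp add: \<epsilon>_def)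
      also have "\<dots> \<le> C * \<epsilon>" using \<epsilon> C by (simp add: mult_le_cancel_right1)
      finally show ?thesis using \<epsilon> by (simp add: dist_norm norm_minus_commute)
    qed
    define Y where "Y t = energy (c t) + m * (s t \<bullet> s t)" for t
    define Y' where "Y' t = v t \<bullet> grad (c t) - 2 * m * (s t \<bullet> \<Lambda> (s t))" for t
    have Y': "(Y has_vector_derivative Y' t) (at t within {0..})" if "0 \<le> t" for t
    proof -
      have "((\<lambda>t. s t \<bullet> s t) has_vector_derivative s t \<bullet> (- \<Lambda> (s t)) + (- \<Lambda> (s t)) \<bullet> s t) (at t within {0..})"
        by (rule bounded_bilinear.has_vector_derivative[OF bounded_bilinear_inner s'[OF that] s'[OF that]])
      from has_vector_derivative_mult_right[OF this, of m]
      have "((\<lambda>t. m * (s t \<bullet> s t)) has_vector_derivative - 2 * m * (s t \<bullet> \<Lambda> (s t))) (at t within {0..})"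
        by (simp add: inner_commute algebra_simps)
      from has_vector_derivative_add[OF energy_has_vector_derivative[OF c'[OF that]] this]
      show ?thesis by (simp add: Y_def[abs_def] Y'_def)
    qed
    have Y_nonneg: "0 \<le> Y t" for t using energy_nonneg m by (simp add: Y_def)
    have Y'_le: "Y' t \<le> - a * Y t" if t: "0 \<le> t" and ball: "c t \<in> cball q \<rho>" for t
    proof -
      let ?g = "grad (c t)"
      have "\<Lambda> (s t) \<bullet> ?g \<le> (norm (\<Lambda> (s t)))\<^sup>2 / 2 + (norm ?g)\<^sup>2 / 2"
      proof -
        have "\<Lambda> (s t) \<bullet> ?g \<le> norm (\<Lambda> (s t)) * norm ?g" by (rule norm_cauchy_schwarz)
        also have "\<dots> \<le> (norm (\<Lambda> (s t)))\<^sup>2 / 2 + (norm ?g)\<^sup>2 / 2"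
          using zero_le_power2[of "norm (\<Lambda> (s t)) - norm ?g"] by (simp add: power2_diff)
        finally show ?thesis .
      qed
      moreover have "(norm (\<Lambda> (s t)))\<^sup>2 / 2 \<le> m * lam * (norm (s t))\<^sup>2"
      proof -
        have "(norm (\<Lambda> (s t)))\<^sup>2 \<le> (norm (s t) * K)\<^sup>2" by (intro power_mono K(2)) auto
        moreover have "K\<^sup>2 / 2 * (norm (s t))\<^sup>2 \<le> m * lam * (norm (s t))\<^sup>2"
          by (intro mult_right_mono m) auto
        ultimately show ?thesis by (simp add: power_mult_distrib mult_ac)
      qed
      moreover have "m * (lam * (norm (s t))\<^sup>2) \<le> m * (s t \<bullet> \<Lambda> (s t))"
        using coercive[OF t] m by (intro mult_left_mono) auto
      moreover have "a * energy (c t) \<le> (norm ?g)\<^sup>2 / 2"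
        using PL[OF ball] mult_right_mono[OF a(2) energy_nonneg[of "c t"]] by simp
      moreover have "a * (m * (norm (s t))\<^sup>2) \<le> lam * (m * (norm (s t))\<^sup>2)"
        using a m by (intro mult_right_mono) auto
      moreover have "v t \<bullet> ?g = \<Lambda> (s t) \<bullet> ?g - (norm ?g)\<^sup>2"
        by (simp add: v[OF t ball] inner_diff_left inner_add_left power2_norm_eq_inner)
      moreover have "Y t = energy (c t) + m * (norm (s t))\<^sup>2"
        by (simp add: Y_def power2_norm_eq_inner)
      ultimately show ?thesis
        by (simp add: Y'_def algebra_simps)
    qed
    have Y_decay: "Y T \<le> Y 0 * exp (- a * T)"
      if "0 \<le> T" "\<And>t. 0 \<le> t \<Longrightarrow> t \<le> T \<Longrightarrow> c t \<in> cball q \<rho>" for T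
      using that by (intro gronwall_decay[OF _ Y' Y'_le]) auto
    have Y0: "Y 0 \<le> (N + m) * \<epsilon>\<^sup>2"
    proof -
      have "energy (c 0) \<le> N * (norm (c 0 - q))\<^sup>2" by (rule N(2)[OF c0])
      also have "\<dots> \<le> N * \<epsilon>\<^sup>2"
        using N by (intro mult_left_mono power_mono) (auto simp: \<epsilon>_def)
      finally have "energy (c 0) \<le> N * \<epsilon>\<^sup>2" .
      moreover have "m * (norm (s 0))\<^sup>2 \<le> m * \<epsilon>\<^sup>2"
        using m by (intro mult_left_mono power_mono) (auto simp: \<epsilon>_def)
      ultimately show ?thesis by (simp add: Y_def power2_norm_eq_inner algebra_simps)
    qed
    have speed: "norm (v T) \<le> C\<^sub>1 * \<epsilon> * exp (- \<kappa> * T)"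
      if "0 \<le> T" and ball: "\<And>t. 0 \<le> t \<Longrightarrow> t \<le> T \<Longrightarrow> c t \<in> cball q \<rho>" for T
    proof -
      have "Y T \<le> ((N + m) * \<epsilon>\<^sup>2) * exp (- a * T)"
        using Y_decay[OF that] Y0 by (meson exp_ge_zero mult_right_mono order_trans)
      also have "\<dots> = (sqrt (N + m) * \<epsilon> * exp (- \<kappa> * T))\<^sup>2"
        using N m by (simp add: power_mult_distrib \<kappa>(2) flip: exp_double)
      finally have sqrtY: "sqrt (Y T) \<le> sqrt (N + m) * \<epsilon> * exp (- \<kappa> * T)"
        using N m \<epsilon> by (intro real_le_lsqrt) auto
      have "(norm (grad (c T)))\<^sup>2 \<le> M * Y T"
        using M(2)[of "c T"] ball[of T] \<open>0 \<le> T\<close> m M(1)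
        by (force simp: Y_def distrib_left intro: order_trans add_increasing2)
      then have g: "norm (grad (c T)) \<le> sqrt M * sqrt (Y T)"
        by (simp add: real_le_rsqrt flip: real_sqrt_mult)
      have "(norm (s T))\<^sup>2 \<le> Y T"
        using m(1) energy_nonneg[of "c T"] mult_right_mono[OF m(1), of "(norm (s T))\<^sup>2"]
        by (simp add: Y_def power2_norm_eq_inner)
      then have "norm (s T) \<le> sqrt (Y T)" by (rule real_le_rsqrt)
      then have l: "norm (\<Lambda> (s T)) \<le> K * sqrt (Y T)"
        using K(2)[of "s T"] K(1) by (simp add: mult.commute) (meson mult_left_mono less_imp_le order_trans)
      have "norm (v T) \<le> norm (grad (c T)) + norm (\<Lambda> (s T))"
        using v[OF \<open>0 \<le> T\<close> ball[OF \<open>0 \<le> T\<close> order_refl]] norm_triangle_ineq[of "- grad (c T)" "\<Lambda> (s T)"]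
        by simp
      also have "\<dots> \<le> (sqrt M + K) * sqrt (Y T)" using g l by (simp add: distrib_right)
      also have "\<dots> \<le> (sqrt M + K) * (sqrt (N + m) * \<epsilon> * exp (- \<kappa> * T))"
        using M K by (intro mult_left_mono sqrtY) auto
      finally show ?thesis by (simp add: C\<^sub>1_def mult_ac)
    qed
    have stay: "norm (c t - q) < \<rho>" if "0 \<le> t" for t
    proof (rule stays_below_of_no_first_exit[OF _ _ that])
      have "continuous_on {0..} c"
        using c' by (auto simp: continuous_on_eq_continuous_within intro: has_vector_derivative_continuous)
      then show "continuous_on {0..} (\<lambda>t. norm (c t - q))" by (intro continuous_intros)
      fix T :: real assume T: "0 \<le> T" "\<And>t. 0 \<le> t \<Longrightarrow> t < T \<Longrightarrow> norm (c t - q) < \<rho>"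
      have "norm (c T - c 0) \<le> C\<^sub>1 * \<epsilon> / \<kappa> * exp (- \<kappa> * 0)"
      proof (rule exponential_speed_bound[OF \<kappa>(1) order_refl T(1) c'])
        fix t assume "0 < t" "t < T"
        then show "norm (v t) \<le> C\<^sub>1 * \<epsilon> * exp (- \<kappa> * t)"
          using T(2) by (intro speed) (auto simp: dist_norm norm_minus_commute less_imp_le)
      qed (use C\<^sub>1 \<epsilon> in auto)
      moreover have "norm (c T - q) \<le> norm (c T - c 0) + norm (c 0 - q)"
        by (rule norm_diff_triangle_ineq[of "c T" "c 0" "c 0" q, simplified])
      moreover have "norm (c 0 - q) \<le> \<epsilon>" by (simp add: \<epsilon>_def)
      ultimately show "norm (c T - q) < \<rho>"
        using \<epsilon>(2) by (simp add: C_def distrib_right)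
    qed
    then have ball: "c t \<in> cball q \<rho>" if "0 \<le> t" for t
      using that by (simp add: dist_norm norm_minus_commute less_imp_le)
    obtain l where l: "\<And>t. 0 \<le> t \<Longrightarrow> norm (c t - l) \<le> C\<^sub>1 * \<epsilon> / \<kappa> * exp (- \<kappa> * t)"
      and lim: "(c \<longlongrightarrow> l) at_top"
      by (rule exponential_speed_imp_limit[OF \<kappa>(1) _ c' speed]) (use C\<^sub>1 \<epsilon> ball in auto)
    have "energy l = 0"
    proof (rule antisym[OF _ energy_nonneg])
      have "isCont energy l"
        using continuous_energy[of UNIV] by (simp add: continuous_on_eq_continuous_at)
      then have "((\<lambda>t. energy (c t)) \<longlongrightarrow> energy l) at_top"
        by (rule isCont_tendsto_compose[OF _ lim])
      moreover have "((\<lambda>t. Y 0 * exp (- a * t)) \<longlongrightarrow> 0) at_top"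
        using a by real_asymp
      moreover have "eventually (\<lambda>t. energy (c t) \<le> Y 0 * exp (- a * t)) at_top"
      proof (rule eventually_mono[OF eventually_ge_at_top[of 0]])
        fix t :: real assume "0 \<le> t"
        then have "Y t \<le> Y 0 * exp (- a * t)" by (intro Y_decay ball) auto
        moreover have "energy (c t) \<le> Y t" using m by (simp add: Y_def)
        ultimately show "energy (c t) \<le> Y 0 * exp (- a * t)" by linarith
      qed
      ultimately show "energy l \<le> 0"
        by (intro tendsto_le[OF trivial_limit_at_top_linorder])
    qed
    moreover have "norm (l - q) \<le> C * \<epsilon>"
    proof -
      have "norm (l - q) \<le> norm (c 0 - l) + norm (c 0 - q)"
        using norm_triangle_ineq4[of "c 0 - q" "c 0 - l"] by simp
      also have "\<dots> \<le> C * \<epsilon>"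
        using l[of 0] unfolding C_def distrib_right
        by (simp add: \<epsilon>_def add_increasing)
      finally show ?thesis .
    qed
    moreover have "norm (c t - l) \<le> C * \<epsilon> * exp (- \<kappa> * t)" if "0 \<le> t" for t
    proof -
      have "C\<^sub>1 * \<epsilon> / \<kappa> \<le> C * \<epsilon>" using \<epsilon> by (simp add: C_def distrib_right)
      then show ?thesis using l[OF that] by (meson exp_ge_zero mult_right_mono order_trans)
    qed
    ultimately show "(\<forall>t\<ge>0. c t \<in> cball q \<rho>) \<and>
      (\<exists>l. D l = 0 \<and> B l l = B q q \<and>
         norm (l - q) \<le> C * (norm (c 0 - q) + norm (s 0)) \<and>
         (\<forall>t\<ge>0. norm (c t - l) \<le> C * (norm (c 0 - q) + norm (s 0)) * exp (- \<kappa> * t)))"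
      using ball unfolding \<epsilon>_def energy_eq_0_iff by blast
  qed
qed

text \<open>
  Projecting the argument of the gradient onto a ball, on which the gradient is Lipschitz, makes the field
  globally Lipschitz. Solutions that stay in the ball do not notice the projection.
\<close>

lemma truncated_flow_solution:
  assumes \<Lambda>: "bounded_linear \<Lambda>" and \<rho>: "\<rho> > 0"
  obtains c s where "c 0 = c0" "s 0 = s0"
    "\<And>t. 0 \<le> t \<Longrightarrow> (c has_vector_derivative
        - grad (closest_point (cball q \<rho>) (c t)) + \<Lambda> (s t)) (at t within {0..})"
    "\<And>t. 0 \<le> t \<Longrightarrow> (s has_vector_derivative - \<Lambda> (s t)) (at t within {0..})"
proof -
  interpret \<Lambda>: bounded_linear \<Lambda> by (rule \<Lambda>)
  obtain K where K: "K > 0" "\<And>x. norm (\<Lambda> x) \<le> norm x * K"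
    using \<Lambda>.pos_bounded by blast
  obtain M where M: "M > 0"
    "\<And>a b. a \<in> cball q \<rho> \<Longrightarrow> b \<in> cball q \<rho> \<Longrightarrow> norm (grad a - grad b) \<le> M * norm (a - b)"
    using grad_lipschitz_on_cball[of \<rho>] by blast
  let ?P = "closest_point (cball q \<rho>)"
  define f where "f w = (- grad (?P (fst w)) + \<Lambda> (snd w), - \<Lambda> (snd w))" for w
  have ne: "cball q \<rho> \<noteq> {}" using \<rho> by auto
  have "norm (f x - f y) \<le> (M + 2 * K) * norm (x - y)" for x y
  proof -
    have fst: "norm (fst x - fst y) \<le> norm (x - y)" and snd: "norm (snd x - snd y) \<le> norm (x - y)"
      using norm_fst_le[of "fst x - fst y" "snd x - snd y"] norm_snd_le[of "snd x - snd y" "fst x - fst y"]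
      by (simp_all add: minus_prod_def)
    have "norm (grad (?P (fst y)) - grad (?P (fst x))) \<le> M * norm (?P (fst y) - ?P (fst x))"
      by (intro M(2) closest_point_in_set closed_cball ne)
    also have "\<dots> \<le> M * norm (x - y)"
      using closest_point_lipschitz[OF convex_cball closed_cball ne, of "fst y" "fst x"] M(1) fst
      by (intro mult_left_mono) (auto simp: dist_norm norm_minus_commute)
    finally have g: "norm (grad (?P (fst y)) - grad (?P (fst x))) \<le> M * norm (x - y)" .
    have "norm (\<Lambda> (snd x - snd y)) \<le> norm (snd x - snd y) * K" by (rule K(2))
    also have "\<dots> \<le> norm (x - y) * K" using snd K(1) by (intro mult_right_mono) auto
    finally have l: "norm (\<Lambda> (snd x) - \<Lambda> (snd y)) \<le> K * norm (x - y)"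
      by (simp add: \<Lambda>.diff mult.commute)
    have "f x - f y = ((grad (?P (fst y)) - grad (?P (fst x))) + (\<Lambda> (snd x) - \<Lambda> (snd y)),
        - (\<Lambda> (snd x) - \<Lambda> (snd y)))"
      by (simp add: f_def)
    also have "norm \<dots> \<le> norm ((grad (?P (fst y)) - grad (?P (fst x))) + (\<Lambda> (snd x) - \<Lambda> (snd y)))
        + norm (- (\<Lambda> (snd x) - \<Lambda> (snd y)))"
      by (rule norm_Pair_le)
    also have "\<dots> \<le> (M * norm (x - y) + K * norm (x - y)) + K * norm (x - y)"
      using norm_triangle_ineq[of "grad (?P (fst y)) - grad (?P (fst x))" "\<Lambda> (snd x) - \<Lambda> (snd y)"] g l
      by (simp add: norm_minus_commute)
    finally show ?thesis by (simp add: algebra_simps)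
  qed
  from lipschitz_ode_global_solution[of f, OF this, of "(c0, s0)"]
  obtain z where z0: "z 0 = (c0, s0)"
    and z: "\<And>t. 0 \<le> t \<Longrightarrow> (z has_vector_derivative f (z t)) (at t within {0..})"
    by blast
  show ?thesis
  proof (rule that[of "\<lambda>t. fst (z t)" "\<lambda>t. snd (z t)"])
    fix t :: real assume "0 \<le> t"
    from bounded_linear.has_vector_derivative[OF bounded_linear_fst z[OF this]]
    show "((\<lambda>t. fst (z t)) has_vector_derivative - grad (?P (fst (z t))) + \<Lambda> (snd (z t))) (at t within {0..})"
      by (simp add: f_def)
    from bounded_linear.has_vector_derivative[OF bounded_linear_snd z[OF \<open>0 \<le> t\<close>]]
    show "((\<lambda>t. snd (z t)) has_vector_derivative - \<Lambda> (snd (z t))) (at t within {0..})"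
      by (simp add: f_def)
  qed (auto simp: z0)
qed

text \<open>
  For \<open>w = c - q\<close> the equations read \<open>D w = 0\<close> and \<open>2 B q w = - B w w\<close>. On the orthogonal complement
  of the kernel the left-hand sides control \<open>|w|\<close>, while the right-hand side is quadratic in \<open>w\<close>.
\<close>

lemma locally_unique_transversal_to_kernel:
  obtains r where "r > 0"
    "\<And>c. \<lbrakk>norm (c - q) < r; D c = 0; B c c = B q q;
        \<And>u. D u = 0 \<Longrightarrow> B q u = 0 \<Longrightarrow> u \<bullet> (c - q) = 0\<rbrakk> \<Longrightarrow> c = q"
proof -
  define J where "J u = (D u, B q u)" for u
  define S where "S = orthogonal_comp {u. D u = 0 \<and> B q u = 0}"
  have J: "bounded_linear J" unfolding J_def[abs_def]
    by (intro bounded_linear_Pair D.bounded_linear_axioms B.bounded_linear_right)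
  have "closed S" "subspace S"
    unfolding S_def by (auto simp: subspace_orthogonal_comp closed_subspace)
  moreover have "w = 0" if "w \<in> S" "J w = 0" for w
    using that by (auto simp: S_def J_def orthogonal_comp_def orthogonal_def zero_prod_def)
  ultimately obtain e where e: "e > 0" "\<And>w. w \<in> S \<Longrightarrow> e * norm w \<le> norm (J w)"
    using injective_imp_isometric[OF _ _ J] by blast
  obtain K where K: "K > 0" "\<And>x y. norm (B x y) \<le> norm x * norm y * K"
    using B.pos_bounded by blast
  show ?thesis
  proof (rule that[of "2 * e / K"])
    show "2 * e / K > 0" using e K by simp
    fix c assume c: "norm (c - q) < 2 * e / K" "D c = 0" "B c c = B q q"
      and orth: "\<And>u. D u = 0 \<Longrightarrow> B q u = 0 \<Longrightarrow> u \<bullet> (c - q) = 0"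
    define w where "w = c - q"
    have "w \<in> S" using orth by (auto simp: S_def w_def orthogonal_comp_def orthogonal_def)
    have "2 *\<^sub>R B q w + B w w = 0"
      using c(3) by (simp add: w_def B.diff_left B.diff_right B_commute[of c q] scaleR_2)
    then have "norm (2 *\<^sub>R B q w) = norm (B w w)"
      by (metis add_eq_0_iff norm_minus_cancel)
    moreover have "D w = 0" using c(2) by (simp add: w_def D.diff D_target)
    ultimately have "2 * norm (J w) = norm (B w w)" by (simp add: J_def norm_Pair)
    also have "\<dots> \<le> norm w * norm w * K" by (rule K(2))
    finally have "norm w * (2 * e) \<le> norm w * (norm w * K)"
      using e(2)[OF \<open>w \<in> S\<close>] by (simp add: mult_ac)
    moreover have "norm w * K < 2 * e" using c(1) K(1) by (simp add: w_def field_simps)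
    ultimately have "w = 0" by (auto simp: mult_le_cancel_left)
    then show "c = q" by (simp add: w_def)
  qed
qed

end

section \<open>The consensus flow\<close>

text \<open>
  Summation by parts for symmetric edge weights. It serves twice: for the Laplacian, and for the work of a
  stress against a velocity field.
\<close>

lemma weighted_differences_inner:
  fixes x u :: "('v::finite) \<Rightarrow> 'a::real_inner"
  assumes sym: "\<And>i j. w i j = w j i"
  shows "2 * (\<Sum>i\<in>UNIV. (\<Sum>j\<in>UNIV. w i j *\<^sub>R (x i - x j)) \<bullet> u i) =
    (\<Sum>i\<in>UNIV. \<Sum>j\<in>UNIV. w i j * ((x i - x j) \<bullet> (u i - u j)))"
proof -
  let ?S = "\<Sum>i\<in>UNIV. \<Sum>j\<in>UNIV. w i j * ((x i - x j) \<bullet> u i)"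
  have "(\<Sum>i\<in>UNIV. \<Sum>j\<in>UNIV. w i j * ((x i - x j) \<bullet> u j)) =
      (\<Sum>i\<in>UNIV. \<Sum>j\<in>UNIV. w j i * ((x j - x i) \<bullet> u i))"
    by (rule sum.swap)
  also have "\<dots> = - ?S"
    by (simp add: sym inner_diff_left algebra_simps sum_negf sum_subtractf)
  finally have "(\<Sum>i\<in>UNIV. \<Sum>j\<in>UNIV. w i j * ((x i - x j) \<bullet> u j)) = - ?S" .
  then have "(\<Sum>i\<in>UNIV. \<Sum>j\<in>UNIV. w i j * ((x i - x j) \<bullet> (u i - u j))) = 2 * ?S"
    by (simp add: inner_diff_right right_diff_distrib sum_subtractf)
  then show ?thesis by (simp add: inner_sum_left)
qed

lemma kron_laplacian_nth:
  fixes E :: "('v::finite) set set"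
  assumes "simple_graph E"
  shows "kron_id_mult (laplacian E) x $ i = (\<Sum>j\<in>UNIV. of_bool ({i, j} \<in> E) *\<^sub>R (x $ i - x $ j))"
proof -
  have "{i} \<notin> E" using assms by (auto simp: simple_graph_def)
  then have "laplacian E $ i $ j *\<^sub>R x $ j =
      (if j = i then real (card {k. {i, k} \<in> E}) *\<^sub>R x $ i else 0) - of_bool ({i, j} \<in> E) *\<^sub>R x $ j" for j
    by (auto simp: laplacian_def)
  then have "kron_id_mult (laplacian E) x $ i =
      real (card {k. {i, k} \<in> E}) *\<^sub>R x $ i - (\<Sum>j\<in>UNIV. of_bool ({i, j} \<in> E) *\<^sub>R x $ j)"
    by (simp add: kron_id_mult_def sum_subtractf)
  also have "real (card {k. {i, k} \<in> E}) *\<^sub>R x $ i = (\<Sum>j\<in>UNIV. of_bool ({i, j} \<in> E) *\<^sub>R x $ i)"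
    by (simp add: of_bool_def if_distrib[of "\<lambda>b. b *\<^sub>R _"] sum.If_cases sum_constant_scaleR
        cong: if_cong del: sum_constant)
  finally show ?thesis by (simp add: scaleR_diff_right sum_subtractf)
qed

lemma bounded_linear_kron_id_mult: "bounded_linear (kron_id_mult M)"
  unfolding linear_conv_bounded_linear[symmetric]
  by (rule linearI)
    (auto simp: kron_id_mult_def vec_eq_iff scaleR_add_right sum.distrib scaleR_sum_right mult.commute)

lemma inner_kron_laplacian:
  fixes E :: "('v::finite) set set"
  assumes "simple_graph E"
  shows "2 * (u \<bullet> kron_id_mult (laplacian E) x) =
    (\<Sum>i\<in>UNIV. \<Sum>j\<in>UNIV. of_bool ({i, j} \<in> E) * ((x $ i - x $ j) \<bullet> (u $ i - u $ j)))"
proof -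
  have "u \<bullet> kron_id_mult (laplacian E) x =
      (\<Sum>i\<in>UNIV. (\<Sum>j\<in>UNIV. of_bool ({i, j} \<in> E) *\<^sub>R (x $ i - x $ j)) \<bullet> u $ i)"
    by (subst inner_commute) (simp add: inner_vec_def[of "kron_id_mult _ _"] kron_laplacian_nth[OF assms])
  then show ?thesis
    by (simp add: weighted_differences_inner[of "\<lambda>i j. of_bool ({i, j} \<in> E)" "\<lambda>i. x $ i" "\<lambda>i. u $ i"]
        insert_commute)
qed

text \<open>
  Testing against a constant configuration: all differences vanish.
\<close>

lemma sum_kron_laplacian:
  fixes E :: "('v::finite) set set"
  assumes "simple_graph E"
  shows "(\<Sum>i\<in>UNIV. kron_id_mult (laplacian E) x $ i) = 0"
proof -
  have "a \<bullet> (\<Sum>i\<in>UNIV. kron_id_mult (laplacian E) x $ i) = 0" for a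
    using inner_kron_laplacian[OF assms, of "\<chi> i. a" x]
    by (simp add: inner_vec_def[of "\<chi> i. a"] inner_sum_right)
  from this[of "\<Sum>i\<in>UNIV. kron_id_mult (laplacian E) x $ i"] show ?thesis by simp
qed

text \<open>
  The quadratic form is half the squared norm of the map taking a configuration to its differences along the
  edges. On a connected graph only constant configurations have no differences, and a constant
  configuration with sum zero vanishes; so this map is bounded below on configurations with sum zero.
\<close>

lemma laplacian_coercive:
  fixes E :: "('v::finite) set set"
  assumes "simple_graph E" and conn: "connected_graph UNIV E"
  obtains lam where "lam > 0"
    "\<And>x :: ('d::finite, 'v) config. (\<Sum>i\<in>UNIV. x $ i) = 0 \<Longrightarrow>
       lam * (norm x)\<^sup>2 \<le> x \<bullet> kron_id_mult (laplacian E) x"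
proof -
  define J :: "('d, 'v) config \<Rightarrow> ((real, 'd) vec, 'v \<times> 'v) vec" where
    "J x = (\<chi> e. case e of (i, j) \<Rightarrow> of_bool ({i, j} \<in> E) *\<^sub>R (x $ i - x $ j))" for x
  define S where "S = {x :: ('d, 'v) config. (\<Sum>i\<in>UNIV. x $ i) = 0}"
  have "linear J"
    by (rule linearI) (auto simp: J_def vec_eq_iff algebra_simps)
  then have J: "bounded_linear J" by (simp add: linear_conv_bounded_linear)
  have S: "subspace S"
    by (auto simp: S_def subspace_def sum.distrib simp flip: scaleR_sum_right)
  have "x = 0" if "x \<in> S" "J x = 0" for x
  proof -
    have edge: "x $ i = x $ j" if "{i, j} \<in> E" for i j
      using \<open>J x = 0\<close> that by (auto simp: J_def vec_eq_iff)
    have "x $ i = x $ j" if "(i, j) \<in> (adj_rel E)\<^sup>*" for i j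
      using that by (induction rule: rtrancl_induct) (auto simp: adj_rel_def edge)
    then have "x $ i = x $ j" for i j using conn by (auto simp: connected_graph_def)
    then have "(\<Sum>j\<in>UNIV. x $ j) = real CARD('v) *\<^sub>R x $ i" for i
      by (metis (no_types, lifting) sum.cong sum_constant_scaleR)
    then show "x = 0" using \<open>x \<in> S\<close> by (simp add: S_def vec_eq_iff)
  qed
  then obtain e where e: "e > 0" "\<And>x. x \<in> S \<Longrightarrow> e * norm x \<le> norm (J x)"
    using injective_imp_isometric[OF closed_subspace[OF S] S J] by blast
  show ?thesis
  proof (rule that[of "e\<^sup>2 / 2"])
    show "e\<^sup>2 / 2 > 0" using e by simp
    fix x :: "('d, 'v) config" assume "(\<Sum>i\<in>UNIV. x $ i) = 0"
    then have "(e * norm x)\<^sup>2 \<le> (norm (J x))\<^sup>2"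
      using e by (intro power_mono) (auto simp: S_def)
    also have "\<dots> = (\<Sum>i\<in>UNIV. \<Sum>j\<in>UNIV. of_bool ({i, j} \<in> E) * ((x $ i - x $ j) \<bullet> (x $ i - x $ j)))"
    proof -
      have "(norm (J x))\<^sup>2 = (\<Sum>(i, j)\<in>UNIV \<times> UNIV. of_bool ({i, j} \<in> E) * ((x $ i - x $ j) \<bullet> (x $ i - x $ j)))"
        unfolding power2_norm_eq_inner inner_vec_def[of "J x"] UNIV_Times_UNIV
        by (intro sum.cong) (auto simp: J_def)
      then show ?thesis by (simp only: sum.cartesian_product)
    qed
    also have "\<dots> = 2 * (x \<bullet> kron_id_mult (laplacian E) x)"
      by (rule inner_kron_laplacian[OF assms(1), symmetric])
    finally show "e\<^sup>2 / 2 * (norm x)\<^sup>2 \<le> x \<bullet> kron_id_mult (laplacian E) x"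
      by (simp add: power_mult_distrib)
  qed
qed

text \<open>
  The consensus flow preserves the centroid, so it stays in the subspace on which the Laplacian is coercive.
\<close>

lemma consensus_flow_sum_zero:
  fixes E :: "('v::finite) set set"
  assumes "simple_graph E"
    and der: "\<And>t. 0 \<le> t \<Longrightarrow> (s has_vector_derivative - kron_id_mult (laplacian E) (s t)) (at t within {0..})"
    and "(\<Sum>i\<in>UNIV. s 0 $ i) = 0" and "0 \<le> t"
  shows "(\<Sum>i\<in>UNIV. s t $ i) = 0"
proof -
  have lin: "bounded_linear (\<lambda>x. \<Sum>i\<in>UNIV. (x :: ('d::finite, 'v) config) $ i)"
    by (intro bounded_linear_sum bounded_linear_vec_nth)
  have "((\<lambda>t. \<Sum>i\<in>UNIV. s t $ i) has_vector_derivative 0) (at t within {0..})" if "t \<in> {0..}" for t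
    using bounded_linear.has_vector_derivative[OF lin der, of t] that sum_kron_laplacian[OF assms(1), of "s t"]
    by (simp add: sum_negf)
  then obtain a where "\<And>t. t \<in> {0..} \<Longrightarrow> (\<Sum>i\<in>UNIV. s t $ i) = a"
    using has_vector_derivative_zero_constant[OF convex_real_interval(1)[of 0]] by blast
  with assms(3,4) show ?thesis by (metis atLeast_iff order_refl)
qed

lemma consensus_sub_sum_zero:
  "(\<Sum>i\<in>UNIV. (x - consensus x) $ i) = 0"
  by (simp add: consensus_def sum_subtractf sum_constant_scaleR del: sum_constant)

lemma kron_laplacian_consensus:
  assumes "simple_graph E"
  shows "kron_id_mult (laplacian E) (consensus x) = 0"
  by (simp add: vec_eq_iff kron_laplacian_nth[OF assms]) (simp add: consensus_def)

section \<open>Rigid motions commuting with a symmetry\<close>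

lemma inner_orthogonal_matrix:
  assumes "orthogonal_matrix (A :: real ^ 'd ^ 'd)"
  shows "(A *v x) \<bullet> (A *v y) = x \<bullet> y"
proof -
  have "(A *v x) \<bullet> (A *v y) = ((A *v x) v* A) \<bullet> y" by (simp add: dot_lmul_matrix)
  also have "(A *v x) v* A = (transpose A ** A) *v x"
    by (simp flip: matrix_vector_mul_assoc)
  finally show ?thesis using assms by (simp add: orthogonal_matrix)
qed

lemma matrix_inv_orthogonal:
  assumes "orthogonal_matrix (A :: real ^ 'd ^ 'd)"
  shows "matrix_inv A = transpose A"
  unfolding matrix_inv_def
proof (rule some_equality)
  show "A ** transpose A = mat 1 \<and> transpose A ** A = mat 1"
    using assms by (simp add: orthogonal_matrix_def)
  fix A' assume "A ** A' = mat 1 \<and> A' ** A = mat 1"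
  then show "A' = transpose A"
    using assms by (metis matrix_mul_assoc matrix_mul_lid matrix_mul_rid orthogonal_matrix)
qed

lemma skew_inner_self:
  assumes "transpose S = - (S :: real ^ 'd ^ 'd)"
  shows "x \<bullet> (S *v x) = 0"
proof -
  have "x \<bullet> (S *v x) = (transpose S *v x) \<bullet> x" by (simp add: dot_lmul_matrix)
  also have "\<dots> = - (x \<bullet> (S *v x))"
    unfolding assms by (simp add: inner_vec_def matrix_vector_mult_def sum_negf mult.commute)
  finally show ?thesis by simp
qed

lemma matrix_diff_ldistrib: "A ** (B - C) = A ** B - A ** (C :: real ^ 'n ^ 'm)"
  by (simp add: matrix_matrix_mult_def vec_eq_iff right_diff_distrib sum_subtractf)

lemma matrix_diff_rdistrib: "(B - C) ** A = B ** A - C ** (A :: real ^ 'n ^ 'm)"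
  by (simp add: matrix_matrix_mult_def vec_eq_iff left_diff_distrib sum_subtractf)

lemma matrix_sum_rdistrib: "(B + C) ** A = B ** A + C ** (A :: real ^ 'n ^ 'm)"
  by (simp add: matrix_matrix_mult_def vec_eq_iff distrib_right sum.distrib)

text \<open>
  The Cayley transform \<open>(1 + S) (1 - S)\<inverse>\<close> of a skew matrix is a rotation; its determinant is \<open>1\<close>
  because \<open>1 + S\<close> is the transpose of \<open>1 - S\<close>. It provides, without a matrix exponential, a curve of
  rotations with a prescribed skew velocity, and it commutes with everything that commutes with \<open>S\<close>.
\<close>

lemma cayley_transform:
  assumes skew: "transpose S = - (S :: real ^ 'd ^ 'd)"
  obtains M where "(mat 1 - S) ** M = mat 1" "rotation_matrix ((mat 1 + S) ** M)"
    "\<And>B. S ** B = B ** S \<Longrightarrow> ((mat 1 + S) ** M) ** B = B ** ((mat 1 + S) ** M)"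
proof -
  define N where "N = mat 1 - S"
  define P where "P = mat 1 + S"
  have NT: "transpose N = P" and PT: "transpose P = N"
  proof -
    have "transpose (mat 1 - S) = mat 1 - transpose S" "transpose (mat 1 + S) = mat 1 + transpose S"
      by (auto simp: vec_eq_iff transpose_def mat_def)
    then show "transpose N = P" "transpose P = N" by (simp_all add: N_def P_def skew)
  qed
  have "x = 0" if "N *v x = 0" for x
  proof -
    have "S *v x = x" using that by (simp add: N_def matrix_vector_mult_diff_rdistrib)
    with skew_inner_self[OF skew, of x] have "x \<bullet> x = 0" by simp
    then show ?thesis by simp
  qed
  then obtain M where M: "M ** N = mat 1" using matrix_left_invertible_ker[of N] by blast
  then have M': "N ** M = mat 1" using matrix_left_right_inverse by blast
  have comm: "N ** P = P ** N"
    unfolding N_def P_def matrix_add_ldistrib matrix_sum_rdistrib matrix_diff_ldistrib matrix_diff_rdistrib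
      matrix_mul_lid matrix_mul_rid by (simp only: algebra_simps)
  have "transpose (P ** M) ** (P ** M) = transpose M ** ((N ** P) ** M)"
    unfolding matrix_transpose_mul PT by (simp only: matrix_mul_assoc)
  also have "\<dots> = transpose M ** (P ** (N ** M))"
    unfolding comm by (simp only: matrix_mul_assoc)
  also have "\<dots> = transpose M ** transpose N" unfolding M' NT by simp
  also have "\<dots> = transpose (N ** M)" by (rule matrix_transpose_mul[symmetric])
  also have "\<dots> = mat 1" unfolding M' by (rule transpose_mat)
  finally have "orthogonal_matrix (P ** M)" by (simp add: orthogonal_matrix)
  moreover have "det (P ** M) = 1"
  proof -
    have "det (P ** M) = det N * det M" by (simp add: det_mul flip: NT)
    also have "\<dots> = det (N ** M)" by (simp add: det_mul)
    finally show ?thesis by (simp add: M')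
  qed
  ultimately have "rotation_matrix (P ** M)" by (simp add: rotation_matrix_def)
  moreover have "(P ** M) ** B = B ** (P ** M)" if B: "S ** B = B ** S" for B
  proof -
    have N: "N ** B = B ** N" and P: "P ** B = B ** P"
      unfolding N_def P_def matrix_add_ldistrib matrix_sum_rdistrib matrix_diff_ldistrib matrix_diff_rdistrib
        matrix_mul_lid matrix_mul_rid B by (rule refl)+
    have "M ** (B ** N) ** M = M ** B ** (N ** M)" by (simp only: matrix_mul_assoc)
    moreover have "M ** (N ** B) ** M = (M ** N) ** (B ** M)" by (simp only: matrix_mul_assoc)
    ultimately have "M ** B = B ** M" unfolding N M M' by simp
    then show ?thesis by (metis P matrix_mul_assoc)
  qed
  ultimately show ?thesis using that[of M] M' by (simp add: N_def P_def)
qed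

text \<open>
  A function with a minimum at \<open>0\<close> has no linear term.
\<close>

lemma first_order_term_vanishes:
  fixes a C :: real
  assumes "\<And>t. \<bar>t\<bar> \<le> 1 \<Longrightarrow> 0 \<le> t * a + t\<^sup>2 * C" and "0 \<le> C"
  shows "a = 0"
proof (rule ccontr)
  assume "a \<noteq> 0"
  define m where "m = C + \<bar>a\<bar> + 1"
  have m: "m > 0" "C < m" "\<bar>a\<bar> \<le> m" using \<open>0 \<le> C\<close> by (auto simp: m_def)
  \<comment> \<open>a step against the sign of \<open>a\<close>, short enough for the linear term to dominate\<close>
  have "0 \<le> (- a / m) * a + (- a / m)\<^sup>2 * C"
    using m by (intro assms) (simp add: field_simps)
  also have "\<dots> = a\<^sup>2 * (C - m) / m\<^sup>2" using m by (simp add: field_simps power2_eq_square)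
  also have "\<dots> < 0" using m \<open>a \<noteq> 0\<close> by (simp add: divide_neg_pos mult_pos_neg)
  finally show False by simp
qed

lemma closed_rotation_matrices: "closed {A :: real ^ 'd ^ 'd. rotation_matrix A}"
proof -
  have "continuous_on UNIV (\<lambda>A :: real ^ 'd ^ 'd. transpose A ** A)"
    unfolding matrix_matrix_mult_def transpose_def by (intro continuous_intros)
  moreover have "continuous_on UNIV (\<lambda>A :: real ^ 'd ^ 'd. det A)"
    unfolding det_def by (intro continuous_intros)
  ultimately show ?thesis
    unfolding rotation_matrix_def orthogonal_matrix
    by (intro closed_Collect_conj closed_Collect_eq continuous_intros)
qed

lemma bounded_rotation_matrices: "bounded {A :: real ^ 'd ^ 'd. rotation_matrix A}"
proof (rule boundedI)
  fix A :: "real ^ 'd ^ 'd" assume "A \<in> {A. rotation_matrix A}"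
  then have "norm (row i A) = 1" for i
    by (simp add: rotation_matrix_def orthogonal_matrix_orthonormal_rows)
  then have "norm (A $ i) = 1" for i by (simp add: row_def)
  moreover have "norm A \<le> (\<Sum>i\<in>UNIV. norm (A $ i))"
    unfolding norm_vec_def[of A] by (rule L2_set_le_sum) auto
  ultimately show "norm A \<le> real CARD('d)" by simp
qed

text \<open>
  Pairs \<open>(A, b)\<close> stand for the rigid motions \<open>x \<mapsto> A x + b\<close> that commute with the symmetry.
\<close>

definition sym_rigid_motions ::
    "('v \<Rightarrow> 'v) set \<Rightarrow> (('v \<Rightarrow> 'v) \<Rightarrow> real ^ 'd ^ 'd::finite) \<Rightarrow> ((real ^ 'd ^ 'd) \<times> (real ^ 'd)) set" where
  "sym_rigid_motions \<Gamma> \<tau> =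
     {(A, b). rotation_matrix A \<and> (\<forall>\<gamma>\<in>\<Gamma>. A ** \<tau> \<gamma> = \<tau> \<gamma> ** A \<and> \<tau> \<gamma> *v b = b)}"

definition affine_image ::
    "real ^ 'd ^ 'd \<Rightarrow> real ^ 'd \<Rightarrow> ('d::finite, 'v::finite) config \<Rightarrow> ('d, 'v) config" where
  "affine_image A b x = (\<chi> i. A *v (x $ i) + b)"

lemma closed_sym_rigid_motions: "closed (sym_rigid_motions \<Gamma> \<tau>)"
proof -
  have "sym_rigid_motions \<Gamma> \<tau> = {A. rotation_matrix A} \<times> UNIV \<inter>
      (\<Inter>\<gamma>\<in>\<Gamma>. {p. fst p ** \<tau> \<gamma> = \<tau> \<gamma> ** fst p} \<inter> {p. \<tau> \<gamma> *v snd p = snd p})"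
    by (auto simp: sym_rigid_motions_def)
  moreover have "closed {p :: (real ^ 'd ^ 'd) \<times> (real ^ 'd). fst p ** B = B ** fst p}" for B
    unfolding matrix_matrix_mult_def by (intro closed_Collect_eq continuous_intros)
  moreover have "closed {p :: (real ^ 'd ^ 'd) \<times> (real ^ 'd). B *v snd p = snd p}" for B
    unfolding matrix_vector_mult_def by (intro closed_Collect_eq continuous_intros)
  ultimately show ?thesis
    by (auto intro!: closed_Int closed_INT closed_Times closed_rotation_matrices)
qed

text \<open>
  The rotations form a compact set, and translations that are long compared with \<open>q\<close> and \<open>c\<close> do no better
  than the identity, so the minimum is taken over a compact set.
\<close>

lemma closest_rigid_image_exists:
  fixes q c :: "('d::finite, 'v::finite) config"
  obtains A b where "(A, b) \<in> sym_rigid_motions \<Gamma> \<tau>"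
    "\<And>A' b'. (A', b') \<in> sym_rigid_motions \<Gamma> \<tau> \<Longrightarrow>
       norm (affine_image A b q - c) \<le> norm (affine_image A' b' q - c)"
proof -
  let ?G = "sym_rigid_motions \<Gamma> \<tau>"
  define f where "f p = norm (affine_image (fst p) (snd p) q - c)" for p :: "(real ^ 'd ^ 'd) \<times> (real ^ 'd)"
  define R where "R = norm (q - c) + norm q + norm c"
  have id: "(mat 1, 0) \<in> ?G"
    by (simp add: sym_rigid_motions_def rotation_matrix_def orthogonal_matrix_id)
  have f_id: "f (mat 1, 0) = norm (q - c)" by (simp add: f_def affine_image_def)
  have large: "norm (q - c) \<le> f (A, b)" if "(A, b) \<in> ?G" "norm b > R" for A b
  proof -
    fix i :: 'v
    have A: "orthogonal_matrix A" using that(1) by (simp add: sym_rigid_motions_def rotation_matrix_def)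
    let ?a = "affine_image A b q - c"
    have "b = ?a $ i + c $ i - A *v (q $ i)" by (simp add: affine_image_def)
    then have "norm b \<le> norm (?a $ i + c $ i) + norm (A *v (q $ i))" by (metis norm_triangle_ineq4)
    also have "\<dots> \<le> norm (?a $ i) + norm (c $ i) + norm (A *v (q $ i))"
      by (intro add_right_mono norm_triangle_ineq)
    also have "norm (A *v (q $ i)) = norm (q $ i)"
      using inner_orthogonal_matrix[OF A, of "q $ i" "q $ i"]
      by (simp only: norm_eq_sqrt_inner)
    also have "norm (?a $ i) + norm (c $ i) + norm (q $ i) \<le> norm ?a + norm c + norm q"
      by (intro add_mono Finite_Cartesian_Product.norm_nth_le)
    finally show ?thesis using that(2) by (simp add: R_def f_def)
  qed
  let ?K = "?G \<inter> ({A. rotation_matrix A} \<times> cball 0 R)"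
  have "compact ?K"
    by (intro closed_Int_compact closed_sym_rigid_motions compact_Times compact_cball)
      (simp add: compact_eq_bounded_closed closed_rotation_matrices bounded_rotation_matrices)
  moreover have "(mat 1, 0) \<in> ?K" using id by (simp add: sym_rigid_motions_def R_def)
  moreover have "continuous_on ?K f"
    unfolding f_def affine_image_def matrix_vector_mult_def by (intro continuous_intros)
  ultimately obtain p where p: "p \<in> ?K" "\<And>p'. p' \<in> ?K \<Longrightarrow> f p \<le> f p'"
    using continuous_attains_inf[of ?K f] by blast
  obtain A b where Ab: "p = (A, b)" by (cases p)
  show ?thesis
  proof (rule that[of A b])
    show "(A, b) \<in> ?G" using p(1) Ab by simp
    fix A' b' assume G: "(A', b') \<in> ?G"
    have "f p \<le> f (A', b')"
    proof (cases "norm b' \<le> R")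
      case True
      with G show ?thesis by (intro p) (auto simp: sym_rigid_motions_def)
    next
      case False
      then show ?thesis using p(2)[OF \<open>(mat 1, 0) \<in> ?K\<close>] large[OF G] f_id by simp
    qed
    then show "norm (affine_image A b q - c) \<le> norm (affine_image A' b' q - c)"
      by (simp add: f_def Ab)
  qed
qed

text \<open>
  If the identity is the best commuting rigid motion for bringing \<open>q\<close> near \<open>c\<close>, then no infinitesimal
  one decreases the distance to first order. The rotations used are the Cayley transforms of \<open>t S\<close>, whose
  velocity at \<open>t = 0\<close> is \<open>2 S\<close>.
\<close>

lemma infinitesimal_optimality:
  fixes q c :: "('d::finite, 'v::finite) config"
  assumes opt: "\<And>A b. (A, b) \<in> sym_rigid_motions \<Gamma> \<tau> \<Longrightarrow> norm (q - c) \<le> norm (affine_image A b q - c)"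
    and skew: "transpose S = - S"
    and comm: "\<And>\<gamma>. \<gamma> \<in> \<Gamma> \<Longrightarrow> S ** \<tau> \<gamma> = \<tau> \<gamma> ** S"
    and fixed: "\<And>\<gamma>. \<gamma> \<in> \<Gamma> \<Longrightarrow> \<tau> \<gamma> *v b = b"
  shows "affine_image S b q \<bullet> (q - c) = 0"
proof -
  define w where "w = q - c"
  define u where "u = affine_image S b q"
  define L where "L x = affine_image S 0 x" for x :: "('d, 'v) config"
  have "linear L"
    by (rule linearI; rule iffD2[OF vec_eq_iff])
      (auto simp: L_def affine_image_def matrix_vector_right_distrib matrix_vector_mult_scaleR)
  then have "bounded_linear L" by (simp add: linear_conv_bounded_linear)
  then obtain K where K: "K > 0" "\<And>x. norm (L x) \<le> norm x * K"
    using bounded_linear.pos_bounded by blast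
  define B where "B = norm q * K * K"
  have B: "B \<ge> 0" using K by (simp add: B_def)
  have key: "0 \<le> t * (4 * (w \<bullet> u)) + t\<^sup>2 * (4 * (norm w * B + (norm u + B)\<^sup>2))"
    if t: "\<bar>t\<bar> \<le> 1" for t
  proof -
    have skew': "transpose (t *\<^sub>R S) = - (t *\<^sub>R S)"
    proof -
      have "transpose (t *\<^sub>R S) = t *\<^sub>R transpose S" by (simp add: vec_eq_iff transpose_def)
      then show ?thesis by (simp add: skew)
    qed
    obtain M where M: "(mat 1 - t *\<^sub>R S) ** M = mat 1"
      and rot: "rotation_matrix ((mat 1 + t *\<^sub>R S) ** M)"
      and commM: "\<And>B. (t *\<^sub>R S) ** B = B ** (t *\<^sub>R S) \<Longrightarrow>
        ((mat 1 + t *\<^sub>R S) ** M) ** B = B ** ((mat 1 + t *\<^sub>R S) ** M)"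
      using cayley_transform[OF skew'] by blast
    define A where "A = (mat 1 + t *\<^sub>R S) ** M"
    define y where "y = affine_image M 0 q"
    have "(t *\<^sub>R S) ** \<tau> \<gamma> = \<tau> \<gamma> ** (t *\<^sub>R S)" if "\<gamma> \<in> \<Gamma>" for \<gamma>
    proof -
      have "(t *\<^sub>R S) ** \<tau> \<gamma> = t *\<^sub>R (S ** \<tau> \<gamma>)" "\<tau> \<gamma> ** (t *\<^sub>R S) = t *\<^sub>R (\<tau> \<gamma> ** S)"
        by (simp_all add: vec_eq_iff matrix_matrix_mult_def sum_distrib_left mult_ac)
      then show ?thesis using comm[OF that] by simp
    qed
    then have G: "(A, (2 * t) *\<^sub>R b) \<in> sym_rigid_motions \<Gamma> \<tau>"
      using rot commM fixed by (auto simp: sym_rigid_motions_def A_def matrix_vector_mult_scaleR)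
    have y: "y $ i - t *\<^sub>R (S *v (y $ i)) = q $ i" for i
    proof -
      have "y $ i - t *\<^sub>R (S *v (y $ i)) = ((mat 1 - t *\<^sub>R S) ** M) *v (q $ i)"
        by (simp add: y_def affine_image_def matrix_vector_mult_diff_rdistrib scaleR_matrix_vector_assoc
            flip: matrix_vector_mul_assoc)
      then show ?thesis by (simp add: M)
    qed
    have Aq: "A *v (q $ i) = y $ i + t *\<^sub>R (S *v (y $ i))" for i
      by (simp add: A_def y_def affine_image_def matrix_vector_mult_add_rdistrib scaleR_matrix_vector_assoc
          flip: matrix_vector_mul_assoc)
    have "norm y \<le> norm q"
    proof -
      have "y $ i \<bullet> y $ i \<le> q $ i \<bullet> q $ i" for i
      proof -
        have "0 \<le> (t * t) * ((S *v y $ i) \<bullet> (S *v y $ i))" by simp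
        then show ?thesis
          unfolding y[of i, symmetric] using skew_inner_self[OF skew, of "y $ i"]
          by (simp add: inner_diff_left inner_diff_right inner_commute mult.assoc)
      qed
      then show ?thesis unfolding norm_le by (simp add: inner_vec_def[of y] inner_vec_def[of q] sum_mono)
    qed
    then have v: "norm (L (L y)) \<le> B"
    proof -
      have "norm (L (L y)) \<le> norm (L y) * K" by (rule K(2))
      also have "\<dots> \<le> norm y * K * K" using K by (intro mult_right_mono) auto
      also have "\<dots> \<le> B" unfolding B_def using K \<open>norm y \<le> norm q\<close> by (intro mult_right_mono) auto
      finally show ?thesis .
    qed
    \<comment> \<open>\<open>y\<close> differs from \<open>q\<close> by \<open>t S y\<close>, so replacing \<open>S y\<close> by \<open>S q\<close> is a second-order error\<close>
    have "affine_image A ((2 * t) *\<^sub>R b) q - c = w + (2 * t) *\<^sub>R (u + t *\<^sub>R L (L y))"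
    proof (rule iffD2[OF vec_eq_iff]; intro allI)
      fix i
      have Sq: "S *v (q $ i) = S *v (y $ i) - t *\<^sub>R (S *v (S *v (y $ i)))"
        by (simp add: matrix_vector_mult_diff_distrib matrix_vector_mult_scaleR flip: y)
      have "A *v (q $ i) = q $ i + (2 * t) *\<^sub>R (S *v (y $ i))"
        unfolding Aq by (simp add: algebra_simps scaleR_2 flip: y scaleR_scaleR)
      then show "(affine_image A ((2 * t) *\<^sub>R b) q - c) $ i = (w + (2 * t) *\<^sub>R (u + t *\<^sub>R L (L y))) $ i"
        by (simp add: affine_image_def w_def u_def L_def Sq algebra_simps)
    qed
    then have "norm w \<le> norm (w + (2 * t) *\<^sub>R (u + t *\<^sub>R L (L y)))"
      using opt[OF G] by (simp only: w_def)
    then have "w \<bullet> w \<le> (w + (2 * t) *\<^sub>R (u + t *\<^sub>R L (L y))) \<bullet> (w + (2 * t) *\<^sub>R (u + t *\<^sub>R L (L y)))"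
      by (simp add: norm_le)
    also have "\<dots> = w \<bullet> w + t * (4 * (w \<bullet> u)) + t\<^sup>2 * (4 * (w \<bullet> L (L y) + (norm (u + t *\<^sub>R L (L y)))\<^sup>2))"
      unfolding power2_norm_eq_inner
      by (simp add: inner_add_left inner_add_right inner_commute algebra_simps power2_eq_square)
    also have "\<dots> \<le> w \<bullet> w + t * (4 * (w \<bullet> u)) + t\<^sup>2 * (4 * (norm w * B + (norm u + B)\<^sup>2))"
    proof -
      have "w \<bullet> L (L y) \<le> norm w * B"
        using norm_cauchy_schwarz[of w "L (L y)"] mult_left_mono[OF v, of "norm w"] by simp
      moreover have "norm (u + t *\<^sub>R L (L y)) \<le> norm u + B"
      proof -
        have "norm (u + t *\<^sub>R L (L y)) \<le> norm u + \<bar>t\<bar> * norm (L (L y))"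
          using norm_triangle_ineq[of u "t *\<^sub>R L (L y)"] by simp
        moreover have "\<bar>t\<bar> * norm (L (L y)) \<le> 1 * B" using t v by (intro mult_mono) auto
        ultimately show ?thesis by simp
      qed
      then have "(norm (u + t *\<^sub>R L (L y)))\<^sup>2 \<le> (norm u + B)\<^sup>2" by (intro power_mono) auto
      ultimately show ?thesis by (intro add_left_mono mult_left_mono add_mono) auto
    qed
    finally show ?thesis by simp
  qed
  have "4 * (w \<bullet> u) = 0"
    by (rule first_order_term_vanishes[OF key]) (use B in auto)
  then show ?thesis by (simp add: w_def u_def inner_commute)
qed

lemma norm_affine_image:
  assumes "orthogonal_matrix A"
  shows "norm (affine_image A 0 x) = norm x"
proof -
  have "norm (A *v y) = norm y" for y
    by (simp only: norm_eq_sqrt_inner inner_orthogonal_matrix[OF assms])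
  then show ?thesis
    unfolding norm_vec_def[of x] norm_vec_def[of "affine_image A 0 x"] by (simp add: affine_image_def)
qed

section \<open>Free symmetric formations and their vector field\<close>

text \<open>
  The prefix \<open>inv\<close> is taken by inversion in a group; this is the inverse of a map.
\<close>

abbreviation fun_inv :: "('a \<Rightarrow> 'b) \<Rightarrow> 'b \<Rightarrow> 'a" where
  "fun_inv \<equiv> inv_into UNIV"

lemma sum_matrix_vector_mult: "(\<Sum>k\<in>K. A k) *v (x :: real ^ 'n) = (\<Sum>k\<in>K. A k *v x)"
  by (induction K rule: infinite_finite_induct) (auto simp: matrix_vector_mult_add_rdistrib)

lemma matrix_vector_mult_sum: "A *v (\<Sum>k\<in>K. x k) = (\<Sum>k\<in>K. A *v (x k :: real ^ 'n))"
  by (induction K rule: infinite_finite_induct) (auto simp: matrix_vector_right_distrib)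

locale free_symmetry =
  fixes E :: "'v::finite set set"
    and \<Gamma> :: "('v \<Rightarrow> 'v) set"
    and \<tau> :: "('v \<Rightarrow> 'v) \<Rightarrow> real ^ 'd ^ 'd::finite"
  assumes graph: "simple_graph E"
    and sym_group: "subgroup \<Gamma> (aut_group E)"
    and free: "free_action \<Gamma>"
    and hom: "\<tau> \<in> hom (aut_group E\<lparr>carrier := \<Gamma>\<rparr>) orthogonal_group"
begin

lemma id_mem: "id \<in> \<Gamma>"
  using subgroup.one_closed[OF sym_group] by (simp add: aut_group_def)

lemma comp_mem: "g \<in> \<Gamma> \<Longrightarrow> h \<in> \<Gamma> \<Longrightarrow> g \<circ> h \<in> \<Gamma>"
  using subgroup.m_closed[OF sym_group] by (simp add: aut_group_def)

lemma automorphism: "g \<in> \<Gamma> \<Longrightarrow> bij g \<and> (\<forall>u v. {g u, g v} \<in> E \<longleftrightarrow> {u, v} \<in> E)"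
  using subgroup.subset[OF sym_group] by (auto simp: aut_group_def)

lemma bij: "g \<in> \<Gamma> \<Longrightarrow> bij g"
  using automorphism by blast

lemma edge_image_iff: "g \<in> \<Gamma> \<Longrightarrow> {g u, g v} \<in> E \<longleftrightarrow> {u, v} \<in> E"
  using automorphism by blast

lemma inv_mem:
  assumes "g \<in> \<Gamma>"
  shows "fun_inv g \<in> \<Gamma>"
proof -
  have g: "bij g" by (rule bij[OF assms])
  have "m_inv (aut_group E) g = fun_inv g"
    unfolding m_inv_def
  proof (rule the_equality)
    have "{fun_inv g u, fun_inv g v} \<in> E \<longleftrightarrow> {u, v} \<in> E" for u v
      using edge_image_iff[OF assms, of "fun_inv g u" "fun_inv g v"] g by (simp add: bij_is_surj surj_f_inv_f)
    then show "fun_inv g \<in> carrier (aut_group E) \<and>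
        g \<otimes>\<^bsub>aut_group E\<^esub> fun_inv g = \<one>\<^bsub>aut_group E\<^esub> \<and> fun_inv g \<otimes>\<^bsub>aut_group E\<^esub> g = \<one>\<^bsub>aut_group E\<^esub>"
      using g by (auto simp: aut_group_def bij_imp_bij_inv bij_is_inj bij_is_surj simp flip: surj_iff inj_iff)
  next
    fix h assume "h \<in> carrier (aut_group E) \<and>
        g \<otimes>\<^bsub>aut_group E\<^esub> h = \<one>\<^bsub>aut_group E\<^esub> \<and> h \<otimes>\<^bsub>aut_group E\<^esub> g = \<one>\<^bsub>aut_group E\<^esub>"
    then show "h = fun_inv g" by (auto simp: aut_group_def intro: inv_unique_comp[symmetric])
  qed
  with subgroup.m_inv_closed[OF sym_group assms] show ?thesis by simp
qed

lemma inv_apply: "g \<in> \<Gamma> \<Longrightarrow> fun_inv g (g i) = i" "g \<in> \<Gamma> \<Longrightarrow> g (fun_inv g i) = i"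
  using bij by (simp_all add: bij_is_inj bij_is_surj surj_f_inv_f)

lemma orthogonal: "g \<in> \<Gamma> \<Longrightarrow> orthogonal_matrix (\<tau> g)"
  using hom by (auto simp: hom_def orthogonal_group_def)

lemma \<tau>_comp: "g \<in> \<Gamma> \<Longrightarrow> h \<in> \<Gamma> \<Longrightarrow> \<tau> (g \<circ> h) = \<tau> g ** \<tau> h"
  using hom by (auto simp: hom_def orthogonal_group_def aut_group_def)

lemma inner_\<tau>: "g \<in> \<Gamma> \<Longrightarrow> (\<tau> g *v x) \<bullet> (\<tau> g *v y) = x \<bullet> y"
  by (rule inner_orthogonal_matrix[OF orthogonal])

lemma \<tau>_id: "\<tau> id = mat 1"
proof -
  have "\<tau> id ** \<tau> id = \<tau> id" using \<tau>_comp[OF id_mem id_mem] by simp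
  then have "transpose (\<tau> id) ** (\<tau> id ** \<tau> id) = transpose (\<tau> id) ** \<tau> id" by simp
  then show ?thesis
    using orthogonal[OF id_mem] by (simp add: orthogonal_matrix matrix_mul_assoc)
qed

lemma \<tau>_inv: "g \<in> \<Gamma> \<Longrightarrow> \<tau> g ** \<tau> (fun_inv g) = mat 1"
  using \<tau>_comp[OF _ inv_mem, of g g] bij[of g] by (simp add: \<tau>_id bij_is_surj surj_iff[THEN iffD1])

lemma \<tau>_transpose: "g \<in> \<Gamma> \<Longrightarrow> transpose (\<tau> g) = \<tau> (fun_inv g)"
  using \<tau>_inv[of g] orthogonal[of g]
  by (metis matrix_mul_assoc matrix_mul_lid matrix_mul_rid orthogonal_matrix)

text \<open>
  The quotient of the two elements has a fixed point, so it is the identity by freeness. This determines the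
  group element between two vertices of an orbit.
\<close>

lemma free_unique:
  assumes "g \<in> \<Gamma>" "h \<in> \<Gamma>" "g i = h i"
  shows "g = h"
proof -
  have "fun_inv g \<circ> h = id"
    using free comp_mem[OF inv_mem[OF assms(1)] assms(2)] assms(3) inv_apply(1)[OF assms(1), of i]
    by (auto simp: free_action_def)
  then have "g \<circ> (fun_inv g \<circ> h) = g" by simp
  then show ?thesis using inv_apply(2)[OF assms(1)] by (auto simp: fun_eq_iff)
qed

lemma connecting_sym_eq: "g \<in> \<Gamma> \<Longrightarrow> g u = v \<Longrightarrow> connecting_sym \<Gamma> u v = g"
  unfolding connecting_sym_def by (rule the_equality) (auto intro: free_unique)

lemma orbit_connecting_sym:
  assumes "u \<in> vertex_orbit \<Gamma> i" "v \<in> vertex_orbit \<Gamma> i"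
  shows "connecting_sym \<Gamma> u v \<in> \<Gamma>" "connecting_sym \<Gamma> u v u = v"
proof -
  obtain g h where "g \<in> \<Gamma>" "h \<in> \<Gamma>" "u = g i" "v = h i"
    using assms by (auto simp: vertex_orbit_def)
  then have "h \<circ> fun_inv g \<in> \<Gamma>" "(h \<circ> fun_inv g) u = v"
    by (simp_all add: comp_mem inv_mem inv_apply)
  then show "connecting_sym \<Gamma> u v \<in> \<Gamma>" "connecting_sym \<Gamma> u v u = v"
    by (simp_all add: connecting_sym_eq)
qed

lemma sym_config_nth: "sym_config \<Gamma> \<tau> x \<Longrightarrow> g \<in> \<Gamma> \<Longrightarrow> x $ g i = \<tau> g *v (x $ i)"
  by (simp add: sym_config_def)

end

text \<open>
  Multiplication with the transpose of the block-diagonal tree matrix. For a tree edge from \<open>u\<close> to \<open>v\<close>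
  with group element \<open>\<gamma>\<close> the entry is \<open>c $ u - transpose (\<tau> \<gamma>) *v c $ v\<close>, which vanishes if and only if
  \<open>c $ v = \<tau> \<gamma> *v c $ u\<close>. Indices that are not columns of the matrix carry the value zero.
\<close>

definition tree_defect ::
    "('v::finite \<Rightarrow> 'v) set \<Rightarrow> (('v \<Rightarrow> 'v) \<Rightarrow> real ^ 'd ^ 'd) \<Rightarrow> 'v set \<Rightarrow> ('v \<Rightarrow> ('v \<times> 'v) set) \<Rightarrow>
     ('d::finite, 'v) config \<Rightarrow> real ^ 'd ^ ('v \<times> ('v \<times> 'v))" where
  "tree_defect \<Gamma> \<tau> V0 T c =
     (\<chi> x. if x \<in> Sigma V0 T then \<Sum>w\<in>UNIV. transpose (Ebar \<Gamma> \<tau> w x) *v (c $ w) else 0)"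

lemma linear_tree_defect:
  fixes \<tau> :: "('v::finite \<Rightarrow> 'v) \<Rightarrow> real ^ 'd ^ 'd::finite"
  shows "linear (tree_defect \<Gamma> \<tau> V0 T)"
proof (rule linearI; rule iffD2[OF vec_eq_iff]; intro allI)
  fix x y :: "('d, 'v) config" and a :: real and k
  show "tree_defect \<Gamma> \<tau> V0 T (x + y) $ k = (tree_defect \<Gamma> \<tau> V0 T x + tree_defect \<Gamma> \<tau> V0 T y) $ k"
    by (simp add: tree_defect_def matrix_vector_right_distrib sum.distrib del: transpose_matrix_vector)
  show "tree_defect \<Gamma> \<tau> V0 T (a *\<^sub>R x) $ k = (a *\<^sub>R tree_defect \<Gamma> \<tau> V0 T x) $ k"
    by (simp add: tree_defect_def matrix_vector_mult_scaleR scaleR_sum_right del: transpose_matrix_vector)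
qed

lemma Q_mult_eq_adjoint:
  "Q_mult \<Gamma> \<tau> V0 T c = adjoint (tree_defect \<Gamma> \<tau> V0 T) (tree_defect \<Gamma> \<tau> V0 T c)"
proof -
  let ?D = "tree_defect \<Gamma> \<tau> V0 T" and ?e = "Ebar \<Gamma> \<tau>"
  have Q: "Q_mult \<Gamma> \<tau> V0 T c $ w = (\<Sum>x\<in>Sigma V0 T. ?e w x *v (?D c $ x))" for w
  proof -
    have "Q_mult \<Gamma> \<tau> V0 T c $ w =
        (\<Sum>z\<in>UNIV. \<Sum>x\<in>Sigma V0 T. ?e w x *v (transpose (?e z x) *v (c $ z)))"
      by (simp add: Q_mult_def Q_block_def sum_matrix_vector_mult matrix_vector_mul_assoc del: transpose_matrix_vector)
    also have "\<dots> = (\<Sum>x\<in>Sigma V0 T. \<Sum>z\<in>UNIV. ?e w x *v (transpose (?e z x) *v (c $ z)))"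
      by (rule sum.swap)
    also have "\<dots> = (\<Sum>x\<in>Sigma V0 T. ?e w x *v (?D c $ x))"
      by (intro sum.cong) (simp_all add: tree_defect_def matrix_vector_mult_sum del: transpose_matrix_vector)
    finally show ?thesis .
  qed
  have "y \<bullet> Q_mult \<Gamma> \<tau> V0 T c = y \<bullet> adjoint ?D (?D c)" for y
  proof -
    have "y \<bullet> Q_mult \<Gamma> \<tau> V0 T c = (\<Sum>w\<in>UNIV. \<Sum>x\<in>Sigma V0 T. y $ w \<bullet> (?e w x *v (?D c $ x)))"
      by (simp add: inner_vec_def[of y] Q inner_sum_right)
    also have "\<dots> = (\<Sum>x\<in>Sigma V0 T. \<Sum>w\<in>UNIV. (y $ w v* ?e w x) \<bullet> (?D c $ x))"
      unfolding dot_lmul_matrix by (rule sum.swap)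
    also have "\<dots> = (\<Sum>x\<in>Sigma V0 T. ?D y $ x \<bullet> ?D c $ x)"
      by (intro sum.cong) (simp_all add: tree_defect_def inner_sum_left)
    also have "\<dots> = ?D y \<bullet> ?D c"
      unfolding inner_vec_def[of "?D y"] by (rule sum.mono_neutral_left) (auto simp: tree_defect_def)
    also have "\<dots> = y \<bullet> adjoint ?D (?D c)" by (simp add: adjoint_works linear_tree_defect)
    finally show ?thesis .
  qed
  then show ?thesis using vector_eq_ldot by blast
qed

text \<open>
  The orbit rigidity matrix as a bilinear form: \<open>edge_form E0 \<tau> c x\<close> is its product at \<open>c\<close> with \<open>x\<close>.
  Since \<open>\<tau> \<gamma>\<close> is orthogonal, rows of loops and of other edges are given by the same expression, and the
  symmetry in \<open>c\<close> and \<open>x\<close> is apparent.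
\<close>

definition edge_form ::
    "'v gain_edge set \<Rightarrow> (('v::finite \<Rightarrow> 'v) \<Rightarrow> real ^ 'd ^ 'd) \<Rightarrow>
     ('d::finite, 'v) config \<Rightarrow> ('d, 'v) config \<Rightarrow> real ^ ('v gain_edge)" where
  "edge_form E0 \<tau> x y = (\<chi> e. if e \<in> E0 then
     (case e of (i, j, g) \<Rightarrow> (x $ i - \<tau> g *v (x $ j)) \<bullet> (y $ i - \<tau> g *v (y $ j))) else 0)"

lemma edge_form_commute: "edge_form E0 \<tau> x y = edge_form E0 \<tau> y x"
  by (auto simp: edge_form_def vec_eq_iff inner_commute)

lemma bounded_bilinear_edge_form: "bounded_bilinear (edge_form E0 \<tau>)"
proof -
  have lin: "linear (edge_form E0 \<tau> x)" for x
    by (rule linearI)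
      (auto simp: edge_form_def vec_eq_iff matrix_vector_right_distrib matrix_vector_mult_scaleR
        inner_add_right inner_diff_right algebra_simps)
  then have "linear (\<lambda>x. edge_form E0 \<tau> x y)" for y
    by (subst edge_form_commute)
  with lin show ?thesis
    by (simp add: bilinear_def flip: bilinear_conv_bounded_bilinear)
qed

locale symmetric_formation = free_symmetry E \<Gamma> \<tau>
  for E :: "'v::finite set set" and \<Gamma> :: "('v \<Rightarrow> 'v) set"
    and \<tau> :: "('v \<Rightarrow> 'v) \<Rightarrow> real ^ 'd ^ 'd::finite" +
  fixes V0 :: "'v set"
    and E0 :: "'v gain_edge set"
    and T :: "'v \<Rightarrow> ('v \<times> 'v) set"
  assumes vertex_reps: "vertex_reps \<Gamma> V0"
    and edge_reps: "edge_reps E \<Gamma> V0 E0"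
    and trees:
      "\<forall>i\<in>V0. oriented_spanning_tree (vertex_orbit \<Gamma> i) (induced_edges E (vertex_orbit \<Gamma> i)) (T i)"
begin

lemma tree_edge:
  assumes "i \<in> V0" "(u, v) \<in> T i"
  shows "u \<in> vertex_orbit \<Gamma> i" "v \<in> vertex_orbit \<Gamma> i" "u \<noteq> v"
proof -
  have "{u, v} \<in> induced_edges E (vertex_orbit \<Gamma> i)"
    using assms trees by (force simp: oriented_spanning_tree_def is_spanning_tree_def)
  then show "u \<in> vertex_orbit \<Gamma> i" "v \<in> vertex_orbit \<Gamma> i" "u \<noteq> v"
    using graph by (auto simp: induced_edges_def simple_graph_def)
qed

lemma tree_defect_nth:
  assumes "i \<in> V0" "(u, v) \<in> T i"
  shows "tree_defect \<Gamma> \<tau> V0 T c $ (i, u, v) =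
    c $ u - transpose (\<tau> (connecting_sym \<Gamma> u v)) *v (c $ v)"
proof -
  have "transpose (Ebar \<Gamma> \<tau> w (i, u, v)) *v (c $ w) =
      (if w = u then c $ u else 0) + (if w = v then - (transpose (\<tau> (connecting_sym \<Gamma> u v)) *v (c $ v)) else 0)" for w
  proof -
    have "transpose (- A) *v x = - (transpose A *v x)" for A :: "real ^ 'd ^ 'd" and x
      by (simp add: vec_eq_iff transpose_def matrix_vector_mult_def sum_negf)
    moreover have "transpose 0 *v x = 0" for x :: "real ^ 'd"
      by (simp add: vec_eq_iff transpose_def matrix_vector_mult_def)
    ultimately show ?thesis using tree_edge[OF assms] assms
      by (cases "w = u"; cases "w = v") (simp_all add: Ebar_def tree_block_def transpose_mat del: transpose_matrix_vector)
  qed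
  then show ?thesis using assms
    by (simp add: tree_defect_def sum.distrib del: transpose_matrix_vector)
qed

text \<open>
  The tree relations propagate along paths in the tree: by composing group elements, every vertex reached
  from \<open>j\<close> has the value that some group element carrying \<open>j\<close> there prescribes. The tree spans the orbit,
  and by freeness the group element found at the end of a path to \<open>g j\<close> is \<open>g\<close> itself.
\<close>

lemma tree_defect_eq_0_iff: "tree_defect \<Gamma> \<tau> V0 T c = 0 \<longleftrightarrow> sym_config \<Gamma> \<tau> c"
proof
  assume c: "sym_config \<Gamma> \<tau> c"
  have "tree_defect \<Gamma> \<tau> V0 T c $ (i, u, v) = 0" for i u v
  proof (cases "i \<in> V0 \<and> (u, v) \<in> T i")
    case True
    let ?g = "connecting_sym \<Gamma> u v"
    have g: "?g \<in> \<Gamma>" "?g u = v" using True tree_edge orbit_connecting_sym by blast+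
    have "c $ v = \<tau> ?g *v (c $ u)" using sym_config_nth[OF c g(1), of u] g(2) by simp
    then have "transpose (\<tau> ?g) *v (c $ v) = (transpose (\<tau> ?g) ** \<tau> ?g) *v (c $ u)"
      by (simp only: matrix_vector_mul_assoc)
    then show ?thesis
      using True orthogonal[OF g(1)] by (simp add: tree_defect_nth orthogonal_matrix)
  qed (auto simp: tree_defect_def)
  then show "tree_defect \<Gamma> \<tau> V0 T c = 0" by (auto simp: vec_eq_iff[where 'a = "real ^ 'd"])
next
  assume c: "tree_defect \<Gamma> \<tau> V0 T c = 0"
  have edge: "c $ v = \<tau> (connecting_sym \<Gamma> u v) *v (c $ u)" if "i \<in> V0" "(u, v) \<in> T i" for i u v
  proof -
    let ?g = "connecting_sym \<Gamma> u v"
    have g: "?g \<in> \<Gamma>" using that tree_edge orbit_connecting_sym by blast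
    have "c $ u = transpose (\<tau> ?g) *v (c $ v)"
      using tree_defect_nth[OF that, of c] c by simp
    then have "\<tau> ?g *v (c $ u) = (\<tau> ?g ** transpose (\<tau> ?g)) *v (c $ v)"
      by (simp only: matrix_vector_mul_assoc)
    then show ?thesis using orthogonal[OF g] by (simp add: orthogonal_matrix_def)
  qed
  show "sym_config \<Gamma> \<tau> c" unfolding sym_config_def
  proof (intro ballI allI)
    fix g j assume g: "g \<in> \<Gamma>"
    obtain i where i: "i \<in> V0" "i \<in> vertex_orbit \<Gamma> j" using vertex_reps unfolding vertex_reps_def by blast
    then obtain h where h: "h \<in> \<Gamma>" "i = h j" by (auto simp: vertex_orbit_def)
    have j: "j \<in> vertex_orbit \<Gamma> i" "g j \<in> vertex_orbit \<Gamma> i"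
    proof -
      have "fun_inv h i = j" "(g \<circ> fun_inv h) i = g j" using inv_apply(1)[OF h(1), of j] h(2) by simp_all
      then show "j \<in> vertex_orbit \<Gamma> i" "g j \<in> vertex_orbit \<Gamma> i"
        unfolding vertex_orbit_def mem_Collect_eq
        using inv_mem[OF h(1)] comp_mem[OF g inv_mem[OF h(1)]] by metis+
    qed
    let ?F = "(\<lambda>(u, v). {u, v}) ` T i"
    have "(j, g j) \<in> (adj_rel ?F)\<^sup>*"
      using trees i j by (auto simp: oriented_spanning_tree_def is_spanning_tree_def connected_graph_def)
    then have "\<exists>k\<in>\<Gamma>. k j = g j \<and> c $ g j = \<tau> k *v (c $ j)"
    proof (induction rule: rtrancl_induct)
      case base
      show ?case using id_mem \<tau>_id by (metis id_apply matrix_vector_mul_lid)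
    next
      case (step u v)
      then obtain k where k: "k \<in> \<Gamma>" "k j = u" "c $ u = \<tau> k *v (c $ j)" by blast
      have "(u, v) \<in> T i \<or> (v, u) \<in> T i" using step.hyps(2) by (auto simp: adj_rel_def doubleton_eq_iff)
      then obtain m where m: "m \<in> \<Gamma>" "m u = v" "c $ v = \<tau> m *v (c $ u)"
      proof
        assume uv: "(u, v) \<in> T i"
        then show ?thesis
          using orbit_connecting_sym[of u i v] tree_edge[OF i(1) uv] edge[OF i(1) uv] that by blast
      next
        assume vu: "(v, u) \<in> T i"
        let ?m = "connecting_sym \<Gamma> v u"
        have m: "?m \<in> \<Gamma>" "?m v = u"
          using orbit_connecting_sym[of v i u] tree_edge[OF i(1) vu] by auto
        have "\<tau> (fun_inv ?m) *v (c $ u) = (transpose (\<tau> ?m) ** \<tau> ?m) *v (c $ v)"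
          using edge[OF i(1) vu] by (simp only: \<tau>_transpose[OF m(1)] matrix_vector_mul_assoc)
        then have "c $ v = \<tau> (fun_inv ?m) *v (c $ u)"
          using orthogonal[OF m(1)] by (simp add: orthogonal_matrix)
        moreover have "fun_inv ?m u = v" using inv_apply(1)[OF m(1), of v] m(2) by simp
        ultimately show ?thesis using that[of "fun_inv ?m"] inv_mem[OF m(1)] by blast
      qed
      have "(m \<circ> k) j = v" using k m by simp
      moreover have "c $ v = \<tau> (m \<circ> k) *v (c $ j)"
        unfolding \<tau>_comp[OF m(1) k(1)] m(3) k(3) by (rule matrix_vector_mul_assoc)
      ultimately show ?case using comp_mem[OF m(1) k(1)] by blast
    qed
    then show "\<tau> g *v (c $ j) = c $ g j" using free_unique[OF _ g] by metis
  qed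
qed

lemma edge_rep:
  assumes "(i, j, g) \<in> E0"
  shows "i \<in> V0" "j \<in> V0" "g \<in> \<Gamma>" "{i, g j} \<in> E"
  using assms edge_reps by (auto simp: edge_reps_def lift_edge_def)

text \<open>
  In the columns of \<open>j\<close> the row contains \<open>x $ j - transpose (\<tau> g) *v x $ i\<close>, which is
  \<open>- transpose (\<tau> g)\<close> applied to the entry in the columns of \<open>i\<close>; moving the transpose to the other side
  completes the difference. For a loop the two column blocks are added.
\<close>

lemma orbit_mult_eq_edge_form:
  assumes "e \<in> E0"
  shows "orbit_mult V0 \<tau> x y e = edge_form E0 \<tau> x y $ e"
proof -
  obtain i j g where e: "e = (i, j, g)" by (cases e)
  note ij = edge_rep[OF assms[unfolded e]]
  have inv: "matrix_inv (\<tau> g) *v a = transpose (\<tau> g) *v a" for a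
    by (simp add: matrix_inv_orthogonal[OF orthogonal[OF ij(3)]])
  have tr: "(transpose (\<tau> g) *v a) \<bullet> b = a \<bullet> (\<tau> g *v b)" for a b
    by (simp add: dot_lmul_matrix)
  note orth = inner_\<tau>[OF ij(3)]
  show ?thesis
  proof (cases "i = j")
    case True
    have "orbit_mult V0 \<tau> x y e = orbit_block \<tau> x e i \<bullet> y $ i"
      unfolding orbit_mult_def using ij(1)
      by (subst sum.remove[of _ i]) (auto simp: e True orbit_block_def intro!: sum.neutral)
    also have "orbit_block \<tau> x e i = 2 *\<^sub>R x $ i - \<tau> g *v (x $ i) - transpose (\<tau> g) *v (x $ i)"
      by (simp add: e True orbit_block_def inv del: transpose_matrix_vector)
    also have "\<dots> \<bullet> y $ i = (x $ i - \<tau> g *v (x $ i)) \<bullet> (y $ i - \<tau> g *v (y $ i))"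
      unfolding inner_diff_left inner_diff_right tr orth inner_scaleR_left by simp
    also have "\<dots> = edge_form E0 \<tau> x y $ e"
      using assms by (simp add: e True edge_form_def)
    finally show ?thesis .
  next
    case False
    have "orbit_mult V0 \<tau> x y e = (\<Sum>k\<in>{i, j}. orbit_block \<tau> x e k \<bullet> y $ k)"
      unfolding orbit_mult_def using ij(1,2)
      by (intro sum.mono_neutral_right) (auto simp: e orbit_block_def False)
    then show ?thesis
      using assms False unfolding e edge_form_def
      by (simp add: orbit_block_def inv tr orth inner_diff_left inner_diff_right del: transpose_matrix_vector)
  qed
qed

lemma orbit_dist_sq_eq_edge_form:
  assumes "sym_config \<Gamma> \<tau> q" "e \<in> E0"
  shows "orbit_dist_sq q e = edge_form E0 \<tau> q q $ e"
  using assms edge_rep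
  by (cases e) (auto simp: orbit_dist_sq_def edge_form_def power2_norm_eq_inner sym_config_nth)

text \<open>
  The field is minus the gradient of the energy. The entries of the vector of desired squared lengths are the
  values of the bilinear form at the symmetric target.
\<close>

lemma formation_field_eq:
  fixes q :: "('d, 'v) config"
  assumes q: "sym_config \<Gamma> \<tau> q"
  shows "formation_field \<Gamma> \<tau> V0 E0 T (orbit_dist_sq q) c =
    - (adjoint (tree_defect \<Gamma> \<tau> V0 T) (tree_defect \<Gamma> \<tau> V0 T c)
       + adjoint (edge_form E0 \<tau> c) (edge_form E0 \<tau> c c - edge_form E0 \<tau> q q))"
proof -
  let ?B = "edge_form E0 \<tau>"
  let ?z = "?B c c - ?B q q"
  let ?F = "(\<chi> i. if i \<in> V0
      then - orbit_transpose_mult E0 \<tau> c (\<lambda>e. orbit_mult V0 \<tau> c c e - orbit_dist_sq q e) i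
      else 0) :: ('d, 'v) config"
  have lin: "linear (?B c)"
    using bounded_bilinear.bounded_linear_right[OF bounded_bilinear_edge_form]
    by (rule bounded_linear.linear)
  have "x \<bullet> ?F = x \<bullet> (- adjoint (?B c) ?z)" for x
  proof -
    have "x \<bullet> ?F = (\<Sum>k\<in>V0. x $ k \<bullet> (- orbit_transpose_mult E0 \<tau> c (\<lambda>e. ?z $ e) k))"
    proof -
      have "x \<bullet> ?F = (\<Sum>k\<in>V0. x $ k \<bullet> (- orbit_transpose_mult E0 \<tau> c
          (\<lambda>e. orbit_mult V0 \<tau> c c e - orbit_dist_sq q e) k))"
        unfolding inner_vec_def[of x] by (rule sum.mono_neutral_cong_right) auto
      then show ?thesis
        by (simp add: orbit_transpose_mult_def orbit_mult_eq_edge_form orbit_dist_sq_eq_edge_form[OF q] cong: sum.cong)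
    qed
    also have "\<dots> = - (\<Sum>e\<in>E0. ?z $ e * orbit_mult V0 \<tau> c x e)"
    proof -
      have "(\<Sum>k\<in>V0. x $ k \<bullet> orbit_transpose_mult E0 \<tau> c (\<lambda>e. ?z $ e) k) =
          (\<Sum>k\<in>V0. \<Sum>e\<in>E0. ?z $ e * (orbit_block \<tau> c e k \<bullet> x $ k))"
        by (simp add: orbit_transpose_mult_def inner_sum_right inner_commute)
      also have "\<dots> = (\<Sum>e\<in>E0. ?z $ e * orbit_mult V0 \<tau> c x e)"
        unfolding orbit_mult_def sum_distrib_left by (rule sum.swap)
      finally show ?thesis by (simp add: sum_negf)
    qed
    also have "(\<Sum>e\<in>E0. ?z $ e * orbit_mult V0 \<tau> c x e) = ?B c x \<bullet> ?z"
      unfolding inner_vec_def[of "?B c x"]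
      by (rule sum.mono_neutral_cong_left) (auto simp: orbit_mult_eq_edge_form, simp add: edge_form_def)
    finally show ?thesis by (simp add: adjoint_works lin)
  qed
  then have "?F = - adjoint (?B c) ?z" using vector_eq_ldot by blast
  then show ?thesis unfolding formation_field_def by (simp add: Q_mult_eq_adjoint)
qed

end

section \<open>Symmetric motions and symmetric stresses\<close>

text \<open>
  An undirected edge is counted once for each of its two orientations.
\<close>

lemma sum_doubleton_pairs:
  fixes \<phi> :: "'v::finite \<Rightarrow> 'v \<Rightarrow> real"
  assumes "a \<noteq> b" "\<phi> a b = \<phi> b a"
  shows "(\<Sum>i\<in>UNIV. \<Sum>j\<in>UNIV. if {i, j} = {a, b} then \<phi> i j else 0) = 2 * \<phi> a b"
proof -
  have "(\<Sum>i\<in>UNIV. \<Sum>j\<in>UNIV. if {i, j} = {a, b} then \<phi> i j else 0) =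
      (\<Sum>p\<in>UNIV \<times> UNIV. if {fst p, snd p} = {a, b} then \<phi> (fst p) (snd p) else 0)"
    by (simp add: sum.cartesian_product split_beta)
  also have "\<dots> = (\<Sum>p\<in>{(a, b), (b, a)}. \<phi> (fst p) (snd p))"
    by (rule sum.mono_neutral_cong_right) (auto simp: doubleton_eq_iff)
  also have "\<dots> = 2 * \<phi> a b" using assms by simp
  finally show ?thesis .
qed

context free_symmetry
begin

lemma bij_betw_comp_left: "h \<in> \<Gamma> \<Longrightarrow> bij_betw (\<lambda>g. h \<circ> g) \<Gamma> \<Gamma>"
  by (rule bij_betw_byWitness[where f' = "\<lambda>g. fun_inv h \<circ> g"])
    (auto simp: comp_mem inv_mem fun_eq_iff inv_apply)

lemma sum_group_comp_left: "h \<in> \<Gamma> \<Longrightarrow> (\<Sum>g\<in>\<Gamma>. f (h \<circ> g)) = (\<Sum>g\<in>\<Gamma>. f g)"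
  by (rule sum.reindex_bij_betw[OF bij_betw_comp_left])

text \<open>
  Averaging the skew matrix and the translation over the group changes neither the motion, which is
  symmetric, nor the skewness, and the averages commute with the symmetry.
\<close>

lemma symmetric_trivial_motion_commutes:
  fixes q u :: "('d, 'v) config"
  assumes q: "sym_config \<Gamma> \<tau> q" and u: "sym_config \<Gamma> \<tau> u" and triv: "trivial_motion q u"
  obtains S b where "transpose S = - S" "\<And>g. g \<in> \<Gamma> \<Longrightarrow> S ** \<tau> g = \<tau> g ** S"
    "\<And>g. g \<in> \<Gamma> \<Longrightarrow> \<tau> g *v b = b" "u = affine_image S b q"
proof -
  obtain S0 b0 where skew: "transpose S0 = - S0" and u_eq: "\<And>i. u $ i = S0 *v (q $ i) + b0"
    using triv by (auto simp: trivial_motion_def)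
  define n where "n = real (card \<Gamma>)"
  have n: "n > 0" using id_mem by (auto simp: n_def card_gt_0_iff)
  define S1 where "S1 = (\<Sum>g\<in>\<Gamma>. \<tau> g ** S0 ** transpose (\<tau> g))"
  define b1 where "b1 = (\<Sum>g\<in>\<Gamma>. \<tau> g *v b0)"
  have S1_vec: "S1 *v x = (\<Sum>g\<in>\<Gamma>. (\<tau> g ** S0 ** transpose (\<tau> g)) *v x)" for x
    by (simp add: S1_def sum_matrix_vector_mult)
  have skew1: "transpose S1 = - S1"
  proof -
    have "transpose S1 = (\<Sum>g\<in>\<Gamma>. transpose (\<tau> g ** S0 ** transpose (\<tau> g)))"
      by (simp add: S1_def transpose_def vec_eq_iff)
    also have "\<dots> = (\<Sum>g\<in>\<Gamma>. - (\<tau> g ** S0 ** transpose (\<tau> g)))"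
    proof (rule sum.cong[OF refl])
      fix g
      have "transpose (\<tau> g ** S0 ** transpose (\<tau> g)) = \<tau> g ** (0 - S0) ** transpose (\<tau> g)"
        by (simp add: matrix_transpose_mul skew matrix_mul_assoc)
      then show "transpose (\<tau> g ** S0 ** transpose (\<tau> g)) = - (\<tau> g ** S0 ** transpose (\<tau> g))"
        unfolding matrix_diff_ldistrib matrix_diff_rdistrib by simp
    qed
    finally show ?thesis by (simp add: S1_def sum_negf)
  qed
  have comm1: "\<tau> h ** S1 = S1 ** \<tau> h" if h: "h \<in> \<Gamma>" for h
  proof -
    have "(\<tau> h ** S1) *v x = (S1 ** \<tau> h) *v x" for x
    proof -
      have "(\<tau> h ** S1) *v x = (\<Sum>g\<in>\<Gamma>. (\<tau> h ** (\<tau> g ** S0 ** transpose (\<tau> g))) *v x)"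
        by (simp add: S1_vec matrix_vector_mult_sum flip: matrix_vector_mul_assoc)
      also have "\<dots> = (\<Sum>g\<in>\<Gamma>. (\<tau> (h \<circ> g) ** S0 ** transpose (\<tau> (h \<circ> g))) *v (\<tau> h *v x))"
      proof (rule sum.cong[OF refl])
        fix g assume g: "g \<in> \<Gamma>"
        have "\<tau> (h \<circ> g) ** S0 ** transpose (\<tau> (h \<circ> g)) ** \<tau> h =
            \<tau> h ** (\<tau> g ** S0 ** transpose (\<tau> g)) ** (transpose (\<tau> h) ** \<tau> h)"
          unfolding \<tau>_comp[OF h g] matrix_transpose_mul by (simp only: matrix_mul_assoc)
        also have "\<dots> = \<tau> h ** (\<tau> g ** S0 ** transpose (\<tau> g))"
          using orthogonal[OF h] by (simp add: orthogonal_matrix)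
        finally show "(\<tau> h ** (\<tau> g ** S0 ** transpose (\<tau> g))) *v x =
            (\<tau> (h \<circ> g) ** S0 ** transpose (\<tau> (h \<circ> g))) *v (\<tau> h *v x)"
          unfolding matrix_vector_mul_assoc by simp
      qed
      also have "\<dots> = (\<Sum>g\<in>\<Gamma>. (\<tau> g ** S0 ** transpose (\<tau> g)) *v (\<tau> h *v x))"
        by (rule sum_group_comp_left[OF h])
      also have "\<dots> = (S1 ** \<tau> h) *v x"
        unfolding S1_vec[symmetric] by (rule matrix_vector_mul_assoc)
      finally show ?thesis .
    qed
    then show ?thesis unfolding matrix_eq by blast
  qed
  have fix1: "\<tau> h *v b1 = b1" if h: "h \<in> \<Gamma>" for h
  proof -
    have "\<tau> h *v b1 = (\<Sum>g\<in>\<Gamma>. \<tau> (h \<circ> g) *v b0)"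
      unfolding b1_def matrix_vector_mult_sum
      by (intro sum.cong) (simp_all only: matrix_vector_mul_assoc \<tau>_comp[OF h])
    also have "\<dots> = b1" unfolding b1_def by (rule sum_group_comp_left[OF h])
    finally show ?thesis .
  qed
  have u1: "n *\<^sub>R u $ i = S1 *v (q $ i) + b1" for i
  proof -
    have "u $ i = (\<tau> g ** S0 ** transpose (\<tau> g)) *v (q $ i) + \<tau> g *v b0" if g: "g \<in> \<Gamma>" for g
    proof -
      let ?j = "fun_inv g i"
      have "u $ i = \<tau> g *v (u $ ?j)" using sym_config_nth[OF u g, of ?j] by (simp add: inv_apply g)
      also have "\<dots> = \<tau> g *v (S0 *v (q $ ?j)) + \<tau> g *v b0"
        unfolding u_eq by (rule matrix_vector_right_distrib)
      also have "q $ ?j = transpose (\<tau> g) *v (q $ i)"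
        using sym_config_nth[OF q inv_mem[OF g], of i] by (simp only: \<tau>_transpose[OF g])
      finally show ?thesis by (simp only: matrix_vector_mul_assoc matrix_mul_assoc)
    qed
    then have "(\<Sum>g\<in>\<Gamma>. u $ i) = (\<Sum>g\<in>\<Gamma>. (\<tau> g ** S0 ** transpose (\<tau> g)) *v (q $ i) + \<tau> g *v b0)"
      by (intro sum.cong) auto
    then show ?thesis by (simp add: n_def S1_vec b1_def sum.distrib sum_constant_scaleR del: sum_constant transpose_matrix_vector)
  qed
  define S where "S = (1 / n) *\<^sub>R S1"
  define b where "b = (1 / n) *\<^sub>R b1"
  show ?thesis
  proof (rule that[of S b])
    have "transpose S = (1 / n) *\<^sub>R transpose S1" by (simp add: S_def transpose_def vec_eq_iff)
    then show "transpose S = - S" by (simp add: skew1 S_def)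
    fix g assume g: "g \<in> \<Gamma>"
    have "S ** \<tau> g = (1 / n) *\<^sub>R (S1 ** \<tau> g)" "\<tau> g ** S = (1 / n) *\<^sub>R (\<tau> g ** S1)"
      by (simp_all add: S_def vec_eq_iff matrix_matrix_mult_def sum_distrib_left mult_ac)
    then show "S ** \<tau> g = \<tau> g ** S" by (simp add: comm1[OF g])
    show "\<tau> g *v b = b" by (simp add: b_def matrix_vector_mult_scaleR fix1[OF g])
  next
    show "u = affine_image S b q"
    proof (rule iffD2[OF vec_eq_iff]; intro allI)
      fix i
      have "u $ i = (1 / n) *\<^sub>R (n *\<^sub>R u $ i)" using n by simp
      also have "\<dots> = affine_image S b q $ i"
        unfolding u1 by (simp add: affine_image_def S_def b_def scaleR_add_right scaleR_matrix_vector_assoc)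
      finally show "u $ i = affine_image S b q $ i" .
    qed
  qed
qed

end

context symmetric_formation
begin

abbreviation edge_product :: "('d, 'v) config \<Rightarrow> ('d, 'v) config \<Rightarrow> 'v \<Rightarrow> 'v \<Rightarrow> real" where
  "edge_product x y i j \<equiv> (x $ i - x $ j) \<bullet> (y $ i - y $ j)"

lemma edge_product_invariant:
  assumes "sym_config \<Gamma> \<tau> x" "sym_config \<Gamma> \<tau> y" "g \<in> \<Gamma>"
  shows "edge_product x y (g i) (g j) = edge_product x y i j"
  unfolding sym_config_nth[OF assms(1,3)] sym_config_nth[OF assms(2,3)]
  by (simp add: inner_\<tau>[OF assms(3)] flip: matrix_vector_mult_diff_distrib)

lemma edge_form_symmetric:
  assumes "sym_config \<Gamma> \<tau> x" "sym_config \<Gamma> \<tau> y" "(i, j, g) \<in> E0"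
  shows "edge_form E0 \<tau> x y $ (i, j, g) = edge_product x y i (g j)"
  using assms edge_rep[OF assms(3)] by (simp add: edge_form_def sym_config_nth)

text \<open>
  The length condition is invariant under the group and every edge orbit has a representative.
\<close>

lemma inf_motion_of_edge_form_0:
  assumes q: "sym_config \<Gamma> \<tau> q" and u: "sym_config \<Gamma> \<tau> u" and 0: "edge_form E0 \<tau> q u = 0"
  shows "inf_motion E q u"
  unfolding inf_motion_def
proof (intro allI impI)
  fix a b assume "{a, b} \<in> E"
  then obtain x where x: "x \<in> E0" "lift_edge x \<in> edge_orbit \<Gamma> {a, b}"
    using edge_reps unfolding edge_reps_def by blast
  obtain i j k where ijk: "x = (i, j, k)" by (cases x)
  obtain g where g: "g \<in> \<Gamma>" "{i, k j} = {g a, g b}"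
    using x(2) by (auto simp: edge_orbit_def lift_edge_def ijk)
  have "edge_product q u i (k j) = 0"
    using edge_form_symmetric[OF q u x(1)[unfolded ijk]] 0 by simp
  moreover have "edge_product q u i (k j) = edge_product q u (g a) (g b)"
    using g(2) by (auto simp: doubleton_eq_iff inner_diff_left inner_diff_right)
  ultimately show "edge_product q u a b = 0"
    using edge_product_invariant[OF q u g(1)] by simp
qed

text \<open>
  The extension of weights on edge representatives to a stress on the graph. Summing over the group elements
  that move a representative to \<open>e\<close>, and not over a choice of one, makes invariance immediate. The
  weight of a representative is only multiplied by the order of its stabiliser.
\<close>

definition spread_stress :: "real ^ ('v gain_edge) \<Rightarrow> 'v set \<Rightarrow> real" where
  "spread_stress z e = (\<Sum>g\<in>\<Gamma>. \<Sum>x\<in>E0. if g ` lift_edge x = e then z $ x else 0)"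

lemma spread_stress_image:
  assumes h: "h \<in> \<Gamma>"
  shows "spread_stress z (h ` e) = spread_stress z e"
proof -
  have "spread_stress z (h ` e) = (\<Sum>g\<in>\<Gamma>. \<Sum>x\<in>E0. if (h \<circ> g) ` lift_edge x = h ` e then z $ x else 0)"
    unfolding spread_stress_def by (rule sum_group_comp_left[OF h, symmetric])
  also have "\<dots> = spread_stress z e"
    unfolding spread_stress_def image_comp[symmetric] inj_image_eq_iff[OF bij_is_inj[OF bij[OF h]]] ..
  finally show ?thesis .
qed

lemma image_lift_edge: "x \<in> E0 \<Longrightarrow> g \<in> \<Gamma> \<Longrightarrow> g ` lift_edge x \<in> E"
  using edge_rep edge_image_iff by (cases x) (auto simp: lift_edge_def)

lemma spread_stress_nonedge: "e \<notin> E \<Longrightarrow> spread_stress z e = 0"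
  unfolding spread_stress_def by (intro sum.neutral ballI) (use image_lift_edge in auto)

text \<open>
  Representatives are unique in their orbits, so no other representative contributes to the weight of this edge.
\<close>

lemma spread_stress_lift_edge:
  assumes x: "x \<in> E0"
  shows "spread_stress z (lift_edge x) = real (card {g \<in> \<Gamma>. g ` lift_edge x = lift_edge x}) * z $ x"
proof -
  have unique: "y = x" if "y \<in> E0" "g \<in> \<Gamma>" "g ` lift_edge y = lift_edge x" for y g
  proof -
    have "lift_edge x \<in> E" using x edge_reps by (auto simp: edge_reps_def)
    moreover have "lift_edge y = fun_inv g ` lift_edge x"
      using inv_apply[OF that(2)] by (simp add: image_image flip: that(3))
    then have "lift_edge y \<in> edge_orbit \<Gamma> (lift_edge x)"
      using inv_mem[OF that(2)] by (auto simp: edge_orbit_def)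
    moreover have "lift_edge x \<in> edge_orbit \<Gamma> (lift_edge x)"
    proof -
      have "id ` lift_edge x \<in> edge_orbit \<Gamma> (lift_edge x)"
        using id_mem unfolding edge_orbit_def by blast
      then show ?thesis by simp
    qed
    ultimately show ?thesis using x that(1) edge_reps unfolding edge_reps_def by blast
  qed
  have "(\<Sum>y\<in>E0. if g ` lift_edge y = lift_edge x then z $ y else 0) =
      (if g ` lift_edge x = lift_edge x then z $ x else 0)" if "g \<in> \<Gamma>" for g
  proof -
    have "(\<Sum>y\<in>E0. if g ` lift_edge y = lift_edge x then z $ y else 0) =
        (\<Sum>y\<in>E0. if y = x then (if g ` lift_edge x = lift_edge x then z $ x else 0) else 0)"
      using unique[OF _ that] by (intro sum.cong) auto
    also have "\<dots> = (if g ` lift_edge x = lift_edge x then z $ x else 0)"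
      using x by (subst sum.delta) auto
    finally show ?thesis .
  qed
  then show ?thesis
    by (simp add: spread_stress_def sum.If_cases Int_def)
qed

text \<open>
  The work of the stress against a symmetric velocity field equals, up to a positive factor, the pairing of the
  weights with the orbit rigidity matrix: each group element contributes the same amount, and each edge is met
  in two orientations.
\<close>

lemma spread_stress_work:
  assumes q: "sym_config \<Gamma> \<tau> q" and u: "sym_config \<Gamma> \<tau> u"
  shows "(\<Sum>i\<in>UNIV. \<Sum>j\<in>UNIV. spread_stress z {i, j} * edge_product q u i j) =
    2 * real (card \<Gamma>) * (\<Sum>x\<in>E0. z $ x * edge_form E0 \<tau> q u $ x)"
proof -
  have pair: "(\<Sum>i\<in>UNIV. \<Sum>j\<in>UNIV. if g ` lift_edge x = {i, j} then edge_product q u i j else 0) =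
      2 * edge_form E0 \<tau> q u $ x" if g: "g \<in> \<Gamma>" and x: "x \<in> E0" for g x
  proof -
    obtain i j k where ijk: "x = (i, j, k)" by (cases x)
    let ?a = "g i" and ?b = "g (k j)"
    have "?a \<noteq> ?b"
      using image_lift_edge[OF x g] graph by (auto simp: simple_graph_def lift_edge_def ijk)
    moreover have "edge_product q u ?a ?b = edge_product q u ?b ?a"
      by (simp add: inner_diff_left inner_diff_right)
    ultimately have "(\<Sum>i\<in>UNIV. \<Sum>j\<in>UNIV. if {i, j} = {?a, ?b} then edge_product q u i j else 0) =
        2 * edge_product q u ?a ?b"
      by (rule sum_doubleton_pairs)
    then show ?thesis
      using edge_form_symmetric[OF q u x[unfolded ijk]] edge_product_invariant[OF q u g]
      by (simp add: ijk lift_edge_def eq_commute[of "{g i, g (k j)}"])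
  qed
  have "(\<Sum>i\<in>UNIV. \<Sum>j\<in>UNIV. spread_stress z {i, j} * edge_product q u i j) =
      (\<Sum>i\<in>UNIV. \<Sum>j\<in>UNIV. \<Sum>g\<in>\<Gamma>. \<Sum>x\<in>E0. z $ x * (if g ` lift_edge x = {i, j} then edge_product q u i j else 0))"
    unfolding spread_stress_def sum_distrib_right by (intro sum.cong refl) simp
  also have "\<dots> = (\<Sum>i\<in>UNIV. \<Sum>g\<in>\<Gamma>. \<Sum>j\<in>UNIV. \<Sum>x\<in>E0. z $ x * (if g ` lift_edge x = {i, j} then edge_product q u i j else 0))"
    by (intro sum.cong refl sum.swap)
  also have "\<dots> = (\<Sum>g\<in>\<Gamma>. \<Sum>i\<in>UNIV. \<Sum>j\<in>UNIV. \<Sum>x\<in>E0. z $ x * (if g ` lift_edge x = {i, j} then edge_product q u i j else 0))"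
    by (rule sum.swap)
  also have "\<dots> = (\<Sum>g\<in>\<Gamma>. \<Sum>i\<in>UNIV. \<Sum>x\<in>E0. \<Sum>j\<in>UNIV. z $ x * (if g ` lift_edge x = {i, j} then edge_product q u i j else 0))"
    by (intro sum.cong refl sum.swap)
  also have "\<dots> = (\<Sum>g\<in>\<Gamma>. \<Sum>x\<in>E0. \<Sum>i\<in>UNIV. \<Sum>j\<in>UNIV. z $ x * (if g ` lift_edge x = {i, j} then edge_product q u i j else 0))"
    by (intro sum.cong refl sum.swap)
  also have "\<dots> = (\<Sum>g\<in>\<Gamma>. \<Sum>x\<in>E0. z $ x * (2 * edge_form E0 \<tau> q u $ x))"
    by (intro sum.cong refl) (simp only: pair flip: sum_distrib_left)
  also have "\<dots> = 2 * real (card \<Gamma>) * (\<Sum>x\<in>E0. z $ x * edge_form E0 \<tau> q u $ x)"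
    by (simp add: sum_distrib_left mult_ac)
  finally show ?thesis .
qed

text \<open>
  A vector \<open>z\<close> annihilated by all symmetric velocities spreads to a symmetric stress. Its resultant force field
  \<open>m\<close> is itself a symmetric velocity field, against which the stress does no work, and this work is
  \<open>|m|\<^sup>2\<close> up to a factor. Hence the forces are in equilibrium, the stress is a self-stress and vanishes.
\<close>

lemma edge_form_nondegenerate:
  assumes q: "sym_config \<Gamma> \<tau> q"
    and no_stress: "\<And>\<omega>. self_stress E q \<omega> \<Longrightarrow> sym_stress \<Gamma> E \<omega> \<Longrightarrow> \<forall>e\<in>E. \<omega> e = 0"
    and z: "\<And>x. x \<notin> E0 \<Longrightarrow> z $ x = 0"
    and orth: "\<And>u. sym_config \<Gamma> \<tau> u \<Longrightarrow> z \<bullet> edge_form E0 \<tau> q u = 0"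
  shows "z = 0"
proof -
  let ?\<omega> = "spread_stress z"
  define m :: "('d, 'v) config" where "m = (\<chi> i. \<Sum>j\<in>UNIV. ?\<omega> {i, j} *\<^sub>R (q $ i - q $ j))"
  have m_sym: "sym_config \<Gamma> \<tau> m"
    unfolding sym_config_def
  proof (intro ballI allI)
    fix h i assume h: "h \<in> \<Gamma>"
    have "m $ h i = (\<Sum>j\<in>UNIV. ?\<omega> {h i, h j} *\<^sub>R (q $ h i - q $ h j))"
      unfolding m_def using bij[OF h]
      by (simp add: sum.reindex_bij_betw[of h UNIV UNIV "\<lambda>j. ?\<omega> {h i, j} *\<^sub>R (q $ h i - q $ j)"])
    also have "\<dots> = (\<Sum>j\<in>UNIV. \<tau> h *v (?\<omega> {i, j} *\<^sub>R (q $ i - q $ j)))"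
      using spread_stress_image[OF h, of z "{i, _}"]
      by (intro sum.cong refl)
        (simp add: sym_config_nth[OF q h] matrix_vector_mult_scaleR matrix_vector_mult_diff_distrib)
    also have "\<dots> = \<tau> h *v (m $ i)" by (simp add: m_def matrix_vector_mult_sum)
    finally show "\<tau> h *v (m $ i) = m $ h i" by simp
  qed
  have "2 * (m \<bullet> m) = (\<Sum>i\<in>UNIV. \<Sum>j\<in>UNIV. ?\<omega> {i, j} * edge_product q m i j)"
    unfolding inner_vec_def[of m m]
    using weighted_differences_inner[of "\<lambda>i j. ?\<omega> {i, j}" "\<lambda>i. q $ i" "\<lambda>i. m $ i"]
    by (simp add: insert_commute) (simp add: m_def)
  also have "\<dots> = 2 * real (card \<Gamma>) * (\<Sum>x\<in>E0. z $ x * edge_form E0 \<tau> q m $ x)"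
    by (rule spread_stress_work[OF q m_sym])
  also have "(\<Sum>x\<in>E0. z $ x * edge_form E0 \<tau> q m $ x) = z \<bullet> edge_form E0 \<tau> q m"
    unfolding inner_vec_def by (rule sum.mono_neutral_cong_left) (auto simp: z)
  finally have "m = 0" by (simp add: orth[OF m_sym])
  have "self_stress E q ?\<omega>"
    unfolding self_stress_def
  proof
    fix i
    have "(\<Sum>j | {i, j} \<in> E. ?\<omega> {i, j} *\<^sub>R (q $ i - q $ j)) = m $ i"
      unfolding m_def vec_lambda_beta
      by (rule sum.mono_neutral_left) (auto simp: spread_stress_nonedge)
    then show "(\<Sum>j | {i, j} \<in> E. ?\<omega> {i, j} *\<^sub>R (q $ i - q $ j)) = 0"
      using \<open>m = 0\<close> by simp
  qed
  moreover have "sym_stress \<Gamma> E ?\<omega>"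
    by (simp add: sym_stress_def spread_stress_image)
  ultimately have \<omega>: "\<forall>e\<in>E. ?\<omega> e = 0" by (rule no_stress)
  have "z $ x = 0" for x
  proof (cases "x \<in> E0")
    case True
    then have "?\<omega> (lift_edge x) = 0" using \<omega> edge_reps by (auto simp: edge_reps_def)
    moreover have "card {g \<in> \<Gamma>. g ` lift_edge x = lift_edge x} \<noteq> 0"
      using id_mem by (auto simp: card_eq_0_iff intro!: exI[of _ id])
    ultimately show ?thesis by (simp add: spread_stress_lift_edge[OF True])
  qed (rule z)
  then show ?thesis by (simp add: vec_eq_iff)
qed

end

section \<open>Symmetric local rigidity and convergence\<close>

context symmetric_formation
begin

text \<open>
  Absence of symmetric self-stresses is the regularity of the constraints. Vectors supported on the edge
  representatives form the space in which the form takes its values.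
\<close>

lemma isostatic_quadratic_constraints:
  assumes "sym_isostatic E \<Gamma> \<tau> q"
  shows "quadratic_constraints (tree_defect \<Gamma> \<tau> V0 T) (edge_form E0 \<tau>) {z. \<forall>x. x \<notin> E0 \<longrightarrow> z $ x = 0} q"
proof (rule quadratic_constraints.intro)
  show "linear (tree_defect \<Gamma> \<tau> V0 T)" by (rule linear_tree_defect)
  show "bounded_bilinear (edge_form E0 \<tau>)" by (rule bounded_bilinear_edge_form)
  show "edge_form E0 \<tau> x y = edge_form E0 \<tau> y x" for x y by (rule edge_form_commute)
  show "tree_defect \<Gamma> \<tau> V0 T q = 0"
    using assms by (simp add: tree_defect_eq_0_iff sym_isostatic_def)
  show "subspace {z :: real ^ ('v gain_edge). \<forall>x. x \<notin> E0 \<longrightarrow> z $ x = 0}"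
    by (auto simp: subspace_def)
  show "edge_form E0 \<tau> x y \<in> {z. \<forall>x. x \<notin> E0 \<longrightarrow> z $ x = 0}" for x y
    by (simp add: edge_form_def)
  fix z assume z: "z \<in> {z. \<forall>x. x \<notin> E0 \<longrightarrow> z $ x = 0}"
    and orth: "\<And>u. tree_defect \<Gamma> \<tau> V0 T u = 0 \<Longrightarrow> z \<bullet> edge_form E0 \<tau> q u = 0"
  show "z = 0"
    by (rule edge_form_nondegenerate[of q])
      (use assms z orth in \<open>auto simp: sym_isostatic_def tree_defect_eq_0_iff\<close>)
qed

text \<open>
  The kernel of the derivative of the constraints at \<open>q\<close> consists of symmetric infinitesimal motions, which
  are trivial.
\<close>

lemma infinitesimally_rigid_kernel:
  assumes "sym_isostatic E \<Gamma> \<tau> q" "tree_defect \<Gamma> \<tau> V0 T u = 0" "edge_form E0 \<tau> q u = 0"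
  shows "sym_config \<Gamma> \<tau> u" "trivial_motion q u"
  using assms inf_motion_of_edge_form_0[of q u] by (auto simp: tree_defect_eq_0_iff sym_isostatic_def)

text \<open>
  Let \<open>(A, b)\<close> be the commuting rigid motion under which \<open>q\<close> is nearest to \<open>c\<close>. The preimage \<open>c'\<close>
  of \<open>c\<close> is again symmetric with the same lengths and at least as near to \<open>q\<close>; by optimality
  \<open>c' - q\<close> is orthogonal to the symmetric trivial motions, which are all the symmetric infinitesimal
  motions. The uniqueness assumption then gives \<open>c' = q\<close>.
\<close>

lemma symmetric_local_rigidity:
  fixes q c :: "('d, 'v) config"
  assumes iso: "sym_isostatic E \<Gamma> \<tau> q"
    and unique: "\<And>x. \<lbrakk>norm (x - q) < r; tree_defect \<Gamma> \<tau> V0 T x = 0;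
        edge_form E0 \<tau> x x = edge_form E0 \<tau> q q;
        \<And>u. tree_defect \<Gamma> \<tau> V0 T u = 0 \<Longrightarrow> edge_form E0 \<tau> q u = 0 \<Longrightarrow> u \<bullet> (x - q) = 0\<rbrakk> \<Longrightarrow> x = q"
    and near: "norm (c - q) < r" and c: "tree_defect \<Gamma> \<tau> V0 T c = 0"
    and lengths: "edge_form E0 \<tau> c c = edge_form E0 \<tau> q q"
  shows "sym_rigid_image \<Gamma> \<tau> q c"
proof -
  have q: "sym_config \<Gamma> \<tau> q" using iso by (simp add: sym_isostatic_def)
  have c_sym: "sym_config \<Gamma> \<tau> c" using c by (simp add: tree_defect_eq_0_iff)
  let ?G = "sym_rigid_motions \<Gamma> \<tau>"
  obtain A b where Ab: "(A, b) \<in> ?G"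
    and closest: "\<And>A' b'. (A', b') \<in> ?G \<Longrightarrow> norm (affine_image A b q - c) \<le> norm (affine_image A' b' q - c)"
    using closest_rigid_image_exists[where q = q and c = c and \<Gamma> = \<Gamma> and \<tau> = \<tau>] by blast
  have rot: "rotation_matrix A" and orthA: "orthogonal_matrix A"
    using Ab by (auto simp: sym_rigid_motions_def rotation_matrix_def)
  have comm: "A ** \<tau> g = \<tau> g ** A" and fixb: "\<tau> g *v b = b" if "g \<in> \<Gamma>" for g
    using Ab that by (auto simp: sym_rigid_motions_def)
  have AT: "A ** transpose A = mat 1" "transpose A ** A = mat 1"
    using orthA by (simp_all add: orthogonal_matrix_def)
  have commT: "transpose A ** \<tau> g = \<tau> g ** transpose A" if g: "g \<in> \<Gamma>" for g
  proof -
    have "transpose A ** \<tau> g = transpose A ** (\<tau> g ** A) ** transpose A"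
      by (simp only: AT matrix_mul_rid flip: matrix_mul_assoc)
    also have "\<dots> = (transpose A ** A) ** (\<tau> g ** transpose A)"
      unfolding comm[OF g, symmetric] by (simp only: matrix_mul_assoc)
    finally show ?thesis by (simp only: AT matrix_mul_lid)
  qed
  define c' :: "('d, 'v) config" where "c' = (\<chi> i. transpose A *v (c $ i - b))"
  have c'_nth: "c' $ i = transpose A *v (c $ i - b)" for i by (simp add: c'_def)
  have A_c': "A *v (c' $ i) + b = c $ i" for i
    unfolding c'_nth matrix_vector_mul_assoc AT by simp
  have moved: "affine_image (A ** A') (A *v b' + b) q - c = affine_image A 0 (affine_image A' b' q - c')" for A' b'
  proof (rule iffD2[OF vec_eq_iff]; intro allI)
    fix i
    show "(affine_image (A ** A') (A *v b' + b) q - c) $ i = affine_image A 0 (affine_image A' b' q - c') $ i"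
      by (simp add: affine_image_def matrix_vector_mult_diff_distrib matrix_vector_right_distrib
          flip: A_c'[of i] matrix_vector_mul_assoc)
  qed
  have opt: "norm (q - c') \<le> norm (affine_image A' b' q - c')" if G: "(A', b') \<in> ?G" for A' b'
  proof -
    have "(A ** A', A *v b' + b) \<in> ?G"
    proof -
      have A': "A' ** \<tau> g = \<tau> g ** A'" "\<tau> g *v b' = b'" if "g \<in> \<Gamma>" for g
        using G that by (auto simp: sym_rigid_motions_def)
      have "A ** A' ** \<tau> g = \<tau> g ** (A ** A')" if g: "g \<in> \<Gamma>" for g
        by (metis A'(1)[OF g] comm[OF g] matrix_mul_assoc)
      moreover have "\<tau> g *v (A *v b' + b) = A *v b' + b" if g: "g \<in> \<Gamma>" for g
        unfolding matrix_vector_right_distrib fixb[OF g]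
        by (metis A'(2)[OF g] comm[OF g] matrix_vector_mul_assoc)
      moreover have "rotation_matrix (A ** A')"
        using rot G by (auto simp: sym_rigid_motions_def rotation_matrix_def orthogonal_matrix_mul det_mul)
      ultimately show ?thesis by (auto simp: sym_rigid_motions_def)
    qed
    from closest[OF this] have "norm (affine_image A b q - c) \<le> norm (affine_image A' b' q - c')"
      unfolding moved norm_affine_image[OF orthA] .
    moreover have "norm (affine_image A b q - c) = norm (q - c')"
      using moved[of "mat 1" 0] by (simp add: norm_affine_image[OF orthA]) (simp add: affine_image_def)
    ultimately show ?thesis by simp
  qed
  have "norm (c' - q) \<le> norm (c - q)"
  proof -
    have "(mat 1, 0) \<in> ?G" by (simp add: sym_rigid_motions_def rotation_matrix_def orthogonal_matrix_id)
    from closest[OF this] have "norm (affine_image A b q - c) \<le> norm (q - c)"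
      by (simp add: affine_image_def)
    moreover have "norm (affine_image A b q - c) = norm (q - c')"
      using moved[of "mat 1" 0] by (simp add: norm_affine_image[OF orthA]) (simp add: affine_image_def)
    ultimately show ?thesis by (simp add: norm_minus_commute)
  qed
  moreover have "sym_config \<Gamma> \<tau> c'"
    unfolding sym_config_def c'_nth
  proof (intro ballI allI)
    fix g i assume g: "g \<in> \<Gamma>"
    show "\<tau> g *v (transpose A *v (c $ i - b)) = transpose A *v (c $ g i - b)"
      unfolding matrix_vector_mul_assoc commT[OF g, symmetric]
      unfolding matrix_vector_mul_assoc[symmetric] matrix_vector_mult_diff_distrib[of "\<tau> g"] fixb[OF g]
        sym_config_nth[OF c_sym g] ..
  qed
  moreover have "edge_form E0 \<tau> c' c' = edge_form E0 \<tau> c c"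
  proof -
    have "edge_form E0 \<tau> c' c' $ (i, j, g) = edge_form E0 \<tau> c c $ (i, j, g)" for i j g
    proof (cases "(i, j, g) \<in> E0")
      case True
      then have g: "g \<in> \<Gamma>" by (rule edge_rep)
      have "c' $ i - \<tau> g *v (c' $ j) = transpose A *v (c $ i - \<tau> g *v (c $ j))"
      proof -
        have "\<tau> g *v (c' $ j) = transpose A *v (\<tau> g *v (c $ j) - b)"
          unfolding c'_nth matrix_vector_mul_assoc commT[OF g, symmetric]
          unfolding matrix_vector_mul_assoc[symmetric] matrix_vector_mult_diff_distrib[of "\<tau> g"] fixb[OF g] ..
        then show ?thesis unfolding c'_nth by (simp flip: matrix_vector_mult_diff_distrib del: transpose_matrix_vector)
      qed
      moreover have "orthogonal_matrix (transpose A)" using orthA by simp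
      ultimately show ?thesis
        using True by (simp add: edge_form_def inner_orthogonal_matrix del: transpose_matrix_vector)
    qed (simp add: edge_form_def)
    then show ?thesis by (auto simp: vec_eq_iff)
  qed
  moreover have "u \<bullet> (c' - q) = 0"
    if "tree_defect \<Gamma> \<tau> V0 T u = 0" "edge_form E0 \<tau> q u = 0" for u
  proof -
    note u = infinitesimally_rigid_kernel[OF iso that]
    obtain S b0 where S: "transpose S = - S" "\<And>g. g \<in> \<Gamma> \<Longrightarrow> S ** \<tau> g = \<tau> g ** S"
      "\<And>g. g \<in> \<Gamma> \<Longrightarrow> \<tau> g *v b0 = b0" "u = affine_image S b0 q"
      using symmetric_trivial_motion_commutes[OF q u] by blast
    have "u \<bullet> (q - c') = 0"
      unfolding S(4) by (rule infinitesimal_optimality[OF opt S(1-3)])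
    then show ?thesis by (simp add: inner_diff_right)
  qed
  ultimately have "c' = q"
    using near lengths by (intro unique) (auto simp: tree_defect_eq_0_iff)
  then have "c $ i = A *v (q $ i) + b" for i using A_c'[of i] by simp
  then show ?thesis
    unfolding sym_rigid_image_def using rot comm fixb by blast
qed

end

theorem theorem7:
  fixes E :: "'v::finite set set"
    and \<Gamma> :: "('v \<Rightarrow> 'v) set"
    and \<tau> :: "('v \<Rightarrow> 'v) \<Rightarrow> real ^ 'd ^ 'd::finite"
    and V0 :: "'v set"
    and E0 :: "'v gain_edge set"
    and T :: "'v \<Rightarrow> ('v \<times> 'v) set"
    and pstar rstar :: "('d, 'v) config"
  assumes graph: "simple_graph E"
    and connected: "connected_graph UNIV E"
    and sym_group: "subgroup \<Gamma> (aut_group E)"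
    and free: "free_action \<Gamma>"
    and hom: "\<tau> \<in> hom (aut_group E\<lparr>carrier := \<Gamma>\<rparr>) orthogonal_group"
    and vertex_reps: "vertex_reps \<Gamma> V0"
    and edge_reps: "edge_reps E \<Gamma> V0 E0"
    and isostatic: "sym_isostatic E \<Gamma> \<tau> (pstar - rstar)"
    and orbits_connected:
      "\<forall>i. connected_graph (vertex_orbit \<Gamma> i) (induced_edges E (vertex_orbit \<Gamma> i))"
    and trees:
      "\<forall>i\<in>V0. oriented_spanning_tree (vertex_orbit \<Gamma> i) (induced_edges E (vertex_orbit \<Gamma> i)) (T i)"
  shows "\<exists>\<delta>>0. \<exists>C>0. \<exists>\<kappa>>0. \<forall>p0 r0.
           consensus r0 = rstar \<and> norm (p0 - pstar) < \<delta> \<and> norm (r0 - rstar) < \<delta> \<longrightarrow>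
             (\<exists>p r. cascade_solution E \<Gamma> \<tau> V0 E0 T (orbit_dist_sq (pstar - rstar)) p r \<and>
                p 0 = p0 \<and> r 0 = r0) \<and>
             (\<forall>p r. cascade_solution E \<Gamma> \<tau> V0 E0 T (orbit_dist_sq (pstar - rstar)) p r \<and>
                p 0 = p0 \<and> r 0 = r0 \<longrightarrow>
                (\<exists>plim. sym_rigid_image \<Gamma> \<tau> (pstar - rstar) (plim - rstar) \<and>
                   (sym_pinned \<Gamma> \<tau> (pstar - rstar) \<longrightarrow> plim = pstar) \<and>
                   norm (plim - pstar) \<le> C * (norm (p0 - pstar) + norm (r0 - rstar)) \<and>
                   (\<forall>t\<ge>0. norm (p t - plim)
                        \<le> C * (norm (p0 - pstar) + norm (r0 - rstar)) * exp (- \<kappa> * t))))"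
proof -
  define q where "q = pstar - rstar"
  have iso: "sym_isostatic E \<Gamma> \<tau> q" using isostatic by (simp add: q_def)
  interpret F: symmetric_formation E \<Gamma> \<tau> V0 E0 T
    by (intro symmetric_formation.intro free_symmetry.intro symmetric_formation_axioms.intro)
      (fact graph sym_group free hom vertex_reps edge_reps trees)+
  let ?D = "tree_defect \<Gamma> \<tau> V0 T" and ?B = "edge_form E0 \<tau>"
  let ?\<Lambda> = "kron_id_mult (laplacian E) :: ('d, 'v) config \<Rightarrow> ('d, 'v) config"
  let ?f = "formation_field \<Gamma> \<tau> V0 E0 T (orbit_dist_sq q)"
  interpret Q: quadratic_constraints ?D ?B "{z. \<forall>x. x \<notin> E0 \<longrightarrow> z $ x = 0}" q
    by (rule F.isostatic_quadratic_constraints[OF iso])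
  have field: "?f c = - Q.grad c" for c
    using iso by (simp add: F.formation_field_eq sym_isostatic_def Q.grad_def Q.resid_def)
  have lin: "bounded_linear ?\<Lambda>" by (rule bounded_linear_kron_id_mult)
  interpret \<Lambda>: bounded_linear ?\<Lambda> by (rule lin)
  obtain lam where lam: "lam > 0"
    and coercive: "\<And>x :: ('d, 'v) config. (\<Sum>i\<in>UNIV. x $ i) = 0 \<Longrightarrow> lam * (norm x)\<^sup>2 \<le> x \<bullet> ?\<Lambda> x"
    using laplacian_coercive[OF graph connected] by blast
  obtain \<rho> \<delta>\<^sub>1 C \<kappa> where pos: "\<rho> > 0" "\<delta>\<^sub>1 > 0" "C > 0" "\<kappa> > 0"
    and flow: "\<And>c s v. \<lbrakk>\<And>t. 0 \<le> t \<Longrightarrow> (c has_vector_derivative v t) (at t within {0..});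
        \<And>t. 0 \<le> t \<Longrightarrow> c t \<in> cball q \<rho> \<Longrightarrow> v t = - Q.grad (c t) + ?\<Lambda> (s t);
        \<And>t. 0 \<le> t \<Longrightarrow> (s has_vector_derivative - ?\<Lambda> (s t)) (at t within {0..});
        \<And>t. 0 \<le> t \<Longrightarrow> lam * (norm (s t))\<^sup>2 \<le> s t \<bullet> ?\<Lambda> (s t);
        norm (c 0 - q) + norm (s 0) < \<delta>\<^sub>1\<rbrakk> \<Longrightarrow>
      (\<forall>t\<ge>0. c t \<in> cball q \<rho>) \<and>
      (\<exists>l. ?D l = 0 \<and> ?B l l = ?B q q \<and>
         norm (l - q) \<le> C * (norm (c 0 - q) + norm (s 0)) \<and>
         (\<forall>t\<ge>0. norm (c t - l) \<le> C * (norm (c 0 - q) + norm (s 0)) * exp (- \<kappa> * t)))"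
    using Q.perturbed_gradient_flow_converges[OF lin lam] by blast
  obtain r1 where r1: "r1 > 0"
    and unique: "\<And>x. \<lbrakk>norm (x - q) < r1; ?D x = 0; ?B x x = ?B q q;
        \<And>u. ?D u = 0 \<Longrightarrow> ?B q u = 0 \<Longrightarrow> u \<bullet> (x - q) = 0\<rbrakk> \<Longrightarrow> x = q"
    using Q.locally_unique_transversal_to_kernel by blast
  \<comment> \<open>the initial error \<open>|c 0 - q| + |s 0|\<close> is at most \<open>2 \<epsilon> < 4 \<delta>\<close>; the second bound brings the limit
    into the ball in which rigidity holds\<close>
  define \<delta> where "\<delta> = min (\<delta>\<^sub>1 / 4) (r1 / (4 * C))"
  define C' where "C' = 2 * C + 1"
  define \<kappa>' where "\<kappa>' = min \<kappa> lam"
  have "\<delta> > 0" "C' > 0" "\<kappa>' > 0" using pos lam r1 by (auto simp: \<delta>_def C'_def \<kappa>'_def)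
  moreover
  {
    fix p0 r0 :: "('d, 'v) config"
    assume r0: "consensus r0 = rstar" and p0_near: "norm (p0 - pstar) < \<delta>" and r0_near: "norm (r0 - rstar) < \<delta>"
    let ?\<epsilon> = "norm (p0 - pstar) + norm (r0 - rstar)"
    have \<Lambda>_rstar: "?\<Lambda> rstar = 0" using kron_laplacian_consensus[OF graph, of r0] r0 by simp
    have sum0: "(\<Sum>i\<in>UNIV. (r0 - rstar) $ i) = 0" unfolding r0[symmetric] by (rule consensus_sub_sum_zero)
    have init: "norm ((p0 - r0) - q) + norm (r0 - rstar) \<le> 2 * ?\<epsilon>"
    proof -
      have "(p0 - r0) - q = (p0 - pstar) - (r0 - rstar)" by (simp add: q_def)
      then have "norm ((p0 - r0) - q) \<le> norm (p0 - pstar) + norm (r0 - rstar)"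
        by (metis norm_triangle_ineq4)
      then have "norm ((p0 - r0) - q) + norm (r0 - rstar) \<le> ?\<epsilon> + norm (r0 - rstar)"
        by (rule add_right_mono)
      also have "\<dots> \<le> ?\<epsilon> + ?\<epsilon>" by simp
      finally show ?thesis by simp
    qed
    then have init_small: "norm ((p0 - r0) - q) + norm (r0 - rstar) < \<delta>\<^sub>1"
      and C_init: "C * (norm ((p0 - r0) - q) + norm (r0 - rstar)) \<le> 2 * C * ?\<epsilon>"
      and C_small: "2 * C * ?\<epsilon> < r1"
    proof -
      have "4 * \<delta> \<le> \<delta>\<^sub>1" "4 * \<delta> * C \<le> r1" using pos by (auto simp: \<delta>_def min_def field_simps)
      moreover have "?\<epsilon> < 2 * \<delta>" using p0_near r0_near by simp
      ultimately show "norm ((p0 - r0) - q) + norm (r0 - rstar) < \<delta>\<^sub>1" using init by simp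
      have "2 * C * ?\<epsilon> < 2 * C * (2 * \<delta>)"
        using \<open>?\<epsilon> < 2 * \<delta>\<close> pos by (intro mult_strict_left_mono) auto
      also have "\<dots> \<le> r1" using \<open>4 * \<delta> * C \<le> r1\<close> by (simp add: mult_ac)
      finally show "2 * C * ?\<epsilon> < r1" .
      show "C * (norm ((p0 - r0) - q) + norm (r0 - rstar)) \<le> 2 * C * ?\<epsilon>"
        using mult_left_mono[OF init, of C] pos by simp
    qed
    have consensus_coercive: "lam * (norm (s t))\<^sup>2 \<le> s t \<bullet> ?\<Lambda> (s t)"
      if "s 0 = r0 - rstar" "0 \<le> t"
        "\<And>t. 0 \<le> t \<Longrightarrow> (s has_vector_derivative - ?\<Lambda> (s t)) (at t within {0..})" for s t
    proof -
      have "(\<Sum>i\<in>UNIV. s 0 $ i) = 0" unfolding that(1) by (rule sum0)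
      from consensus_flow_sum_zero[OF graph that(3) this that(2)] show ?thesis by (rule coercive)
    qed
    have "\<exists>p r. cascade_solution E \<Gamma> \<tau> V0 E0 T (orbit_dist_sq q) p r \<and> p 0 = p0 \<and> r 0 = r0"
    proof -
      obtain c s where c0: "c 0 = p0 - r0" and s0: "s 0 = r0 - rstar"
        and c': "\<And>t. 0 \<le> t \<Longrightarrow> (c has_vector_derivative
            - Q.grad (closest_point (cball q \<rho>) (c t)) + ?\<Lambda> (s t)) (at t within {0..})"
        and s': "\<And>t. 0 \<le> t \<Longrightarrow> (s has_vector_derivative - ?\<Lambda> (s t)) (at t within {0..})"
        using Q.truncated_flow_solution[OF lin pos(1), of "p0 - r0" "r0 - rstar"] by blast
      have ball: "c t \<in> cball q \<rho>" if "0 \<le> t" for t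
      proof -
        have "norm (c 0 - q) + norm (s 0) < \<delta>\<^sub>1" unfolding c0 s0 by (rule init_small)
        from flow[OF c' _ s' consensus_coercive[OF s0 _ s'] this] that
        show ?thesis by (simp only: closest_point_self)
      qed
      have "cascade_solution E \<Gamma> \<tau> V0 E0 T (orbit_dist_sq q) (\<lambda>t. c t + s t + rstar) (\<lambda>t. s t + rstar)"
        unfolding cascade_solution_def
      proof (intro allI impI conjI)
        fix t :: real assume t: "0 \<le> t"
        show "((\<lambda>t. s t + rstar) has_vector_derivative - ?\<Lambda> (s t + rstar)) (at t within {0..})"
          using has_vector_derivative_add[OF s'[OF t] has_vector_derivative_const[of rstar]]
          by (simp add: \<Lambda>.add \<Lambda>_rstar)
        have "(c has_vector_derivative - Q.grad (c t) + ?\<Lambda> (s t)) (at t within {0..})"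
          using c'[OF t] by (simp add: closest_point_self[OF ball[OF t]])
        from has_vector_derivative_add[OF has_vector_derivative_add[OF this s'[OF t]] has_vector_derivative_const[of rstar]]
        show "((\<lambda>t. c t + s t + rstar) has_vector_derivative ?f (c t + s t + rstar - (s t + rstar))) (at t within {0..})"
          by (simp add: field)
      qed
      then show ?thesis
        by (intro exI[of _ "\<lambda>t. c t + s t + rstar"] exI[of _ "\<lambda>t. s t + rstar"]) (simp add: c0 s0)
    qed
    moreover have "\<exists>plim. sym_rigid_image \<Gamma> \<tau> q (plim - rstar) \<and>
        (sym_pinned \<Gamma> \<tau> q \<longrightarrow> plim = pstar) \<and>
        norm (plim - pstar) \<le> C' * ?\<epsilon> \<and>
        (\<forall>t\<ge>0. norm (p t - plim) \<le> C' * ?\<epsilon> * exp (- \<kappa>' * t))"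
      if sol: "cascade_solution E \<Gamma> \<tau> V0 E0 T (orbit_dist_sq q) p r" and p_0: "p 0 = p0" and r_0: "r 0 = r0" for p r
    proof -
      define c where "c t = p t - r t" for t
      define s where "s t = r t - rstar" for t
      have r': "(r has_vector_derivative - ?\<Lambda> (r t)) (at t within {0..})"
        and p': "(p has_vector_derivative ?f (c t)) (at t within {0..})" if "0 \<le> t" for t
        using sol that by (auto simp: cascade_solution_def c_def)
      have \<Lambda>_s: "?\<Lambda> (s t) = ?\<Lambda> (r t)" for t by (simp add: s_def \<Lambda>.diff \<Lambda>_rstar)
      have s': "(s has_vector_derivative - ?\<Lambda> (s t)) (at t within {0..})" if "0 \<le> t" for t
        using has_vector_derivative_diff[OF r'[OF that] has_vector_derivative_const[of rstar]]
        unfolding \<Lambda>_s by (simp add: s_def[abs_def])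
      have c': "(c has_vector_derivative - Q.grad (c t) + ?\<Lambda> (s t)) (at t within {0..})" if "0 \<le> t" for t
        using has_vector_derivative_diff[OF p'[OF that] r'[OF that]]
        unfolding \<Lambda>_s field by (simp add: c_def[abs_def])
      have s0: "s 0 = r0 - rstar" and c0: "c 0 = p0 - r0" by (simp_all add: s_def c_def p_0 r_0)
      have s_coercive: "lam * (norm (s t))\<^sup>2 \<le> s t \<bullet> ?\<Lambda> (s t)" if "0 \<le> t" for t
        by (rule consensus_coercive[OF s0 that s'])
      have "norm (c 0 - q) + norm (s 0) < \<delta>\<^sub>1" using init_small by (simp add: c0 s0)
      from flow[OF c' refl s' s_coercive this]
      obtain l where l: "?D l = 0" "?B l l = ?B q q" "norm (l - q) \<le> C * (norm (c 0 - q) + norm (s 0))"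
        and l_lim: "\<And>t. 0 \<le> t \<Longrightarrow> norm (c t - l) \<le> C * (norm (c 0 - q) + norm (s 0)) * exp (- \<kappa> * t)"
        by blast
      have l_q: "norm (l - q) \<le> 2 * C * ?\<epsilon>" using l(3) C_init by (simp add: c0 s0)
      then have l_near: "norm (l - q) < r1" using C_small by simp
      have "sym_rigid_image \<Gamma> \<tau> q l"
        by (rule F.symmetric_local_rigidity[OF iso unique l_near l(1,2)])
      moreover have "l = q" if pinned: "sym_pinned \<Gamma> \<tau> q"
      proof (rule unique[OF l_near l(1,2)])
        fix u assume "?D u = 0" "?B q u = 0"
        with F.infinitesimally_rigid_kernel[OF iso this] pinned have "u = 0"
          by (simp add: sym_pinned_def)
        then show "u \<bullet> (l - q) = 0" by simp
      qed
      moreover have "norm (l - q) \<le> C' * ?\<epsilon>"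
      proof -
        have "2 * C * ?\<epsilon> \<le> C' * ?\<epsilon>" by (intro mult_right_mono) (auto simp: C'_def)
        with l_q show ?thesis by simp
      qed
      moreover have "norm (p t - (l + rstar)) \<le> C' * ?\<epsilon> * exp (- \<kappa>' * t)" if t: "0 \<le> t" for t
      proof -
        have "p t - (l + rstar) = (c t - l) + s t" by (simp add: c_def s_def)
        then have "norm (p t - (l + rstar)) \<le> norm (c t - l) + norm (s t)" by (metis norm_triangle_ineq)
        moreover have "norm (c t - l) \<le> 2 * C * ?\<epsilon> * exp (- \<kappa>' * t)"
        proof -
          have "norm (c t - l) \<le> C * (norm (c 0 - q) + norm (s 0)) * exp (- \<kappa> * t)" by (rule l_lim[OF t])
          also have "\<dots> \<le> 2 * C * ?\<epsilon> * exp (- \<kappa>' * t)"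
          proof (rule mult_mono)
            show "C * (norm (c 0 - q) + norm (s 0)) \<le> 2 * C * ?\<epsilon>" unfolding c0 s0 by (rule C_init)
            show "exp (- \<kappa> * t) \<le> exp (- \<kappa>' * t)" using t by (simp add: \<kappa>'_def mult_right_mono)
          qed (use pos in auto)
          finally show ?thesis .
        qed
        moreover have "norm (s t) \<le> ?\<epsilon> * exp (- \<kappa>' * t)"
        proof -
          have "norm (s t) \<le> norm (s 0) * exp (- lam * t)"
            by (rule exponential_decay_of_coercive[OF s' s_coercive t])
          also have "\<dots> \<le> ?\<epsilon> * exp (- \<kappa>' * t)"
            using t by (intro mult_mono) (auto simp: s0 \<kappa>'_def mult_right_mono)
          finally show ?thesis .
        qed
        ultimately show ?thesis by (simp add: C'_def algebra_simps)
      qed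
      ultimately show ?thesis
        by (intro exI[of _ "l + rstar"]) (auto simp: q_def diff_diff_eq2)
    qed
    ultimately have "(\<exists>p r. cascade_solution E \<Gamma> \<tau> V0 E0 T (orbit_dist_sq q) p r \<and> p 0 = p0 \<and> r 0 = r0) \<and>
        (\<forall>p r. cascade_solution E \<Gamma> \<tau> V0 E0 T (orbit_dist_sq q) p r \<and> p 0 = p0 \<and> r 0 = r0 \<longrightarrow>
          (\<exists>plim. sym_rigid_image \<Gamma> \<tau> q (plim - rstar) \<and>
            (sym_pinned \<Gamma> \<tau> q \<longrightarrow> plim = pstar) \<and>
            norm (plim - pstar) \<le> C' * ?\<epsilon> \<and>
            (\<forall>t\<ge>0. norm (p t - plim) \<le> C' * ?\<epsilon> * exp (- \<kappa>' * t))))"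
      by blast
  }
  ultimately show ?thesis unfolding q_def[symmetric] by blast
qed

end
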